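(* Let $\Omega^1$ be a pivotal $A$-bimodule with dual $\mathfrak{X}^1$. The map $S:H(\Omega^1)\to H(\Omega^1)$ defined on generators by $$S(a)=\overline{a},\quad S(\overline{a})=a,\quad S((x,\omega))=(\omega,x),\quad S((\omega,x))=(x,\omega)\qquad(a\in A,\ \omega\in\Omega^1,\ x\in\mathfrak{X}^1)$$ and extended anti-multiplicatively to $H(\Omega^1)$ is a well-defined anti-algebra automorphism of $H(\Omega^1)$ with $S^{-1}=S$, and it satisfies the conditions of a Böhm–Szlachányi Hopf algebroid, i.e. $S(\overline{a})=a$ for all $a\in A$ and, for all $b\in H(\Omega^1)$, $$S(b_{(1)})_{(1)}\bullet b_{(2)}\diamond S(b_{(1)})_{(2)}=1\diamond S(b),\qquad S^{-1}(b_{(2)})_{(1)}\diamond S^{-1}(b_{(2)})_{(2)}\bullet b_{(1)}=S^{-1}(b)\diamond1 .$$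
   Context: Conventions. $\mathbb{K}$ is a field, $A$ a unital associative $\mathbb{K}$-algebra, $\otimes$ means $\otimes_A$. $A^{op}=\{\overline{a}: a\in A\}$ with $\overline{a}\,\overline{b}=\overline{ba}$; $A^e=A\otimes_{\mathbb{K}}A^{op}$ with elements written $a\overline{b}$. Summation over repeated dual-basis indices is implicit. $T_{A^e}(V)$ is the tensor algebra of an $A^e$-bimodule $V$. For an algebra $B$ with an algebra map $A^e\to B$, write $a,\overline{a}$ for the images of $a,\overline{a}$, and $B\diamond B=B\otimes_{\mathbb{K}}B/\langle\overline{s}b\otimes b'-b\otimes sb' : b,b'\in B, s\in A\rangle$; with $|B$ denoting $B$ as an $A$-bimodule via $r\cdot b\cdot s=r\overline{s}b$, this is $|B\otimes|B$, the target of the coproduct, $\Delta(b)=b_{(1)}\otimes b_{(2)}$. Pivotal bimodules. $\Omega^1$ is pivotal if it is finitely generated projective on both sides and its left dual $\mathrm{Hom}_A(\Omega^1,A)$ and right dual ${}_A\mathrm{Hom}(\Omega^1,A)$ are isomorphic as bimodules. Fixing such an isomorphism, a single bimodule $\mathfrak{X}^1$ is both left and right dual of $\Omega^1$, with bimodule maps $\mathrm{ev}:\mathfrak{X}^1\otimes\Omega^1\to A$, $\mathrm{coev}:A\to\Omega^1\otimes\mathfrak{X}^1$, $\mathrm{coev}(1)=\omega_i\otimes x_i$, $\underline{\mathrm{ev}}:\Omega^1\otimes\mathfrak{X}^1\to A$, $\underline{\mathrm{coev}}:A\to\mathfrak{X}^1\otimes\Omega^1$, $\underline{\mathrm{coev}}(1)=y_j\otimes\rho_j$,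 satisfying $\omega=\omega_i\,\mathrm{ev}(x_i\otimes\omega)=\underline{\mathrm{ev}}(\omega\otimes y_j)\rho_j$ and $x=\mathrm{ev}(x\otimes\omega_i)x_i=y_j\,\underline{\mathrm{ev}}(\rho_j\otimes x)$. The bialgebroid $H(\Omega^1)$. Let $\mathfrak{Z}=(\mathfrak{X}^1\otimes_{\mathbb{K}}\Omega^1)\oplus(\Omega^1\otimes_{\mathbb{K}}\mathfrak{X}^1)$; write $(x,\omega)$ for $x\otimes_{\mathbb{K}}\omega$ in the first summand and $(\omega,x)$ for $\omega\otimes_{\mathbb{K}}x$ in the second. $\mathfrak{Z}$ is an $A^e$-bimodule via $a\overline{a'}(x,\omega)b\overline{b'}=(axb,b'\omega a')$ and $a\overline{a'}(\omega,x)b\overline{b'}=(a\omega b,b'xa')$. $H(\Omega^1)$ is the quotient of $T_{A^e}(\mathfrak{Z})$ (product $\bullet$) by the ideal generated by, for all $x\in\mathfrak{X}^1$, $\omega\in\Omega^1$, $$(\omega_i,x)\bullet(x_i,\omega)=\overline{\underline{\mathrm{ev}}(\omega\otimes x)},\qquad (x,\rho_j)\bullet(\omega,y_j)=\mathrm{ev}(x\otimes\omega),$$ $$(y_j,\omega)\bullet(\rho_j,x)=\overline{\mathrm{ev}(x\otimes\omega)},\qquad (\omega,x_i)\bullet(x,\omega_i)=\underline{\mathrm{ev}}(\omega\otimes x).$$ It is a left $A$-bialgebroid with $\Delta(a\overline{b})=a\otimes\overline{b}$, $\Delta((x,\omega))=(x,\omega_i)\otimes(x_i,\omega)$, $\Delta((\omega,x))=(\omega,y_j)\otimes(\rho_j,x)$,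 $\epsilon(a\overline{b})=ab$, $\epsilon((x,\omega))=\mathrm{ev}(x\otimes\omega)$, $\epsilon((\omega,x))=\underline{\mathrm{ev}}(\omega\otimes x)$, extended by $\Delta(m\bullet n)=m_{(1)}\bullet n_{(1)}\otimes m_{(2)}\bullet n_{(2)}$ and $\epsilon(m\bullet n)=\epsilon(m\bullet\epsilon(n))$. *)

theory Defs
  imports
    "HOL-Algebra.Module"
    "HOL-Algebra.QuotRing"
    "HOL-Algebra.Chinese_Remainder"
    "HOL-Algebra.Generated_Groups"
    "HOL-Algebra.Free_Abelian_Groups"
begin

section \<open>Algebras and bimodules\<close>

definition opp :: "('a, 'm) ring_scheme \<Rightarrow> ('a, 'm) ring_scheme" where
  "opp R = R\<lparr>mult := \<lambda>x y. y \<otimes>\<^bsub>R\<^esub> x\<rparr>"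

text \<open>The locale \<open>algebra\<close> of the library is about commutative algebras.\<close>

locale unital_algebra = K?: field K + A?: ring A + module K A
  for K :: "('k, 'm) ring_scheme" (structure) and A :: "('k, 'a, 'n) module_scheme" (structure) +
  assumes smult_mult_l: "\<lbrakk>k \<in> carrier K; a \<in> carrier A; b \<in> carrier A\<rbrakk>
      \<Longrightarrow> k \<odot>\<^bsub>A\<^esub> (a \<otimes>\<^bsub>A\<^esub> b) = (k \<odot>\<^bsub>A\<^esub> a) \<otimes>\<^bsub>A\<^esub> b"
    and smult_mult_r: "\<lbrakk>k \<in> carrier K; a \<in> carrier A; b \<in> carrier A\<rbrakk>
      \<Longrightarrow> k \<odot>\<^bsub>A\<^esub> (a \<otimes>\<^bsub>A\<^esub> b) = a \<otimes>\<^bsub>A\<^esub> (k \<odot>\<^bsub>A\<^esub> b)"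

text \<open>As for \<open>module\<close>, only the additive part of the underlying ring record is meaningful.\<close>

record ('r, 'm) bimod = "'m ring" +
  lact :: "'r \<Rightarrow> 'm \<Rightarrow> 'm" (infixr \<open>\<triangleright>\<index>\<close> 70)
  ract :: "'m \<Rightarrow> 'r \<Rightarrow> 'm" (infixl \<open>\<triangleleft>\<index>\<close> 70)

definition mk_bimod ::
  "('m, 'c) ring_scheme \<Rightarrow> ('r \<Rightarrow> 'm \<Rightarrow> 'm) \<Rightarrow> ('m \<Rightarrow> 'r \<Rightarrow> 'm) \<Rightarrow> ('r, 'm) bimod" where
  "mk_bimod G l r = \<lparr>carrier = carrier G, monoid.mult = monoid.mult G, one = one G,
     ring.zero = ring.zero G, ring.add = ring.add G, lact = l, ract = r\<rparr>"

locale bimodule = R?: ring R + M?: abelian_group M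
  for R :: "('r, 'c) ring_scheme" (structure) and M :: "('r, 'm, 'd) bimod_scheme" (structure) +
  assumes lact_closed: "\<lbrakk>r \<in> carrier R; m \<in> carrier M\<rbrakk> \<Longrightarrow> r \<triangleright>\<^bsub>M\<^esub> m \<in> carrier M"
    and ract_closed: "\<lbrakk>r \<in> carrier R; m \<in> carrier M\<rbrakk> \<Longrightarrow> m \<triangleleft>\<^bsub>M\<^esub> r \<in> carrier M"
    and lact_add_l: "\<lbrakk>r \<in> carrier R; s \<in> carrier R; m \<in> carrier M\<rbrakk>
      \<Longrightarrow> (r \<oplus>\<^bsub>R\<^esub> s) \<triangleright>\<^bsub>M\<^esub> m = (r \<triangleright>\<^bsub>M\<^esub> m) \<oplus>\<^bsub>M\<^esub> (s \<triangleright>\<^bsub>M\<^esub> m)"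
    and lact_add_r: "\<lbrakk>r \<in> carrier R; m \<in> carrier M; m' \<in> carrier M\<rbrakk>
      \<Longrightarrow> r \<triangleright>\<^bsub>M\<^esub> (m \<oplus>\<^bsub>M\<^esub> m') = (r \<triangleright>\<^bsub>M\<^esub> m) \<oplus>\<^bsub>M\<^esub> (r \<triangleright>\<^bsub>M\<^esub> m')"
    and ract_add_l: "\<lbrakk>r \<in> carrier R; m \<in> carrier M; m' \<in> carrier M\<rbrakk>
      \<Longrightarrow> (m \<oplus>\<^bsub>M\<^esub> m') \<triangleleft>\<^bsub>M\<^esub> r = (m \<triangleleft>\<^bsub>M\<^esub> r) \<oplus>\<^bsub>M\<^esub> (m' \<triangleleft>\<^bsub>M\<^esub> r)"
    and ract_add_r: "\<lbrakk>r \<in> carrier R; s \<in> carrier R; m \<in> carrier M\<rbrakk>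
      \<Longrightarrow> m \<triangleleft>\<^bsub>M\<^esub> (r \<oplus>\<^bsub>R\<^esub> s) = (m \<triangleleft>\<^bsub>M\<^esub> r) \<oplus>\<^bsub>M\<^esub> (m \<triangleleft>\<^bsub>M\<^esub> s)"
    and lact_mult: "\<lbrakk>r \<in> carrier R; s \<in> carrier R; m \<in> carrier M\<rbrakk>
      \<Longrightarrow> (r \<otimes>\<^bsub>R\<^esub> s) \<triangleright>\<^bsub>M\<^esub> m = r \<triangleright>\<^bsub>M\<^esub> (s \<triangleright>\<^bsub>M\<^esub> m)"
    and ract_mult: "\<lbrakk>r \<in> carrier R; s \<in> carrier R; m \<in> carrier M\<rbrakk>
      \<Longrightarrow> m \<triangleleft>\<^bsub>M\<^esub> (r \<otimes>\<^bsub>R\<^esub> s) = (m \<triangleleft>\<^bsub>M\<^esub> r) \<triangleleft>\<^bsub>M\<^esub> s"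
    and lact_one: "m \<in> carrier M \<Longrightarrow> \<one>\<^bsub>R\<^esub> \<triangleright>\<^bsub>M\<^esub> m = m"
    and ract_one: "m \<in> carrier M \<Longrightarrow> m \<triangleleft>\<^bsub>M\<^esub> \<one>\<^bsub>R\<^esub> = m"
    and lact_ract: "\<lbrakk>r \<in> carrier R; s \<in> carrier R; m \<in> carrier M\<rbrakk>
      \<Longrightarrow> (r \<triangleright>\<^bsub>M\<^esub> m) \<triangleleft>\<^bsub>M\<^esub> s = r \<triangleright>\<^bsub>M\<^esub> (m \<triangleleft>\<^bsub>M\<^esub> s)"

definition reg_bimod :: "('r, 'c) ring_scheme \<Rightarrow> ('r, 'r) bimod" where
  "reg_bimod R = mk_bimod R (monoid.mult R) (monoid.mult R)"

definition restrict_scalars :: "('k \<Rightarrow> 'r) \<Rightarrow> ('r, 'm, 'c) bimod_scheme \<Rightarrow> ('k, 'm) bimod" where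
  "restrict_scalars f M = mk_bimod M (\<lambda>k m. f k \<triangleright>\<^bsub>M\<^esub> m) (\<lambda>m k. m \<triangleleft>\<^bsub>M\<^esub> f k)"

definition scalar :: "('k, 'a, 'c) module_scheme \<Rightarrow> 'k \<Rightarrow> 'a" where
  "scalar A k = k \<odot>\<^bsub>A\<^esub> \<one>\<^bsub>A\<^esub>"

text \<open>A bimodule over a \<open>K\<close>-algebra is one on which \<open>K\<close> acts centrally,
  equivalently a left module over the enveloping algebra.\<close>

locale algebra_bimodule = unital_algebra K A + bimodule A M
  for K :: "('k, 'c) ring_scheme" (structure) and A :: "('k, 'a, 'd) module_scheme" (structure)
    and M :: "('a, 'm, 'e) bimod_scheme" (structure) +
  assumes scalar_central: "\<lbrakk>k \<in> carrier K; m \<in> carrier M\<rbrakk>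
    \<Longrightarrow> scalar A k \<triangleright>\<^bsub>M\<^esub> m = m \<triangleleft>\<^bsub>M\<^esub> scalar A k"


section \<open>Tensor products\<close>

text \<open>The free abelian group on \<open>S\<close> as an additive group. (The library's
  \<open>free_Abelian_group\<close> is the same group, written multiplicatively.) Here and in \<open>tensor\<close> the
  multiplicative fields are fillers.\<close>

definition free_ab :: "'s set \<Rightarrow> ('s \<Rightarrow>\<^sub>0 int) ring" where
  "free_ab S = \<lparr>carrier = {c. Poly_Mapping.keys c \<subseteq> S}, monoid.mult = (\<lambda>_ _. 0), one = 0,
     ring.zero = 0, ring.add = (+)\<rparr>"

definition frag_bilin ::
  "('u \<Rightarrow> 'v \<Rightarrow> 'w) \<Rightarrow> ('u \<Rightarrow>\<^sub>0 int) \<Rightarrow> ('v \<Rightarrow>\<^sub>0 int) \<Rightarrow> ('w \<Rightarrow>\<^sub>0 int)" where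
  "frag_bilin h f g = frag_extend (\<lambda>u. frag_extend (\<lambda>v. frag_of (h u v)) g) f"

definition int_monoid_ring :: "('w, 'c) monoid_scheme \<Rightarrow> ('w \<Rightarrow>\<^sub>0 int) ring" where
  "int_monoid_ring W = (free_ab (carrier W))
     \<lparr>mult := frag_bilin (\<lambda>u v. u \<otimes>\<^bsub>W\<^esub> v), one := frag_of \<one>\<^bsub>W\<^esub>\<rparr>"

definition tensor_rels ::
  "('r, 'c) ring_scheme \<Rightarrow> ('r, 'm, 'd) bimod_scheme \<Rightarrow> ('r, 'n, 'e) bimod_scheme
    \<Rightarrow> ('m \<times> 'n \<Rightarrow>\<^sub>0 int) set" where
  "tensor_rels R M N =
     {frag_of (m \<oplus>\<^bsub>M\<^esub> m', n) - frag_of (m, n) - frag_of (m', n) | m m' n.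
        m \<in> carrier M \<and> m' \<in> carrier M \<and> n \<in> carrier N} \<union>
     {frag_of (m, n \<oplus>\<^bsub>N\<^esub> n') - frag_of (m, n) - frag_of (m, n') | m n n'.
        m \<in> carrier M \<and> n \<in> carrier N \<and> n' \<in> carrier N} \<union>
     {frag_of (m \<triangleleft>\<^bsub>M\<^esub> r, n) - frag_of (m, r \<triangleright>\<^bsub>N\<^esub> n) | m r n.
        m \<in> carrier M \<and> r \<in> carrier R \<and> n \<in> carrier N}"

definition tensor_null ::
  "('r, 'c) ring_scheme \<Rightarrow> ('r, 'm, 'd) bimod_scheme \<Rightarrow> ('r, 'n, 'e) bimod_scheme
    \<Rightarrow> ('m \<times> 'n \<Rightarrow>\<^sub>0 int) set" where
  "tensor_null R M N =
     generate (free_Abelian_group (carrier M \<times> carrier N)) (tensor_rels R M N)"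

definition tensor ::
  "('r, 'c) ring_scheme \<Rightarrow> ('r, 'm, 'd) bimod_scheme \<Rightarrow> ('r, 'n, 'e) bimod_scheme
    \<Rightarrow> ('m \<times> 'n \<Rightarrow>\<^sub>0 int) set ring" where
  "tensor R M N = free_ab (carrier M \<times> carrier N) Quot tensor_null R M N"

text \<open>The element of the tensor product represented by a formal sum of pairs.\<close>

definition tens_cls ::
  "('r, 'c) ring_scheme \<Rightarrow> ('r, 'm, 'd) bimod_scheme \<Rightarrow> ('r, 'n, 'e) bimod_scheme
    \<Rightarrow> ('m \<times> 'n \<Rightarrow>\<^sub>0 int) \<Rightarrow> ('m \<times> 'n \<Rightarrow>\<^sub>0 int) set" where
  "tens_cls R M N f = tensor_null R M N +>\<^bsub>free_ab (carrier M \<times> carrier N)\<^esub> f"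

abbreviation tens ::
  "('r, 'c) ring_scheme \<Rightarrow> ('r, 'm, 'd) bimod_scheme \<Rightarrow> ('r, 'n, 'e) bimod_scheme
    \<Rightarrow> 'm \<Rightarrow> 'n \<Rightarrow> ('m \<times> 'n \<Rightarrow>\<^sub>0 int) set" where
  "tens R M N m n \<equiv> tens_cls R M N (frag_of (m, n))"

text \<open>The tensor algebra of an \<open>R\<close>-bimodule \<open>V\<close>. The pair \<open>(r, [v\<^sub>1, \<dots>, v\<^sub>n])\<close> stands for
  \<open>r \<otimes> v\<^sub>1 \<otimes> \<dots> \<otimes> v\<^sub>n\<close>, and degree \<open>n\<close> is realised as the \<open>n\<close>-fold tensor power
  \<open>R \<otimes> V \<otimes> \<dots> \<otimes> V\<close> over \<open>R\<close>, so that degree \<open>0\<close> is \<open>R\<close> itself. All relations are homogeneous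
  in \<open>n\<close>, hence the quotient is the direct sum of these powers. In the product, the
  coefficient of the right factor is absorbed into the last entry of the left factor.\<close>

definition word_monoid ::
  "('r, 'c) ring_scheme \<Rightarrow> ('r, 'v, 'd) bimod_scheme \<Rightarrow> ('r \<times> 'v list) monoid" where
  "word_monoid R V = \<lparr>carrier = carrier R \<times> lists (carrier V),
     monoid.mult = (\<lambda>(r, us) (s, vs).
       if us = [] then (r \<otimes>\<^bsub>R\<^esub> s, vs)
       else (r, butlast us @ [last us \<triangleleft>\<^bsub>V\<^esub> s] @ vs)),
     one = (\<one>\<^bsub>R\<^esub>, [])\<rparr>"

definition tensor_power_rels ::
  "('r, 'c) ring_scheme \<Rightarrow> ('r, 'v, 'd) bimod_scheme \<Rightarrow> ('r \<times> 'v list \<Rightarrow>\<^sub>0 int) set" where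
  "tensor_power_rels R V =
     {frag_of (r \<oplus>\<^bsub>R\<^esub> s, vs) - frag_of (r, vs) - frag_of (s, vs) | r s vs.
        r \<in> carrier R \<and> s \<in> carrier R \<and> vs \<in> lists (carrier V)} \<union>
     {frag_of (r, us @ [v \<oplus>\<^bsub>V\<^esub> w] @ vs) - frag_of (r, us @ [v] @ vs) - frag_of (r, us @ [w] @ vs)
        | r us v w vs. r \<in> carrier R \<and> us \<in> lists (carrier V) \<and> v \<in> carrier V
            \<and> w \<in> carrier V \<and> vs \<in> lists (carrier V)} \<union>
     {frag_of (r \<otimes>\<^bsub>R\<^esub> s, [v] @ vs) - frag_of (r, [s \<triangleright>\<^bsub>V\<^esub> v] @ vs) | r s v vs.
        r \<in> carrier R \<and> s \<in> carrier R \<and> v \<in> carrier V \<and> vs \<in> lists (carrier V)} \<union>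
     {frag_of (r, us @ [v \<triangleleft>\<^bsub>V\<^esub> s, w] @ vs) - frag_of (r, us @ [v, s \<triangleright>\<^bsub>V\<^esub> w] @ vs)
        | r s us v w vs. r \<in> carrier R \<and> s \<in> carrier R \<and> us \<in> lists (carrier V)
            \<and> v \<in> carrier V \<and> w \<in> carrier V \<and> vs \<in> lists (carrier V)}"

definition tensor_power_null ::
  "('r, 'c) ring_scheme \<Rightarrow> ('r, 'v, 'd) bimod_scheme \<Rightarrow> ('r \<times> 'v list \<Rightarrow>\<^sub>0 int) set" where
  "tensor_power_null R V =
     generate (free_Abelian_group (carrier (word_monoid R V))) (tensor_power_rels R V)"

definition tensor_algebra ::
  "('r, 'c) ring_scheme \<Rightarrow> ('r, 'v, 'd) bimod_scheme \<Rightarrow> ('r \<times> 'v list \<Rightarrow>\<^sub>0 int) set ring" where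
  "tensor_algebra R V = int_monoid_ring (word_monoid R V) Quot tensor_power_null R V"

definition ta_scalar ::
  "('r, 'c) ring_scheme \<Rightarrow> ('r, 'v, 'd) bimod_scheme \<Rightarrow> 'r \<Rightarrow> ('r \<times> 'v list \<Rightarrow>\<^sub>0 int) set" where
  "ta_scalar R V r = tensor_power_null R V +>\<^bsub>int_monoid_ring (word_monoid R V)\<^esub> frag_of (r, [])"

definition ta_vector ::
  "('r, 'c) ring_scheme \<Rightarrow> ('r, 'v, 'd) bimod_scheme \<Rightarrow> 'v \<Rightarrow> ('r \<times> 'v list \<Rightarrow>\<^sub>0 int) set" where
  "ta_vector R V v =
     tensor_power_null R V +>\<^bsub>int_monoid_ring (word_monoid R V)\<^esub> frag_of (\<one>\<^bsub>R\<^esub>, [v])"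


section \<open>Pivotal bimodules\<close>

definition lhom ::
  "('r, 'c) ring_scheme \<Rightarrow> ('r, 'm, 'd) bimod_scheme \<Rightarrow> ('r, 'n, 'e) bimod_scheme
    \<Rightarrow> ('m \<Rightarrow> 'n) set" where
  "lhom R M N = {f \<in> carrier M \<rightarrow> carrier N.
     (\<forall>m\<in>carrier M. \<forall>m'\<in>carrier M. f (m \<oplus>\<^bsub>M\<^esub> m') = f m \<oplus>\<^bsub>N\<^esub> f m') \<and>
     (\<forall>r\<in>carrier R. \<forall>m\<in>carrier M. f (r \<triangleright>\<^bsub>M\<^esub> m) = r \<triangleright>\<^bsub>N\<^esub> f m)}"

definition rhom ::
  "('r, 'c) ring_scheme \<Rightarrow> ('r, 'm, 'd) bimod_scheme \<Rightarrow> ('r, 'n, 'e) bimod_scheme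
    \<Rightarrow> ('m \<Rightarrow> 'n) set" where
  "rhom R M N = {f \<in> carrier M \<rightarrow> carrier N.
     (\<forall>m\<in>carrier M. \<forall>m'\<in>carrier M. f (m \<oplus>\<^bsub>M\<^esub> m') = f m \<oplus>\<^bsub>N\<^esub> f m') \<and>
     (\<forall>r\<in>carrier R. \<forall>m\<in>carrier M. f (m \<triangleleft>\<^bsub>M\<^esub> r) = f m \<triangleleft>\<^bsub>N\<^esub> r)}"

definition free_bimod :: "('r, 'c) ring_scheme \<Rightarrow> nat \<Rightarrow> ('r, nat \<Rightarrow> 'r) bimod" where
  "free_bimod R n = \<lparr>carrier = {..<n} \<rightarrow>\<^sub>E carrier R, monoid.mult = undefined, one = undefined,
     ring.zero = (\<lambda>i\<in>{..<n}. \<zero>\<^bsub>R\<^esub>), ring.add = (\<lambda>u v. \<lambda>i\<in>{..<n}. u i \<oplus>\<^bsub>R\<^esub> v i),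
     lact = (\<lambda>r v. \<lambda>i\<in>{..<n}. r \<otimes>\<^bsub>R\<^esub> v i), ract = (\<lambda>v r. \<lambda>i\<in>{..<n}. v i \<otimes>\<^bsub>R\<^esub> r)\<rparr>"

text \<open>Finitely generated projective: a direct summand of a free module of finite rank.\<close>

definition fgp_left :: "('r, 'c) ring_scheme \<Rightarrow> ('r, 'm, 'd) bimod_scheme \<Rightarrow> bool" where
  "fgp_left R M \<longleftrightarrow> (\<exists>n. \<exists>i \<in> lhom R M (free_bimod R n). \<exists>p \<in> lhom R (free_bimod R n) M.
     \<forall>m\<in>carrier M. p (i m) = m)"

definition fgp_right :: "('r, 'c) ring_scheme \<Rightarrow> ('r, 'm, 'd) bimod_scheme \<Rightarrow> bool" where
  "fgp_right R M \<longleftrightarrow> (\<exists>n. \<exists>i \<in> rhom R M (free_bimod R n). \<exists>p \<in> rhom R (free_bimod R n) M.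
     \<forall>m\<in>carrier M. p (i m) = m)"

text \<open>The left dual consists of the right \<open>R\<close>-linear maps and the right dual of the left
  \<open>R\<close>-linear ones. The actions are those making the evaluations
  \<open>f \<otimes> m \<mapsto> f m\<close> and \<open>m \<otimes> f \<mapsto> f m\<close> bimodule maps.\<close>

definition left_dual :: "('r, 'c) ring_scheme \<Rightarrow> ('r, 'm, 'd) bimod_scheme
    \<Rightarrow> ('r, 'm \<Rightarrow> 'r) bimod" where
  "left_dual R M = \<lparr>carrier = rhom R M (reg_bimod R) \<inter> extensional (carrier M),
     monoid.mult = undefined, one = undefined,
     ring.zero = (\<lambda>m\<in>carrier M. \<zero>\<^bsub>R\<^esub>), ring.add = (\<lambda>f g. \<lambda>m\<in>carrier M. f m \<oplus>\<^bsub>R\<^esub> g m),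
     lact = (\<lambda>r f. \<lambda>m\<in>carrier M. r \<otimes>\<^bsub>R\<^esub> f m),
     ract = (\<lambda>f r. \<lambda>m\<in>carrier M. f (r \<triangleright>\<^bsub>M\<^esub> m))\<rparr>"

definition right_dual :: "('r, 'c) ring_scheme \<Rightarrow> ('r, 'm, 'd) bimod_scheme
    \<Rightarrow> ('r, 'm \<Rightarrow> 'r) bimod" where
  "right_dual R M = \<lparr>carrier = lhom R M (reg_bimod R) \<inter> extensional (carrier M),
     monoid.mult = undefined, one = undefined,
     ring.zero = (\<lambda>m\<in>carrier M. \<zero>\<^bsub>R\<^esub>), ring.add = (\<lambda>f g. \<lambda>m\<in>carrier M. f m \<oplus>\<^bsub>R\<^esub> g m),
     lact = (\<lambda>r f. \<lambda>m\<in>carrier M. f (m \<triangleleft>\<^bsub>M\<^esub> r)),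
     ract = (\<lambda>f r. \<lambda>m\<in>carrier M. f m \<otimes>\<^bsub>R\<^esub> r)\<rparr>"

definition pivotal :: "('r, 'c) ring_scheme \<Rightarrow> ('r, 'm, 'd) bimod_scheme \<Rightarrow> bool" where
  "pivotal R M \<longleftrightarrow> fgp_left R M \<and> fgp_right R M \<and>
     (\<exists>\<phi> \<in> lhom R (left_dual R M) (right_dual R M) \<inter> rhom R (left_dual R M) (right_dual R M).
        bij_betw \<phi> (carrier (left_dual R M)) (carrier (right_dual R M)))"

text \<open>\<open>coev(1) = \<Sum>i<coev_len. coev_w i \<otimes> coev_x i\<close> and, for the other duality,
  \<open>coevu(1) = \<Sum>j<coevu_len. coevu_y j \<otimes> coevu_r j\<close>.\<close>

record ('a, 'w, 'x) dual_data =
  ev :: "'x \<Rightarrow> 'w \<Rightarrow> 'a"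
  evu :: "'w \<Rightarrow> 'x \<Rightarrow> 'a"
  coev_len :: nat
  coev_w :: "nat \<Rightarrow> 'w"
  coev_x :: "nat \<Rightarrow> 'x"
  coevu_len :: nat
  coevu_y :: "nat \<Rightarrow> 'x"
  coevu_r :: "nat \<Rightarrow> 'w"

text \<open>Bimodule maps from \<open>M \<otimes> N\<close> to \<open>R\<close>, as balanced maps on \<open>M \<times> N\<close>.\<close>

definition bimod_pairing ::
  "('r, 'c) ring_scheme \<Rightarrow> ('r, 'm, 'd) bimod_scheme \<Rightarrow> ('r, 'n, 'e) bimod_scheme
    \<Rightarrow> ('m \<Rightarrow> 'n \<Rightarrow> 'r) \<Rightarrow> bool" where
  "bimod_pairing R M N e \<longleftrightarrow>
     (\<forall>m\<in>carrier M. e m \<in> rhom R N (reg_bimod R)) \<and>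
     (\<forall>n\<in>carrier N. (\<lambda>m. e m n) \<in> lhom R M (reg_bimod R)) \<and>
     (\<forall>m\<in>carrier M. \<forall>r\<in>carrier R. \<forall>n\<in>carrier N. e (m \<triangleleft>\<^bsub>M\<^esub> r) n = e m (r \<triangleright>\<^bsub>N\<^esub> n))"

text \<open>Bimodule maps from \<open>R\<close> to \<open>M \<otimes> N\<close>, as central elements \<open>\<Sum>i<l. u i \<otimes> v i\<close>.\<close>

definition bimod_copairing ::
  "('r, 'c) ring_scheme \<Rightarrow> ('r, 'm, 'd) bimod_scheme \<Rightarrow> ('r, 'n, 'e) bimod_scheme
    \<Rightarrow> nat \<Rightarrow> (nat \<Rightarrow> 'm) \<Rightarrow> (nat \<Rightarrow> 'n) \<Rightarrow> bool" where
  "bimod_copairing R M N l u v \<longleftrightarrow>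
     (\<forall>i<l. u i \<in> carrier M \<and> v i \<in> carrier N) \<and>
     (\<forall>r\<in>carrier R. (\<Oplus>\<^bsub>tensor R M N\<^esub>i\<in>{..<l}. tens R M N (r \<triangleright>\<^bsub>M\<^esub> u i) (v i))
        = (\<Oplus>\<^bsub>tensor R M N\<^esub>i\<in>{..<l}. tens R M N (u i) (v i \<triangleleft>\<^bsub>N\<^esub> r)))"

definition pivotal_dual ::
  "('a, 'c) ring_scheme \<Rightarrow> ('a, 'w, 'd) bimod_scheme \<Rightarrow> ('a, 'x, 'e) bimod_scheme
    \<Rightarrow> ('a, 'w, 'x) dual_data \<Rightarrow> bool" where
  "pivotal_dual A Om X D \<longleftrightarrow>
     bimod_pairing A X Om (ev D) \<and> bimod_pairing A Om X (evu D) \<and>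
     bimod_copairing A Om X (coev_len D) (coev_w D) (coev_x D) \<and>
     bimod_copairing A X Om (coevu_len D) (coevu_y D) (coevu_r D) \<and>
     (\<forall>w\<in>carrier Om.
        w = (\<Oplus>\<^bsub>Om\<^esub>i\<in>{..<coev_len D}. coev_w D i \<triangleleft>\<^bsub>Om\<^esub> ev D (coev_x D i) w) \<and>
        w = (\<Oplus>\<^bsub>Om\<^esub>j\<in>{..<coevu_len D}. evu D w (coevu_y D j) \<triangleright>\<^bsub>Om\<^esub> coevu_r D j)) \<and>
     (\<forall>x\<in>carrier X.
        x = (\<Oplus>\<^bsub>X\<^esub>i\<in>{..<coev_len D}. ev D x (coev_w D i) \<triangleright>\<^bsub>X\<^esub> coev_x D i) \<and>
        x = (\<Oplus>\<^bsub>X\<^esub>j\<in>{..<coevu_len D}. coevu_y D j \<triangleleft>\<^bsub>X\<^esub> evu D (coevu_r D j) x))"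


section \<open>The bialgebroid\<close>

type_synonym 'a env = "('a \<times> 'a \<Rightarrow>\<^sub>0 int) set"
type_synonym ('w, 'x) zed = "('x \<times> 'w \<Rightarrow>\<^sub>0 int) set \<times> ('w \<times> 'x \<Rightarrow>\<^sub>0 int) set"
type_synonym ('a, 'w, 'x) tzed = "('a env \<times> ('w, 'x) zed list \<Rightarrow>\<^sub>0 int) set"
type_synonym ('a, 'w, 'x) bialg = "('a, 'w, 'x) tzed set"

abbreviation over :: "('k, 'a, 'c) module_scheme \<Rightarrow> ('a, 'm, 'd) bimod_scheme \<Rightarrow> ('k, 'm) bimod" where
  "over A M \<equiv> restrict_scalars (scalar A) M"

definition env_algebra :: "('k, 'b) ring_scheme \<Rightarrow> ('k, 'a, 'c) module_scheme \<Rightarrow> 'a env ring" where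
  "env_algebra K A = int_monoid_ring (A \<times>\<times> opp A)
     Quot tensor_null K (over A (reg_bimod A)) (over (opp A) (reg_bimod (opp A)))"

text \<open>The element written \<open>a\<close> times \<open>b\<close>-bar.\<close>

definition env :: "('k, 'b) ring_scheme \<Rightarrow> ('k, 'a, 'c) module_scheme \<Rightarrow> 'a \<Rightarrow> 'a \<Rightarrow> 'a env" where
  "env K A a b = tens K (over A (reg_bimod A)) (over (opp A) (reg_bimod (opp A))) a b"

text \<open>The map on classes in a tensor product induced by \<open>h\<close> on pairs of representatives
  (compare \<open>rcoset_mult\<close>).\<close>

definition tens_lift ::
  "('r, 'c) ring_scheme \<Rightarrow> ('r, 'm, 'd) bimod_scheme \<Rightarrow> ('r, 'n, 'e) bimod_scheme
    \<Rightarrow> ('u \<Rightarrow> 'v \<Rightarrow> 'm \<times> 'n) \<Rightarrow> ('u \<Rightarrow>\<^sub>0 int) set \<Rightarrow> ('v \<Rightarrow>\<^sub>0 int) set \<Rightarrow> ('m \<times> 'n \<Rightarrow>\<^sub>0 int) set" where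
  "tens_lift R M N h c d = (\<Union>f\<in>c. \<Union>g\<in>d. tens_cls R M N (frag_bilin h f g))"

definition zed_bimod ::
  "('k, 'b) ring_scheme \<Rightarrow> ('k, 'a, 'c) module_scheme \<Rightarrow> ('a, 'w, 'd) bimod_scheme
    \<Rightarrow> ('a, 'x, 'e) bimod_scheme \<Rightarrow> ('a env, ('w, 'x) zed) bimod" where
  "zed_bimod K A Om X = mk_bimod
     (RDirProd (tensor K (over A X) (over A Om)) (tensor K (over A Om) (over A X)))
     (\<lambda>e (p, q).
        (tens_lift K (over A X) (over A Om)
           (\<lambda>(a, a') (x, w). (a \<triangleright>\<^bsub>X\<^esub> x, w \<triangleleft>\<^bsub>Om\<^esub> a')) e p,
         tens_lift K (over A Om) (over A X)
           (\<lambda>(a, a') (w, x). (a \<triangleright>\<^bsub>Om\<^esub> w, x \<triangleleft>\<^bsub>X\<^esub> a')) e q))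
     (\<lambda>(p, q) e.
        (tens_lift K (over A X) (over A Om)
           (\<lambda>(x, w) (b, b'). (x \<triangleleft>\<^bsub>X\<^esub> b, b' \<triangleright>\<^bsub>Om\<^esub> w)) p e,
         tens_lift K (over A Om) (over A X)
           (\<lambda>(w, x) (b, b'). (w \<triangleleft>\<^bsub>Om\<^esub> b, b' \<triangleright>\<^bsub>X\<^esub> x)) q e))"

definition zed_xw ::
  "('k, 'b) ring_scheme \<Rightarrow> ('k, 'a, 'c) module_scheme \<Rightarrow> ('a, 'w, 'd) bimod_scheme
    \<Rightarrow> ('a, 'x, 'e) bimod_scheme \<Rightarrow> 'x \<Rightarrow> 'w \<Rightarrow> ('w, 'x) zed" where
  "zed_xw K A Om X x w =
     (tens K (over A X) (over A Om) x w, \<zero>\<^bsub>tensor K (over A Om) (over A X)\<^esub>)"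

definition zed_wx ::
  "('k, 'b) ring_scheme \<Rightarrow> ('k, 'a, 'c) module_scheme \<Rightarrow> ('a, 'w, 'd) bimod_scheme
    \<Rightarrow> ('a, 'x, 'e) bimod_scheme \<Rightarrow> 'w \<Rightarrow> 'x \<Rightarrow> ('w, 'x) zed" where
  "zed_wx K A Om X w x =
     (\<zero>\<^bsub>tensor K (over A X) (over A Om)\<^esub>, tens K (over A Om) (over A X) w x)"

definition tz ::
  "('k, 'b) ring_scheme \<Rightarrow> ('k, 'a, 'c) module_scheme \<Rightarrow> ('a, 'w, 'd) bimod_scheme
    \<Rightarrow> ('a, 'x, 'e) bimod_scheme \<Rightarrow> ('a, 'w, 'x) tzed ring" where
  "tz K A Om X = tensor_algebra (env_algebra K A) (zed_bimod K A Om X)"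

definition tz_env ::
  "('k, 'b) ring_scheme \<Rightarrow> ('k, 'a, 'c) module_scheme \<Rightarrow> ('a, 'w, 'd) bimod_scheme
    \<Rightarrow> ('a, 'x, 'e) bimod_scheme \<Rightarrow> 'a \<Rightarrow> 'a \<Rightarrow> ('a, 'w, 'x) tzed" where
  "tz_env K A Om X a b = ta_scalar (env_algebra K A) (zed_bimod K A Om X) (env K A a b)"

definition tz_xw ::
  "('k, 'b) ring_scheme \<Rightarrow> ('k, 'a, 'c) module_scheme \<Rightarrow> ('a, 'w, 'd) bimod_scheme
    \<Rightarrow> ('a, 'x, 'e) bimod_scheme \<Rightarrow> 'x \<Rightarrow> 'w \<Rightarrow> ('a, 'w, 'x) tzed" where
  "tz_xw K A Om X x w =
     ta_vector (env_algebra K A) (zed_bimod K A Om X) (zed_xw K A Om X x w)"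

definition tz_wx ::
  "('k, 'b) ring_scheme \<Rightarrow> ('k, 'a, 'c) module_scheme \<Rightarrow> ('a, 'w, 'd) bimod_scheme
    \<Rightarrow> ('a, 'x, 'e) bimod_scheme \<Rightarrow> 'w \<Rightarrow> 'x \<Rightarrow> ('a, 'w, 'x) tzed" where
  "tz_wx K A Om X w x =
     ta_vector (env_algebra K A) (zed_bimod K A Om X) (zed_wx K A Om X w x)"

definition H_relators ::
  "('k, 'b) ring_scheme \<Rightarrow> ('k, 'a, 'c) module_scheme \<Rightarrow> ('a, 'w, 'd) bimod_scheme
    \<Rightarrow> ('a, 'x, 'e) bimod_scheme \<Rightarrow> ('a, 'w, 'x) dual_data \<Rightarrow> ('a, 'w, 'x) tzed set" where
  "H_relators K A Om X D =
    (let T = tz K A Om X; el = (\<lambda>a. tz_env K A Om X a \<one>\<^bsub>A\<^esub>); bar = tz_env K A Om X \<one>\<^bsub>A\<^esub>;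
         xw = tz_xw K A Om X; wx = tz_wx K A Om X in
     \<Union>x\<in>carrier X. \<Union>w\<in>carrier Om.
      {(\<Oplus>\<^bsub>T\<^esub>i\<in>{..<coev_len D}. wx (coev_w D i) x \<otimes>\<^bsub>T\<^esub> xw (coev_x D i) w)
         \<ominus>\<^bsub>T\<^esub> bar (evu D w x),
       (\<Oplus>\<^bsub>T\<^esub>j\<in>{..<coevu_len D}. xw x (coevu_r D j) \<otimes>\<^bsub>T\<^esub> wx w (coevu_y D j))
         \<ominus>\<^bsub>T\<^esub> el (ev D x w),
       (\<Oplus>\<^bsub>T\<^esub>j\<in>{..<coevu_len D}. xw (coevu_y D j) w \<otimes>\<^bsub>T\<^esub> wx (coevu_r D j) x)
         \<ominus>\<^bsub>T\<^esub> bar (ev D x w),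
       (\<Oplus>\<^bsub>T\<^esub>i\<in>{..<coev_len D}. wx w (coev_x D i) \<otimes>\<^bsub>T\<^esub> xw x (coev_w D i))
         \<ominus>\<^bsub>T\<^esub> el (evu D w x)})"

definition H_ideal ::
  "('k, 'b) ring_scheme \<Rightarrow> ('k, 'a, 'c) module_scheme \<Rightarrow> ('a, 'w, 'd) bimod_scheme
    \<Rightarrow> ('a, 'x, 'e) bimod_scheme \<Rightarrow> ('a, 'w, 'x) dual_data \<Rightarrow> ('a, 'w, 'x) tzed set" where
  "H_ideal K A Om X D = Idl\<^bsub>tz K A Om X\<^esub> (H_relators K A Om X D)"

definition H_alg ::
  "('k, 'b) ring_scheme \<Rightarrow> ('k, 'a, 'c) module_scheme \<Rightarrow> ('a, 'w, 'd) bimod_scheme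
    \<Rightarrow> ('a, 'x, 'e) bimod_scheme \<Rightarrow> ('a, 'w, 'x) dual_data \<Rightarrow> ('a, 'w, 'x) bialg ring" where
  "H_alg K A Om X D = tz K A Om X Quot H_ideal K A Om X D"

definition H_cls ::
  "('k, 'b) ring_scheme \<Rightarrow> ('k, 'a, 'c) module_scheme \<Rightarrow> ('a, 'w, 'd) bimod_scheme
    \<Rightarrow> ('a, 'x, 'e) bimod_scheme \<Rightarrow> ('a, 'w, 'x) dual_data \<Rightarrow> ('a, 'w, 'x) tzed
    \<Rightarrow> ('a, 'w, 'x) bialg" where
  "H_cls K A Om X D t = H_ideal K A Om X D +>\<^bsub>tz K A Om X\<^esub> t"

definition H_el ::
  "('k, 'b) ring_scheme \<Rightarrow> ('k, 'a, 'c) module_scheme \<Rightarrow> ('a, 'w, 'd) bimod_scheme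
    \<Rightarrow> ('a, 'x, 'e) bimod_scheme \<Rightarrow> ('a, 'w, 'x) dual_data \<Rightarrow> 'a \<Rightarrow> ('a, 'w, 'x) bialg" where
  "H_el K A Om X D a = H_cls K A Om X D (tz_env K A Om X a \<one>\<^bsub>A\<^esub>)"

definition H_bar ::
  "('k, 'b) ring_scheme \<Rightarrow> ('k, 'a, 'c) module_scheme \<Rightarrow> ('a, 'w, 'd) bimod_scheme
    \<Rightarrow> ('a, 'x, 'e) bimod_scheme \<Rightarrow> ('a, 'w, 'x) dual_data \<Rightarrow> 'a \<Rightarrow> ('a, 'w, 'x) bialg" where
  "H_bar K A Om X D a = H_cls K A Om X D (tz_env K A Om X \<one>\<^bsub>A\<^esub> a)"

definition H_xw ::
  "('k, 'b) ring_scheme \<Rightarrow> ('k, 'a, 'c) module_scheme \<Rightarrow> ('a, 'w, 'd) bimod_scheme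
    \<Rightarrow> ('a, 'x, 'e) bimod_scheme \<Rightarrow> ('a, 'w, 'x) dual_data \<Rightarrow> 'x \<Rightarrow> 'w
    \<Rightarrow> ('a, 'w, 'x) bialg" where
  "H_xw K A Om X D x w = H_cls K A Om X D (tz_xw K A Om X x w)"

definition H_wx ::
  "('k, 'b) ring_scheme \<Rightarrow> ('k, 'a, 'c) module_scheme \<Rightarrow> ('a, 'w, 'd) bimod_scheme
    \<Rightarrow> ('a, 'x, 'e) bimod_scheme \<Rightarrow> ('a, 'w, 'x) dual_data \<Rightarrow> 'w \<Rightarrow> 'x
    \<Rightarrow> ('a, 'w, 'x) bialg" where
  "H_wx K A Om X D w x = H_cls K A Om X D (tz_wx K A Om X w x)"

text \<open>For maps \<open>el\<close> and \<open>bar\<close> from \<open>A\<close> to a ring \<open>B\<close>, the \<open>A\<close>-bimodule on \<open>B\<close> whose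
  tensor square over \<open>A\<close> is the target of the coproduct. The latter is also the quotient of
  the tensor product over the ground field, since scalars are among the elements of \<open>A\<close>.\<close>

definition bar_bimod ::
  "('b, 'c) ring_scheme \<Rightarrow> ('a \<Rightarrow> 'b) \<Rightarrow> ('a \<Rightarrow> 'b) \<Rightarrow> ('a, 'b) bimod" where
  "bar_bimod B el bar = mk_bimod B (\<lambda>r b. el r \<otimes>\<^bsub>B\<^esub> b) (\<lambda>b s. bar s \<otimes>\<^bsub>B\<^esub> b)"

definition H_bimod ::
  "('k, 'b) ring_scheme \<Rightarrow> ('k, 'a, 'c) module_scheme \<Rightarrow> ('a, 'w, 'd) bimod_scheme
    \<Rightarrow> ('a, 'x, 'e) bimod_scheme \<Rightarrow> ('a, 'w, 'x) dual_data \<Rightarrow> ('a, ('a, 'w, 'x) bialg) bimod" where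
  "H_bimod K A Om X D = bar_bimod (H_alg K A Om X D) (H_el K A Om X D) (H_bar K A Om X D)"

text \<open>The defining equations of the coproduct. An element of the tensor square is the set of
  its representatives, so in the multiplicativity equation \<open>f\<close> and \<open>g\<close> range over all
  expressions of the coproducts of \<open>m\<close> and \<open>n\<close> as formal sums of pairs.\<close>

definition is_H_coproduct ::
  "('k, 'b) ring_scheme \<Rightarrow> ('k, 'a, 'c) module_scheme \<Rightarrow> ('a, 'w, 'd) bimod_scheme
    \<Rightarrow> ('a, 'x, 'e) bimod_scheme \<Rightarrow> ('a, 'w, 'x) dual_data
    \<Rightarrow> (('a, 'w, 'x) bialg \<Rightarrow> (('a, 'w, 'x) bialg \<times> ('a, 'w, 'x) bialg \<Rightarrow>\<^sub>0 int) set) \<Rightarrow> bool" where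
  "is_H_coproduct K A Om X D \<Delta> \<longleftrightarrow>
    (let H = H_alg K A Om X D; el = H_el K A Om X D; bar = H_bar K A Om X D;
         xw = H_xw K A Om X D; wx = H_wx K A Om X D; B = H_bimod K A Om X D;
         P = tensor A B B in
     \<Delta> \<in> carrier H \<rightarrow>\<^sub>E carrier P \<and>
     (\<forall>m\<in>carrier H. \<forall>n\<in>carrier H. \<Delta> (m \<oplus>\<^bsub>H\<^esub> n) = \<Delta> m \<oplus>\<^bsub>P\<^esub> \<Delta> n) \<and>
     (\<forall>a\<in>carrier A. \<forall>b\<in>carrier A. \<Delta> (el a \<otimes>\<^bsub>H\<^esub> bar b) = tens A B B (el a) (bar b)) \<and>
     (\<forall>x\<in>carrier X. \<forall>w\<in>carrier Om. \<Delta> (xw x w) =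
        (\<Oplus>\<^bsub>P\<^esub>i\<in>{..<coev_len D}. tens A B B (xw x (coev_w D i)) (xw (coev_x D i) w))) \<and>
     (\<forall>w\<in>carrier Om. \<forall>x\<in>carrier X. \<Delta> (wx w x) =
        (\<Oplus>\<^bsub>P\<^esub>j\<in>{..<coevu_len D}. tens A B B (wx w (coevu_y D j)) (wx (coevu_r D j) x))) \<and>
     (\<forall>m\<in>carrier H. \<forall>n\<in>carrier H. \<forall>f\<in>\<Delta> m. \<forall>g\<in>\<Delta> n. \<Delta> (m \<otimes>\<^bsub>H\<^esub> n) =
        tens_cls A B B (frag_bilin (\<lambda>(m1, m2) (n1, n2). (m1 \<otimes>\<^bsub>H\<^esub> n1, m2 \<otimes>\<^bsub>H\<^esub> n2)) f g)))"

definition H_coproduct ::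
  "('k, 'b) ring_scheme \<Rightarrow> ('k, 'a, 'c) module_scheme \<Rightarrow> ('a, 'w, 'd) bimod_scheme
    \<Rightarrow> ('a, 'x, 'e) bimod_scheme \<Rightarrow> ('a, 'w, 'x) dual_data
    \<Rightarrow> ('a, 'w, 'x) bialg \<Rightarrow> (('a, 'w, 'x) bialg \<times> ('a, 'w, 'x) bialg \<Rightarrow>\<^sub>0 int) set" where
  "H_coproduct K A Om X D = (THE \<Delta>. is_H_coproduct K A Om X D \<Delta>)"


section \<open>Antipodes\<close>

text \<open>Anti-multiplicative unital \<open>K\<close>-linear endomorphisms of \<open>B\<close>, where \<open>K\<close> acts on \<open>B\<close>
  through \<open>el\<close>.\<close>

definition alg_antihom ::
  "('k, 'm) ring_scheme \<Rightarrow> ('k, 'a, 'c) module_scheme \<Rightarrow> ('b, 'd) ring_scheme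
    \<Rightarrow> ('a \<Rightarrow> 'b) \<Rightarrow> ('b \<Rightarrow> 'b) \<Rightarrow> bool" where
  "alg_antihom K A B el S \<longleftrightarrow> S \<in> ring_hom B (opp B) \<and>
     (\<forall>k\<in>carrier K. \<forall>b\<in>carrier B. S (el (scalar A k) \<otimes>\<^bsub>B\<^esub> b) = el (scalar A k) \<otimes>\<^bsub>B\<^esub> S b)"

text \<open>The Boehm--Szlachanyi conditions. For \<open>\<Sum>b\<^sub>1 \<otimes> b\<^sub>2\<close> any representative \<open>f\<close> of the
  coproduct of \<open>b\<close>, and \<open>\<sigma>\<close> any choice of representatives of coproducts, the two displayed
  conditions read
  \<open>\<Sum>S(b\<^sub>1)\<^sub>1 b\<^sub>2 \<otimes> S(b\<^sub>1)\<^sub>2 = 1 \<otimes> S(b)\<close> and \<open>\<Sum>T(b\<^sub>2)\<^sub>1 \<otimes> T(b\<^sub>2)\<^sub>2 b\<^sub>1 = T(b) \<otimes> 1\<close>,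
  with \<open>T\<close> the inverse of \<open>S\<close>.\<close>

definition BS_antipode ::
  "('a, 'c) ring_scheme \<Rightarrow> ('b, 'd) ring_scheme \<Rightarrow> ('a \<Rightarrow> 'b) \<Rightarrow> ('a \<Rightarrow> 'b)
    \<Rightarrow> ('b \<Rightarrow> ('b \<times> 'b \<Rightarrow>\<^sub>0 int) set) \<Rightarrow> ('b \<Rightarrow> 'b) \<Rightarrow> bool" where
  "BS_antipode A B el bar \<Delta> S \<longleftrightarrow>
    (let M = bar_bimod B el bar; T = inv_into (carrier B) S in
     (\<forall>a\<in>carrier A. S (bar a) = el a) \<and>
     (\<forall>\<sigma>. (\<forall>b\<in>carrier B. \<sigma> b \<in> \<Delta> b) \<longrightarrow>
       (\<forall>b\<in>carrier B. \<forall>f\<in>\<Delta> b.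
          tens_cls A M M (frag_extend (\<lambda>(b1, b2).
            frag_extend (\<lambda>(c1, c2). frag_of (c1 \<otimes>\<^bsub>B\<^esub> b2, c2)) (\<sigma> (S b1))) f)
            = tens A M M \<one>\<^bsub>B\<^esub> (S b) \<and>
          tens_cls A M M (frag_extend (\<lambda>(b1, b2).
            frag_extend (\<lambda>(c1, c2). frag_of (c1, c2 \<otimes>\<^bsub>B\<^esub> b1)) (\<sigma> (T b2))) f)
            = tens A M M (T b) \<one>\<^bsub>B\<^esub>)))"

definition H_antipode_gens ::
  "('k, 'b) ring_scheme \<Rightarrow> ('k, 'a, 'c) module_scheme \<Rightarrow> ('a, 'w, 'd) bimod_scheme
    \<Rightarrow> ('a, 'x, 'e) bimod_scheme \<Rightarrow> ('a, 'w, 'x) dual_data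
    \<Rightarrow> (('a, 'w, 'x) bialg \<Rightarrow> ('a, 'w, 'x) bialg) \<Rightarrow> bool" where
  "H_antipode_gens K A Om X D S \<longleftrightarrow>
     (\<forall>a\<in>carrier A. S (H_el K A Om X D a) = H_bar K A Om X D a) \<and>
     (\<forall>a\<in>carrier A. S (H_bar K A Om X D a) = H_el K A Om X D a) \<and>
     (\<forall>x\<in>carrier X. \<forall>w\<in>carrier Om. S (H_xw K A Om X D x w) = H_wx K A Om X D w x) \<and>
     (\<forall>w\<in>carrier Om. \<forall>x\<in>carrier X. S (H_wx K A Om X D w x) = H_xw K A Om X D x w)"

end

theory Submission
  imports Defs
begin

text \<open>
  The algebra \<open>H\<close> is initial among rings \<open>B\<close> with maps \<open>a\<close>, \<open>a\<close>-bar, \<open>(x, \<omega>)\<close>, \<open>(\<omega>, x)\<close> into \<open>B\<close> that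
  satisfy the defining relations. Exchanging \<open>a\<close> with \<open>a\<close>-bar and \<open>(x, \<omega>)\<close> with \<open>(\<omega>, x)\<close> turns such a
  structure on \<open>B\<close> into one on the opposite ring, which gives \<open>S\<close>.

  The ring of additive endomorphisms of the tensor square \<open>B \<diamondop> B\<close> is again such a ring: the generators
  act by left multiplication with their prescribed coproducts, and the relations follow by contracting
  dual bases. For \<open>B = H\<close> initiality yields an action of \<open>H\<close> on \<open>H \<diamondop> H\<close>; applied to \<open>1 \<diamondop> 1\<close> it is the
  coproduct. It commutes with right multiplication, whence the coproduct is multiplicative.

  For \<open>\<Psi>(g \<diamondop> h) = S(g)\<^sub>1 h \<diamondop> S(g)\<^sub>2\<close> one has \<open>\<Psi>(b\<^sub>1 g \<diamondop> b\<^sub>2 h) = \<Psi>(g \<diamondop> h) (1 \<diamondop> S b)\<close>: the class of such \<open>b\<close>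
  is closed under products, and for generators the equation is another contraction of dual bases.
  At \<open>g = h = 1\<close> this is the first antipode identity; the second one is similar.
\<close>

text \<open>The tensor square is not a ring. A product ux \<diamondop> vy respects the balancing
  relations of the pair (u, v) automatically, but those of (x, y) only if (u, v) meets the Takeuchi
  condition. Endomorphisms compose without any condition, so it is enough to test the generators,
  and for (x, \<omega>) and (\<omega>, x) the condition is the centrality of the two copairings. A
  single contraction does most of the work: summed over i, the operator of (\<omega>_i, x) applied
  to (x_i, \<omega>)g \<diamondop> h gives g \<diamondop> (\<omega>, x)h. It yields a relation of
  \<open>H\<close> for the operators, and for h = 1 it is the first antipode identity at the
  generator (x, \<omega>). Initiality of \<open>H\<close> is assembled from the universal properties
  of stacked quotients: the enveloping algebra, two tensor products over the field, the tensor
  algebra, and finally the quotient by an ideal. All but the last are quotients of free abelian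
  groups by explicit relations, and these are treated uniformly.\<close>

section \<open>Additive maps\<close>

definition additive_map ::
  "('a, 'c) ring_scheme \<Rightarrow> ('b, 'd) ring_scheme \<Rightarrow> ('a \<Rightarrow> 'b) \<Rightarrow> bool" where
  "additive_map G H f \<longleftrightarrow> f \<in> carrier G \<rightarrow> carrier H \<and>
     (\<forall>x\<in>carrier G. \<forall>y\<in>carrier G. f (x \<oplus>\<^bsub>G\<^esub> y) = f x \<oplus>\<^bsub>H\<^esub> f y)"

lemma additive_mapI:
  assumes "\<And>x. x \<in> carrier G \<Longrightarrow> f x \<in> carrier H"
    and "\<And>x y. \<lbrakk>x \<in> carrier G; y \<in> carrier G\<rbrakk> \<Longrightarrow> f (x \<oplus>\<^bsub>G\<^esub> y) = f x \<oplus>\<^bsub>H\<^esub> f y"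
  shows "additive_map G H f"
  using assms by (auto simp: additive_map_def)

lemma additive_map_closed: "\<lbrakk>additive_map G H f; x \<in> carrier G\<rbrakk> \<Longrightarrow> f x \<in> carrier H"
  by (auto simp: additive_map_def)

lemma additive_map_add:
  "\<lbrakk>additive_map G H f; x \<in> carrier G; y \<in> carrier G\<rbrakk> \<Longrightarrow> f (x \<oplus>\<^bsub>G\<^esub> y) = f x \<oplus>\<^bsub>H\<^esub> f y"
  by (auto simp: additive_map_def)

text \<open>Only the additive fields of the two records are read, so rings, bimodules and tensor
  products are covered alike. The theory of multiplicative group homomorphisms then supplies zero
  and negatives.\<close>

lemma additive_map_hom: "additive_map G H f \<longleftrightarrow> f \<in> hom (add_monoid G) (add_monoid H)"
  by (auto simp: additive_map_def hom_def)

lemma additive_map_zero: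
  assumes "abelian_group G" "abelian_group H" "additive_map G H f"
  shows "f \<zero>\<^bsub>G\<^esub> = \<zero>\<^bsub>H\<^esub>"
proof -
  interpret G: abelian_group G by fact
  interpret H: abelian_group H by fact
  interpret group_hom "add_monoid G" "add_monoid H" f
    using assms(3) G.a_group H.a_group
    by (simp add: group_hom_def group_hom_axioms_def additive_map_hom)
  show ?thesis using hom_one by simp
qed

lemma additive_map_uminus:
  assumes "abelian_group G" "abelian_group H" "additive_map G H f" "x \<in> carrier G"
  shows "f (\<ominus>\<^bsub>G\<^esub> x) = \<ominus>\<^bsub>H\<^esub> f x"
proof -
  interpret G: abelian_group G by fact
  interpret H: abelian_group H by fact
  interpret group_hom "add_monoid G" "add_monoid H" f
    using assms(3) G.a_group H.a_group
    by (simp add: group_hom_def group_hom_axioms_def additive_map_hom)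
  show ?thesis using hom_inv[of x] assms(4) by (simp add: a_inv_def)
qed

lemma additive_map_minus:
  assumes "abelian_group G" "abelian_group H" "additive_map G H f" "x \<in> carrier G" "y \<in> carrier G"
  shows "f (x \<ominus>\<^bsub>G\<^esub> y) = f x \<ominus>\<^bsub>H\<^esub> f y"
  using assms additive_map_uminus[OF assms(1-3), of y]
  by (simp add: a_minus_def additive_map_add abelian_group.a_inv_closed)

lemma additive_map_finsum:
  assumes G: "abelian_group G" and H: "abelian_group H" and f: "additive_map G H f"
    and "finite I" "\<And>i. i \<in> I \<Longrightarrow> g i \<in> carrier G"
  shows "f (\<Oplus>\<^bsub>G\<^esub>i\<in>I. g i) = (\<Oplus>\<^bsub>H\<^esub>i\<in>I. f (g i))"
proof -
  interpret G: abelian_group G by fact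
  interpret H: abelian_group H by fact
  show ?thesis
    using assms(4,5)
  proof (induction I rule: finite_induct)
    case empty
    then show ?case using additive_map_zero[OF G H f] by simp
  next
    case (insert i I)
    then show ?case
      using f by (simp add: additive_map_add additive_map_closed Pi_def)
  qed
qed

lemma additive_map_comp:
  "\<lbrakk>additive_map G H f; additive_map H L g\<rbrakk> \<Longrightarrow> additive_map G L (\<lambda>x. g (f x))"
  by (auto simp: additive_map_def Pi_def)

lemma (in abelian_group) additive_map_add_fun:
  assumes "additive_map M G f" "additive_map M G g"
  shows "additive_map M G (\<lambda>x. f x \<oplus> g x)"
  using assms by (intro additive_mapI) (auto simp: additive_map_closed additive_map_add a_ac)

lemma (in abelian_group) additive_map_finsum_fun:
  assumes "abelian_monoid M" "finite I" "\<And>i. i \<in> I \<Longrightarrow> additive_map M G (f i)"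
  shows "additive_map M G (\<lambda>x. \<Oplus>i\<in>I. f i x)"
proof -
  interpret M: abelian_monoid M by fact
  have cl: "f i x \<in> carrier G" if "i \<in> I" "x \<in> carrier M" for i x
    using assms(3)[OF that(1)] that(2) by (rule additive_map_closed)
  show ?thesis
  proof (rule additive_mapI)
    fix x y assume xy: "x \<in> carrier M" "y \<in> carrier M"
    have "(\<Oplus>i\<in>I. f i (x \<oplus>\<^bsub>M\<^esub> y)) = (\<Oplus>i\<in>I. f i x \<oplus> f i y)"
      using cl xy additive_map_add[OF assms(3)] by (intro finsum_cong') (auto simp: Pi_def)
    also have "\<dots> = (\<Oplus>i\<in>I. f i x) \<oplus> (\<Oplus>i\<in>I. f i y)"
      using cl xy by (intro finsum_addf) (auto simp: Pi_def)
    finally show "(\<Oplus>i\<in>I. f i (x \<oplus>\<^bsub>M\<^esub> y)) = (\<Oplus>i\<in>I. f i x) \<oplus> (\<Oplus>i\<in>I. f i y)" .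
  qed (use cl in \<open>auto intro!: finsum_closed\<close>)
qed

lemma (in abelian_monoid) finsum_swap:
  assumes "finite I" "finite J" "\<And>i j. \<lbrakk>i \<in> I; j \<in> J\<rbrakk> \<Longrightarrow> f i j \<in> carrier G"
  shows "(\<Oplus>i\<in>I. \<Oplus>j\<in>J. f i j) = (\<Oplus>j\<in>J. \<Oplus>i\<in>I. f i j)"
  using assms(1,3)
proof (induction I rule: finite_induct)
  case (insert i I)
  then have "(\<Oplus>j\<in>J. \<Oplus>i\<in>insert i I. f i j) = (\<Oplus>j\<in>J. f i j \<oplus> (\<Oplus>i\<in>I. f i j))"
    by (intro finsum_cong') (auto simp: Pi_def)
  also have "\<dots> = (\<Oplus>j\<in>J. f i j) \<oplus> (\<Oplus>j\<in>J. \<Oplus>i\<in>I. f i j)"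
    by (rule finsum_addf) (use insert in \<open>auto simp: Pi_def\<close>)
  finally show ?case using insert by (simp add: Pi_def)
qed simp

section \<open>Quotients of free abelian groups\<close>

text \<open>Expresses that the additive extension of \<open>h\<close> kills \<open>x\<close> without naming that extension.\<close>

definition ext_vanishes ::
  "('a, 'c) ring_scheme \<Rightarrow> 's set \<Rightarrow> ('s \<Rightarrow> 'a) \<Rightarrow> ('s \<Rightarrow>\<^sub>0 int) \<Rightarrow> bool" where
  "ext_vanishes G S h x \<longleftrightarrow> (\<forall>\<phi>. (\<forall>s\<in>S. \<phi> (frag_of s) = h s) \<and>
     (\<forall>f g. Poly_Mapping.keys f \<subseteq> S \<and> Poly_Mapping.keys g \<subseteq> S \<longrightarrow> \<phi> (f - g) = \<phi> f \<ominus>\<^bsub>G\<^esub> \<phi> g)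
     \<longrightarrow> \<phi> x = \<zero>\<^bsub>G\<^esub>)"

lemma keys_frag_diff2:
  assumes "a \<in> S" "b \<in> S"
  shows "Poly_Mapping.keys (frag_of a - frag_of b) \<subseteq> S"
  using assms keys_diff[of "frag_of a" "frag_of b"] by auto

lemma keys_frag_diff3:
  assumes "a \<in> S" "b \<in> S" "c \<in> S"
  shows "Poly_Mapping.keys (frag_of a - frag_of b - frag_of c) \<subseteq> S"
  using keys_frag_diff2[OF assms(1,2)] assms(3) keys_diff[of "frag_of a - frag_of b" "frag_of c"] by auto

text \<open>Every relation imposed on a free abelian group below has the shape a - b or a - b - c.
  This lemma and the next therefore turn well-definedness into a single equation between values of
  \<open>h\<close>.\<close>

lemma ext_vanishes_diff2:
  assumes "abelian_group G" "a \<in> S" "b \<in> S" "h a = h b" "h b \<in> carrier G"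
  shows "ext_vanishes G S h (frag_of a - frag_of b)"
proof -
  interpret G: abelian_group G by fact
  show ?thesis using assms(2-) by (simp add: ext_vanishes_def G.minus_eq G.r_neg)
qed

lemma ext_vanishes_diff3:
  assumes "abelian_group G" "a \<in> S" "b \<in> S" "c \<in> S" "h a = h b \<oplus>\<^bsub>G\<^esub> h c"
    "h b \<in> carrier G" "h c \<in> carrier G"
  shows "ext_vanishes G S h (frag_of a - frag_of b - frag_of c)"
proof -
  interpret G: abelian_group G by fact
  show ?thesis using assms(2-) keys_frag_diff2[of a S b]
    by (simp add: ext_vanishes_def G.minus_eq G.a_comm[of "h b"] G.a_assoc G.r_neg)
qed

lemma add_monoid_free_ab: "add_monoid (free_ab S) = free_Abelian_group S"
  by (simp add: free_ab_def free_Abelian_group_def)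

lemma add_monoid_int_monoid_ring:
  "add_monoid (int_monoid_ring W) = free_Abelian_group (carrier W)"
  by (simp add: int_monoid_ring_def free_ab_def free_Abelian_group_def)

text \<open>Only the additive group of \<open>R\<close> is prescribed, because the quotient is taken
  both for \<open>free_ab\<close>, whose product is a filler, and for
  \<open>int_monoid_ring\<close>, where the quotient becomes a ring.\<close>

locale frag_quot =
  fixes S :: "'s set" and Rel :: "('s \<Rightarrow>\<^sub>0 int) set" and R :: "('s \<Rightarrow>\<^sub>0 int) ring"
  assumes add_monoid_R: "add_monoid R = free_Abelian_group S"
    and Rel_carrier: "\<And>r. r \<in> Rel \<Longrightarrow> Poly_Mapping.keys r \<subseteq> S"
begin

abbreviation "Null \<equiv> generate (free_Abelian_group S) Rel"
abbreviation "cls f \<equiv> Null +>\<^bsub>R\<^esub> f"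
abbreviation "Q \<equiv> R Quot Null"

lemma carrier_R: "carrier R = {f. Poly_Mapping.keys f \<subseteq> S}"
  using arg_cong[OF add_monoid_R, of carrier] by (auto simp: free_Abelian_group_def)

lemma add_R [simp]: "f \<oplus>\<^bsub>R\<^esub> g = f + g"
  using arg_cong[OF add_monoid_R, of "\<lambda>m. mult m f g"] by simp

lemma zero_R [simp]: "\<zero>\<^bsub>R\<^esub> = 0"
  using arg_cong[OF add_monoid_R, of one] by simp

lemma abelian_group_R: "abelian_group R"
  by (rule comm_group_abelian_groupI) (simp only: add_monoid_R abelian_free_Abelian_group)

lemma abelian_subgroup_Null: "abelian_subgroup Null R"
proof (rule abelian_subgroupI3)
  show "additive_subgroup Null R"
    unfolding additive_subgroup_def add_monoid_R
    by (rule group.generate_is_subgroup) (auto dest: Rel_carrier)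
qed (rule abelian_group_R)

lemma Rel_subset: "Rel \<subseteq> carrier (free_Abelian_group S)"
  by (auto dest: Rel_carrier)

lemma Null_keys: "n \<in> Null \<Longrightarrow> Poly_Mapping.keys n \<subseteq> S"
  using group.generate_in_carrier[OF group_free_Abelian_group Rel_subset] by simp

lemma Null_zero: "0 \<in> Null"
  using generate.one[of "free_Abelian_group S" Rel] by simp

lemma Null_add: "\<lbrakk>m \<in> Null; n \<in> Null\<rbrakk> \<Longrightarrow> m + n \<in> Null"
  using generate.eng[of m "free_Abelian_group S" Rel n] by simp

lemma Null_uminus: "n \<in> Null \<Longrightarrow> - n \<in> Null"
  using group.generate_m_inv_closed[OF group_free_Abelian_group Rel_subset, of n]
    inv_free_Abelian_group[OF Null_keys, of n] by simp

lemma Null_minus: "\<lbrakk>m \<in> Null; n \<in> Null\<rbrakk> \<Longrightarrow> m - n \<in> Null"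
  using Null_add[OF _ Null_uminus, of m n] by simp

lemma Null_Rel: "r \<in> Rel \<Longrightarrow> r \<in> Null"
  by (rule generate.incl)

text \<open>Differences replace the products and inverses of \<open>generate\<close>, to match
  \<open>frag_extend_diff\<close> and the two difference laws of \<open>frag_bilin\<close>.\<close>

lemma Null_induct [consumes 1, case_names zero rel minus]:
  assumes "n \<in> Null" and zero: "P 0" and rel: "\<And>r. r \<in> Rel \<Longrightarrow> P r"
    and minus: "\<And>m n. \<lbrakk>m \<in> Null; n \<in> Null; P m; P n\<rbrakk> \<Longrightarrow> P (m - n)"
  shows "P n"
proof -
  have neg: "P (- n)" if "n \<in> Null" "P n" for n
    using minus[OF Null_zero that(1) zero that(2)] by simp
  show ?thesis
    using assms(1)
  proof (induction rule: generate.induct)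
    case one
    then show ?case using zero by simp
  next
    case (incl h)
    then show ?case using rel by simp
  next
    case (inv h)
    then show ?case using neg[OF Null_Rel rel] Rel_carrier by simp
  next
    case (eng m n)
    then show ?case using minus[OF _ Null_uminus _ neg, of m n] by simp
  qed
qed

lemma cls_def': "cls f = {n + f | n. n \<in> Null}"
  by (auto simp: a_r_coset_def r_coset_def add_monoid_R)

lemma cls_self: "f \<in> cls f"
  unfolding cls_def' using Null_zero by (auto intro: exI[of _ 0])

lemma cls_eq_iff: "cls f = cls g \<longleftrightarrow> f - g \<in> Null"
proof
  assume "cls f = cls g"
  then have "f \<in> cls g" using cls_self by blast
  then show "f - g \<in> Null" by (auto simp: cls_def')
next
  assume fg: "f - g \<in> Null"
  have "n + f \<in> cls g" if "n \<in> Null" for n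
    unfolding cls_def' using Null_add[OF that fg] by (auto intro!: exI[of _ "n + (f - g)"])
  moreover have "n + g \<in> cls f" if "n \<in> Null" for n
    unfolding cls_def' using Null_minus[OF that fg] by (auto intro!: exI[of _ "n - (f - g)"])
  ultimately show "cls f = cls g"
    using cls_def'[of f] cls_def'[of g] by auto
qed

lemma cls_eq_of_mem: "g \<in> cls f \<Longrightarrow> cls g = cls f"
  by (auto simp: cls_eq_iff) (auto simp: cls_def')

lemma cls_mem_keys: "\<lbrakk>g \<in> cls f; Poly_Mapping.keys f \<subseteq> S\<rbrakk> \<Longrightarrow> Poly_Mapping.keys g \<subseteq> S"
  using Null_keys keys_add unfolding cls_def' by fastforce

lemma carrier_Q: "carrier Q = {cls f | f. Poly_Mapping.keys f \<subseteq> S}"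
  by (auto simp: FactRing_def A_RCOSETS_def' carrier_R a_r_coset_def)

lemma cls_closed: "Poly_Mapping.keys f \<subseteq> S \<Longrightarrow> cls f \<in> carrier Q"
  by (auto simp: carrier_Q)

lemma cls_of_closed: "s \<in> S \<Longrightarrow> cls (frag_of s) \<in> carrier Q"
  by (simp add: cls_closed)

lemma carrier_Q_E:
  assumes "p \<in> carrier Q"
  obtains f where "Poly_Mapping.keys f \<subseteq> S" "p = cls f"
  using assms by (auto simp: carrier_Q)

lemma cls_add:
  assumes "Poly_Mapping.keys f \<subseteq> S" "Poly_Mapping.keys g \<subseteq> S"
  shows "cls f \<oplus>\<^bsub>Q\<^esub> cls g = cls (f + g)"
  using abelian_subgroup.a_rcos_sum[OF abelian_subgroup_Null, of f g] assms
  by (simp add: FactRing_def carrier_R)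

lemma zero_Q: "\<zero>\<^bsub>Q\<^esub> = cls 0"
  by (simp add: FactRing_def cls_def')

lemma abelian_group_Q: "abelian_group Q"
  by (rule comm_group_abelian_groupI)
    (simp add: FactRing_def
      abelian_subgroup.a_factorgroup_is_comm_group[OF abelian_subgroup_Null, unfolded A_FactGroup_def'])

sublocale Q: abelian_group Q by (rule abelian_group_Q)

lemma cls_uminus:
  assumes "Poly_Mapping.keys f \<subseteq> S"
  shows "\<ominus>\<^bsub>Q\<^esub> cls f = cls (- f)"
  using assms by (intro Q.minus_equality) (auto simp: cls_add cls_closed zero_Q)

lemma cls_minus:
  assumes "Poly_Mapping.keys f \<subseteq> S" "Poly_Mapping.keys g \<subseteq> S"
  shows "cls f \<ominus>\<^bsub>Q\<^esub> cls g = cls (f - g)"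
  using assms by (simp add: Q.minus_eq cls_uminus cls_add)

lemma Q_induct [consumes 1, case_names zero gen minus]:
  assumes p: "p \<in> carrier Q" and zero: "P \<zero>\<^bsub>Q\<^esub>" and gen: "\<And>s. s \<in> S \<Longrightarrow> P (cls (frag_of s))"
    and minus: "\<And>p q. \<lbrakk>p \<in> carrier Q; q \<in> carrier Q; P p; P q\<rbrakk> \<Longrightarrow> P (p \<ominus>\<^bsub>Q\<^esub> q)"
  shows "P p"
proof -
  obtain f where f: "Poly_Mapping.keys f \<subseteq> S" "p = cls f"
    using p by (rule carrier_Q_E)
  have "P (cls f)"
  proof (rule free_Abelian_group_induct[OF f(1), of "\<lambda>f. P (cls f)"])
    show "P (cls 0)" using zero by (simp add: zero_Q)
    show "P (cls (f - g))" if "Poly_Mapping.keys f \<subseteq> S" "Poly_Mapping.keys g \<subseteq> S" "P (cls f)" "P (cls g)" for f g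
      using minus[of "cls f" "cls g"] that by (simp add: cls_minus cls_closed)
  qed (rule gen)
  then show ?thesis using f by simp
qed

lemma Q_additive_eqI:
  assumes p: "p \<in> carrier Q" and G: "abelian_group G"
    and f: "additive_map Q G f" and g: "additive_map Q G g"
    and eq: "\<And>s. s \<in> S \<Longrightarrow> f (cls (frag_of s)) = g (cls (frag_of s))"
  shows "f p = g p"
  using p
proof (induction rule: Q_induct)
  case zero
  show ?case using additive_map_zero[OF abelian_group_Q G f] additive_map_zero[OF abelian_group_Q G g] by simp
next
  case (gen s)
  then show ?case by (rule eq)
next
  case (minus p q)
  then show ?case
    using additive_map_minus[OF abelian_group_Q G f] additive_map_minus[OF abelian_group_Q G g] by simp
qed

lemma Q_lift:
  assumes G: "abelian_group G" and h: "\<And>s. s \<in> S \<Longrightarrow> h s \<in> carrier G"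
    and rel: "\<And>r. r \<in> Rel \<Longrightarrow> ext_vanishes G S h r"
  obtains \<Phi> where "additive_map Q G \<Phi>" "\<And>s. s \<in> S \<Longrightarrow> \<Phi> (cls (frag_of s)) = h s"
proof -
  interpret G: abelian_group G by fact
  obtain \<phi> where hom: "\<phi> \<in> hom (free_Abelian_group S) (add_monoid G)"
    and \<phi>: "\<And>s. s \<in> S \<Longrightarrow> \<phi> (frag_of s) = h s"
    using comm_group.free_Abelian_group_universal[OF G.a_comm_group, of h S] h by auto
  have add: "additive_map R G \<phi>"
    using hom by (simp only: additive_map_hom add_monoid_R)
  have uminus_R: "\<ominus>\<^bsub>R\<^esub> g = - g" if "Poly_Mapping.keys g \<subseteq> S" for g
    using inv_free_Abelian_group[OF that] by (simp only: a_inv_def add_monoid_R)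
  have minus: "\<phi> (f - g) = \<phi> f \<ominus>\<^bsub>G\<^esub> \<phi> g"
    if "Poly_Mapping.keys f \<subseteq> S" "Poly_Mapping.keys g \<subseteq> S" for f g
    using additive_map_minus[OF abelian_group_R G add, of f g] that uminus_R
    by (simp add: carrier_R a_minus_def)
  have closed: "\<phi> f \<in> carrier G" if "Poly_Mapping.keys f \<subseteq> S" for f
    using additive_map_closed[OF add] that by (simp add: carrier_R)
  have null: "\<phi> n = \<zero>\<^bsub>G\<^esub>" if "n \<in> Null" for n
    using that
  proof (induction rule: Null_induct)
    case zero
    then show ?case using additive_map_zero[OF abelian_group_R G add] by simp
  next
    case (rel r)
    \<comment> \<open>The map \<open>\<phi>\<close> is one of those over which
      \<open>ext_vanishes\<close> quantifies.\<close>
    then show ?case using assms(3)[of r] \<phi> \<open>\<And>f g. _ \<Longrightarrow> _ \<Longrightarrow> \<phi> (f - g) = _\<close> by (auto simp: ext_vanishes_def)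
  next
    case (minus m n)
    then show ?case using \<open>\<And>f g. _ \<Longrightarrow> _ \<Longrightarrow> \<phi> (f - g) = _\<close>[of m n] by (simp add: Null_keys G.minus_eq)
  qed
  \<comment> \<open>A class is a set of formal sums. As \<open>\<phi>\<close> kills
    \<open>Null\<close>, any chosen member gives the same value.\<close>
  define \<Phi> where "\<Phi> p = \<phi> (SOME f. f \<in> p)" for p
  have \<Phi>: "\<Phi> (cls f) = \<phi> f" if f: "Poly_Mapping.keys f \<subseteq> S" for f
  proof -
    define g where "g = (SOME g. g \<in> cls f)"
    have g: "g \<in> cls f" unfolding g_def by (rule someI[of _ f]) (rule cls_self)
    then have "cls g = cls f" by (rule cls_eq_of_mem)
    then have "\<phi> (g - f) = \<zero>\<^bsub>G\<^esub>" using null by (simp add: cls_eq_iff)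
    moreover have "Poly_Mapping.keys g \<subseteq> S" using cls_mem_keys[OF g f] .
    ultimately have "\<phi> g = \<phi> f"
      using minus[of g f] f closed[of f] closed[of g] G.minus_equality[of "\<phi> g" "\<ominus>\<^bsub>G\<^esub> \<phi> f"] G.minus_minus
      by (simp add: G.minus_eq)
    then show ?thesis unfolding \<Phi>_def g_def .
  qed
  show ?thesis
  proof
    show "additive_map Q G \<Phi>"
    proof (rule additive_mapI)
      show "\<Phi> p \<in> carrier G" if "p \<in> carrier Q" for p
        using that by (auto elim!: carrier_Q_E simp: \<Phi> closed)
      show "\<Phi> (p \<oplus>\<^bsub>Q\<^esub> q) = \<Phi> p \<oplus>\<^bsub>G\<^esub> \<Phi> q" if pq: "p \<in> carrier Q" "q \<in> carrier Q" for p q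
      proof -
        obtain f g where fg: "Poly_Mapping.keys f \<subseteq> S" "p = cls f" "Poly_Mapping.keys g \<subseteq> S" "q = cls g"
          using pq by (auto elim!: carrier_Q_E)
        moreover have "Poly_Mapping.keys (f + g) \<subseteq> S"
          using fg keys_add[of f g] by blast
        ultimately show ?thesis
          using additive_map_add[OF add, of f g] by (simp add: cls_add \<Phi> carrier_R)
      qed
    qed
    show "\<Phi> (cls (frag_of s)) = h s" if "s \<in> S" for s
      using that by (simp add: \<Phi> \<phi>)
  qed
qed

end

section \<open>Biadditive extension of an operation on generators\<close>

lemma frag_bilin_of [simp]: "frag_bilin h (frag_of u) (frag_of v) = frag_of (h u v)"
  by (simp add: frag_bilin_def)

lemma frag_bilin_0_left [simp]: "frag_bilin h 0 g = 0"
  by (simp add: frag_bilin_def)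

lemma frag_bilin_0_right [simp]: "frag_bilin h f 0 = 0"
  by (simp add: frag_bilin_def frag_extend_eq_0)

lemma frag_bilin_diff_left: "frag_bilin h (f - f') g = frag_bilin h f g - frag_bilin h f' g"
  by (simp add: frag_bilin_def frag_extend_diff)

lemma frag_bilin_add_left: "frag_bilin h (f + f') g = frag_bilin h f g + frag_bilin h f' g"
  by (simp add: frag_bilin_def frag_extend_add)

text \<open>In the first argument \<open>frag_bilin\<close> is an additive extension by definition;
  in the second, additivity has to be carried through an induction over the first.\<close>

lemma frag_bilin_diff_right: "frag_bilin h f (g - g') = frag_bilin h f g - frag_bilin h f g'"
proof -
  have "f \<in> {f. Poly_Mapping.keys f \<subseteq> UNIV}" by simp
  then have "Poly_Mapping.keys f \<subseteq> UNIV" by simp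
  then show ?thesis
    by (induction f rule: frag_induction)
      (auto simp: frag_bilin_diff_left, simp_all add: frag_bilin_def frag_extend_diff)
qed

lemma frag_bilin_add_right: "frag_bilin h f (g + g') = frag_bilin h f g + frag_bilin h f g'"
  using frag_bilin_diff_right[of h f g "- g'"] frag_bilin_diff_right[of h f 0 g'] by simp

lemmas frag_bilin_simps = frag_bilin_diff_left frag_bilin_diff_right

lemma keys_frag_bilin:
  assumes "Poly_Mapping.keys f \<subseteq> U" "Poly_Mapping.keys g \<subseteq> V"
    and "\<And>u v. \<lbrakk>u \<in> U; v \<in> V\<rbrakk> \<Longrightarrow> h u v \<in> S"
  shows "Poly_Mapping.keys (frag_bilin h f g) \<subseteq> S"
  unfolding frag_bilin_def
  by (rule order_trans[OF keys_frag_extend])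
    (use assms in \<open>fastforce dest!: subsetD[OF keys_frag_extend]\<close>)

text \<open>Induction over the relation subgroup and then over \<open>g\<close> leaves only a
  relator paired with a single generator.\<close>

lemma (in frag_quot) frag_bilin_Null_left:
  assumes T: "frag_quot U RelU RU"
    and rel: "\<And>r v. \<lbrakk>r \<in> RelU; v \<in> V\<rbrakk> \<Longrightarrow> frag_bilin h r (frag_of v) \<in> Null"
    and n: "n \<in> generate (free_Abelian_group U) RelU" and g: "Poly_Mapping.keys g \<subseteq> V"
  shows "frag_bilin h n g \<in> Null"
  using n
proof (induction rule: frag_quot.Null_induct[OF T, consumes 1])
  case (2 r)
  show ?case
    using g by (induction g rule: frag_induction)
      (auto simp: frag_bilin_simps 2 rel intro: Null_zero Null_minus)
qed (auto simp: frag_bilin_simps intro: Null_zero Null_minus)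

lemma (in frag_quot) frag_bilin_Null_right:
  assumes T: "frag_quot V RelV RV"
    and rel: "\<And>u r. \<lbrakk>u \<in> U; r \<in> RelV\<rbrakk> \<Longrightarrow> frag_bilin h (frag_of u) r \<in> Null"
    and n: "n \<in> generate (free_Abelian_group V) RelV" and f: "Poly_Mapping.keys f \<subseteq> U"
  shows "frag_bilin h f n \<in> Null"
  using n
proof (induction rule: frag_quot.Null_induct[OF T, consumes 1])
  case (2 r)
  show ?case
    using f by (induction f rule: frag_induction)
      (auto simp: frag_bilin_simps 2 rel intro: Null_zero Null_minus)
qed (auto simp: frag_bilin_simps intro: Null_zero Null_minus)

text \<open>Needed because \<open>tens_lift\<close> is a union over all pairs of representatives:
  once the classes agree, the union collapses to the class computed from any one pair.\<close>

lemma (in frag_quot) UN_cls_frag_bilin: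
  assumes U: "frag_quot U RelU RU" and V: "frag_quot V RelV RV"
    and relU: "\<And>r v. \<lbrakk>r \<in> RelU; v \<in> V\<rbrakk> \<Longrightarrow> frag_bilin h r (frag_of v) \<in> Null"
    and relV: "\<And>u r. \<lbrakk>u \<in> U; r \<in> RelV\<rbrakk> \<Longrightarrow> frag_bilin h (frag_of u) r \<in> Null"
    and f: "Poly_Mapping.keys f \<subseteq> U" and g: "Poly_Mapping.keys g \<subseteq> V"
  shows "(\<Union>f'\<in>generate (free_Abelian_group U) RelU +>\<^bsub>RU\<^esub> f.
      \<Union>g'\<in>generate (free_Abelian_group V) RelV +>\<^bsub>RV\<^esub> g. cls (frag_bilin h f' g'))
    = cls (frag_bilin h f g)"
proof -
  interpret U: frag_quot U RelU RU by fact
  interpret V: frag_quot V RelV RV by fact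
  have "cls (frag_bilin h f' g') = cls (frag_bilin h f g)" if f': "f' \<in> U.cls f" and g': "g' \<in> V.cls g" for f' g'
  proof -
    have "f' - f \<in> U.Null" "g' - g \<in> V.Null"
      using U.cls_eq_of_mem[OF f'] V.cls_eq_of_mem[OF g'] by (simp_all add: U.cls_eq_iff V.cls_eq_iff)
    then have "frag_bilin h (f' - f) g \<in> Null" "frag_bilin h f' (g' - g) \<in> Null"
      using frag_bilin_Null_left[OF U relU, of V "f' - f" g] frag_bilin_Null_right[OF V relV, of U "g' - g" f']
        g U.cls_mem_keys[OF f' f] by blast+
    from Null_add[OF this] show ?thesis
      by (simp add: cls_eq_iff frag_bilin_simps)
  qed
  then show ?thesis
    using U.cls_self[of f] V.cls_self[of g] by blast
qed

section \<open>Tensor products\<close>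

text \<open>Asks for what the relations mention, addition and the two inner actions, so that each
  instance reduces to closure.\<close>

locale tensor_pair =
  fixes R :: "('r, 'c) ring_scheme" and M :: "('r, 'm, 'd) bimod_scheme"
    and N :: "('r, 'n, 'e) bimod_scheme"
  assumes M: "abelian_group M" and N: "abelian_group N"
    and ract_M: "\<lbrakk>r \<in> carrier R; m \<in> carrier M\<rbrakk> \<Longrightarrow> m \<triangleleft>\<^bsub>M\<^esub> r \<in> carrier M"
    and lact_N: "\<lbrakk>r \<in> carrier R; n \<in> carrier N\<rbrakk> \<Longrightarrow> r \<triangleright>\<^bsub>N\<^esub> n \<in> carrier N"
begin

interpretation M: abelian_group M by (rule M)
interpretation N: abelian_group N by (rule N)

lemma tensor_rels_cases:
  assumes "x \<in> tensor_rels R M N"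
    and "\<And>m m' n. \<lbrakk>x = frag_of (m \<oplus>\<^bsub>M\<^esub> m', n) - frag_of (m, n) - frag_of (m', n);
      m \<in> carrier M; m' \<in> carrier M; n \<in> carrier N\<rbrakk> \<Longrightarrow> P"
    and "\<And>m n n'. \<lbrakk>x = frag_of (m, n \<oplus>\<^bsub>N\<^esub> n') - frag_of (m, n) - frag_of (m, n');
      m \<in> carrier M; n \<in> carrier N; n' \<in> carrier N\<rbrakk> \<Longrightarrow> P"
    and "\<And>m k n. \<lbrakk>x = frag_of (m \<triangleleft>\<^bsub>M\<^esub> k, n) - frag_of (m, k \<triangleright>\<^bsub>N\<^esub> n);
      m \<in> carrier M; k \<in> carrier R; n \<in> carrier N\<rbrakk> \<Longrightarrow> P"
  shows P
  using assms(1) unfolding tensor_rels_def by (elim UnE CollectE exE conjE) (fact assms(2-4))+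

lemma tensor_rels_intros:
  "\<lbrakk>m \<in> carrier M; m' \<in> carrier M; n \<in> carrier N\<rbrakk> \<Longrightarrow>
    frag_of (m \<oplus>\<^bsub>M\<^esub> m', n) - frag_of (m, n) - frag_of (m', n) \<in> tensor_rels R M N"
  "\<lbrakk>m \<in> carrier M; n \<in> carrier N; n' \<in> carrier N\<rbrakk> \<Longrightarrow>
    frag_of (m, n \<oplus>\<^bsub>N\<^esub> n') - frag_of (m, n) - frag_of (m, n') \<in> tensor_rels R M N"
  "\<lbrakk>m \<in> carrier M; k \<in> carrier R; n \<in> carrier N\<rbrakk> \<Longrightarrow>
    frag_of (m \<triangleleft>\<^bsub>M\<^esub> k, n) - frag_of (m, k \<triangleright>\<^bsub>N\<^esub> n) \<in> tensor_rels R M N"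
  unfolding tensor_rels_def by blast+

lemma tensor_rels_keys:
  assumes "r \<in> tensor_rels R M N"
  shows "Poly_Mapping.keys r \<subseteq> carrier M \<times> carrier N"
proof -
  show ?thesis
    using assms unfolding tensor_rels_def
    by (elim UnE CollectE exE conjE; simp only:; intro keys_frag_diff3 keys_frag_diff2)
      (auto simp: ract_M lact_N)
qed

sublocale fq: frag_quot "carrier M \<times> carrier N" "tensor_rels R M N" "free_ab (carrier M \<times> carrier N)"
  by unfold_locales (auto simp only: add_monoid_free_ab dest: tensor_rels_keys)

text \<open>The generic locale produces facts about \<open>generate\<close> and \<open>Quot\<close>;
  folding these names turns them into facts about \<open>tensor\<close>.\<close>

lemmas fq_fold = tensor_null_def[symmetric] tensor_def[symmetric] tens_cls_def[symmetric]

lemma abelian_group_tensor: "abelian_group (tensor R M N)"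
  using fq.abelian_group_Q unfolding fq_fold .

lemma tens_cls_closed: "Poly_Mapping.keys f \<subseteq> carrier M \<times> carrier N \<Longrightarrow> tens_cls R M N f \<in> carrier (tensor R M N)"
  using fq.cls_closed unfolding fq_fold .

lemma tens_closed: "\<lbrakk>m \<in> carrier M; n \<in> carrier N\<rbrakk> \<Longrightarrow> tens R M N m n \<in> carrier (tensor R M N)"
  by (rule tens_cls_closed) simp

lemmas tens_cls_minus = fq.cls_minus[unfolded fq_fold]
lemmas tens_cls_add = fq.cls_add[unfolded fq_fold]
lemmas zero_tensor = fq.zero_Q[unfolded fq_fold]
lemmas tens_cls_mem_keys = fq.cls_mem_keys[unfolded fq_fold]
lemmas tens_cls_eq_of_mem = fq.cls_eq_of_mem[unfolded fq_fold]
lemmas tens_cls_self = fq.cls_self[unfolded fq_fold]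
lemmas carrier_tensor_E = fq.carrier_Q_E[unfolded fq_fold]

lemma tensor_induct [consumes 1, case_names zero tens minus]:
  assumes "p \<in> carrier (tensor R M N)" "P \<zero>\<^bsub>tensor R M N\<^esub>"
    and "\<And>m n. \<lbrakk>m \<in> carrier M; n \<in> carrier N\<rbrakk> \<Longrightarrow> P (tens R M N m n)"
    and "\<And>p q. \<lbrakk>p \<in> carrier (tensor R M N); q \<in> carrier (tensor R M N); P p; P q\<rbrakk>
      \<Longrightarrow> P (p \<ominus>\<^bsub>tensor R M N\<^esub> q)"
  shows "P p"
  using fq.Q_induct[unfolded fq_fold, of p P] assms by auto

lemma tensor_additive_eqI:
  assumes "abelian_group G" "additive_map (tensor R M N) G f" "additive_map (tensor R M N) G g"
    and "\<And>m n. \<lbrakk>m \<in> carrier M; n \<in> carrier N\<rbrakk> \<Longrightarrow> f (tens R M N m n) = g (tens R M N m n)"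
    and "p \<in> carrier (tensor R M N)"
  shows "f p = g p"
  using fq.Q_additive_eqI[unfolded fq_fold, of p G f g] assms by auto

lemma tens_add_left:
  assumes "m \<in> carrier M" "m' \<in> carrier M" "n \<in> carrier N"
  shows "tens R M N (m \<oplus>\<^bsub>M\<^esub> m') n = tens R M N m n \<oplus>\<^bsub>tensor R M N\<^esub> tens R M N m' n"
proof -
  have "frag_of (m \<oplus>\<^bsub>M\<^esub> m', n) - frag_of (m, n) - frag_of (m', n) \<in> tensor_rels R M N"
    using assms by (auto simp: tensor_rels_def)
  from fq.Null_Rel[OF this] have "tens R M N (m \<oplus>\<^bsub>M\<^esub> m') n = tens_cls R M N (frag_of (m, n) + frag_of (m', n))"
    by (simp add: tens_cls_def tensor_null_def fq.cls_eq_iff algebra_simps)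
  then show ?thesis using assms by (simp add: tens_cls_add)
qed

lemma tens_add_right:
  assumes "m \<in> carrier M" "n \<in> carrier N" "n' \<in> carrier N"
  shows "tens R M N m (n \<oplus>\<^bsub>N\<^esub> n') = tens R M N m n \<oplus>\<^bsub>tensor R M N\<^esub> tens R M N m n'"
proof -
  have "frag_of (m, n \<oplus>\<^bsub>N\<^esub> n') - frag_of (m, n) - frag_of (m, n') \<in> tensor_rels R M N"
    using assms by (auto simp: tensor_rels_def)
  from fq.Null_Rel[OF this] have "tens R M N m (n \<oplus>\<^bsub>N\<^esub> n') = tens_cls R M N (frag_of (m, n) + frag_of (m, n'))"
    by (simp add: tens_cls_def tensor_null_def fq.cls_eq_iff algebra_simps)
  then show ?thesis using assms by (simp add: tens_cls_add)
qed

lemma tens_balanced: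
  assumes "m \<in> carrier M" "r \<in> carrier R" "n \<in> carrier N"
  shows "tens R M N (m \<triangleleft>\<^bsub>M\<^esub> r) n = tens R M N m (r \<triangleright>\<^bsub>N\<^esub> n)"
proof -
  have "frag_of (m \<triangleleft>\<^bsub>M\<^esub> r, n) - frag_of (m, r \<triangleright>\<^bsub>N\<^esub> n) \<in> tensor_rels R M N"
    using assms by (auto simp: tensor_rels_def)
  from fq.Null_Rel[OF this] show ?thesis
    by (simp add: tens_cls_def tensor_null_def fq.cls_eq_iff)
qed

lemma tens_additive_left: "n \<in> carrier N \<Longrightarrow> additive_map M (tensor R M N) (\<lambda>m. tens R M N m n)"
  by (intro additive_mapI tens_closed tens_add_left)

lemma tens_additive_right: "m \<in> carrier M \<Longrightarrow> additive_map N (tensor R M N) (\<lambda>n. tens R M N m n)"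
  by (intro additive_mapI tens_closed tens_add_right)

lemma tensor_lift:
  assumes G: "abelian_group G"
    and left: "\<And>n. n \<in> carrier N \<Longrightarrow> additive_map M G (\<lambda>m. h m n)"
    and right: "\<And>m. m \<in> carrier M \<Longrightarrow> additive_map N G (h m)"
    and bal: "\<And>m r n. \<lbrakk>m \<in> carrier M; r \<in> carrier R; n \<in> carrier N\<rbrakk> \<Longrightarrow> h (m \<triangleleft>\<^bsub>M\<^esub> r) n = h m (r \<triangleright>\<^bsub>N\<^esub> n)"
  obtains \<Phi> where "additive_map (tensor R M N) G \<Phi>"
    "\<And>m n. \<lbrakk>m \<in> carrier M; n \<in> carrier N\<rbrakk> \<Longrightarrow> \<Phi> (tens R M N m n) = h m n"
proof -
  interpret G: abelian_group G by fact
  have hcl: "h m n \<in> carrier G" if "m \<in> carrier M" "n \<in> carrier N" for m n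
    using additive_map_closed[OF left] that by auto
  have rel: "ext_vanishes G (carrier M \<times> carrier N) (case_prod h) r" if r: "r \<in> tensor_rels R M N" for r
    using r unfolding tensor_rels_def
    by (elim UnE CollectE exE conjE; simp only:; intro ext_vanishes_diff3 ext_vanishes_diff2 G)
      (auto simp: hcl ract_M lact_N bal additive_map_add[OF left] additive_map_add[OF right])
  obtain \<Phi> where \<Phi>: "additive_map (tensor R M N) G \<Phi>"
    "\<And>s. s \<in> carrier M \<times> carrier N \<Longrightarrow> \<Phi> (tens_cls R M N (frag_of s)) = case_prod h s"
    by (rule fq.Q_lift[OF G, of "case_prod h", unfolded fq_fold]) (auto intro: hcl rel)
  show ?thesis
    by (rule that[OF \<Phi>(1)]) (use \<Phi>(2) in auto)
qed

end

lemma carrier_mk_bimod [simp]: "carrier (mk_bimod G l r) = carrier G"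
  and add_mk_bimod [simp]: "ring.add (mk_bimod G l r) = ring.add G"
  and zero_mk_bimod [simp]: "ring.zero (mk_bimod G l r) = ring.zero G"
  and lact_mk_bimod [simp]: "lact (mk_bimod G l r) = l"
  and ract_mk_bimod [simp]: "ract (mk_bimod G l r) = r"
  by (simp_all add: mk_bimod_def)

text \<open>For bimodules made by \<open>mk_bimod\<close>, which place the additive fields of a
  given group in a new record.\<close>

lemma abelian_group_cong:
  assumes "abelian_group G" "carrier H = carrier G" "ring.add H = ring.add G" "ring.zero H = ring.zero G"
  shows "abelian_group H"
  by (rule abelian_groupI) (use abelian_groupE[OF assms(1)] in \<open>simp_all add: assms(2-4)\<close>)

section \<open>Rings presented by monoid rings\<close>

lemma carrier_int_monoid_ring: "carrier (int_monoid_ring W) = {f. Poly_Mapping.keys f \<subseteq> carrier W}"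
  and mult_int_monoid_ring: "f \<otimes>\<^bsub>int_monoid_ring W\<^esub> g = frag_bilin (\<lambda>u v. u \<otimes>\<^bsub>W\<^esub> v) f g"
  and one_int_monoid_ring: "\<one>\<^bsub>int_monoid_ring W\<^esub> = frag_of \<one>\<^bsub>W\<^esub>"
  and add_int_monoid_ring: "f \<oplus>\<^bsub>int_monoid_ring W\<^esub> g = f + g"
  by (simp_all add: int_monoid_ring_def free_ab_def)

lemma ring_int_monoid_ring:
  assumes "monoid W"
  shows "ring (int_monoid_ring W)"
proof (rule ringI)
  interpret monoid W by fact
  let ?m = "frag_bilin (\<lambda>u v. u \<otimes>\<^bsub>W\<^esub> v)"
  show "abelian_group (int_monoid_ring W)"
    by (rule comm_group_abelian_groupI)
      (simp only: add_monoid_int_monoid_ring abelian_free_Abelian_group)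
  have assoc: "?m (?m f g) h = ?m f (?m g h)"
    if "Poly_Mapping.keys f \<subseteq> carrier W" "Poly_Mapping.keys g \<subseteq> carrier W" "Poly_Mapping.keys h \<subseteq> carrier W"
    for f g h
    using that(1)
  proof (induction f rule: frag_induction)
    case (one a)
    show ?case
      using that(2)
    proof (induction g rule: frag_induction)
      case (one b)
      show ?case
        using that(3) \<open>a \<in> _\<close> \<open>b \<in> _\<close>
        by (induction h rule: frag_induction) (simp_all add: frag_bilin_simps m_assoc)
    qed (simp_all add: frag_bilin_simps)
  qed (simp_all add: frag_bilin_simps)
  have l_one: "?m (frag_of \<one>\<^bsub>W\<^esub>) f = f" if "Poly_Mapping.keys f \<subseteq> carrier W" for f
    using that by (induction f rule: frag_induction) (simp_all add: frag_bilin_simps)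
  have r_one: "?m f (frag_of \<one>\<^bsub>W\<^esub>) = f" if "Poly_Mapping.keys f \<subseteq> carrier W" for f
    using that by (induction f rule: frag_induction) (simp_all add: frag_bilin_simps)
  show "monoid (int_monoid_ring W)"
  proof (rule monoidI)
    fix f g assume "f \<in> carrier (int_monoid_ring W)" "g \<in> carrier (int_monoid_ring W)"
    then show "f \<otimes>\<^bsub>int_monoid_ring W\<^esub> g \<in> carrier (int_monoid_ring W)"
      unfolding carrier_int_monoid_ring mult_int_monoid_ring
      by (intro CollectI keys_frag_bilin[of f "carrier W" g "carrier W"]) auto
  qed (simp_all add: carrier_int_monoid_ring mult_int_monoid_ring one_int_monoid_ring assoc l_one r_one)
qed (auto simp: mult_int_monoid_ring add_int_monoid_ring frag_bilin_add_left frag_bilin_add_right)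

text \<open>The subgroup generated by \<open>Rel\<close> is an ideal as soon as multiplying a
  relator by a monoid element, on either side, stays in it: both factors of a general product are
  integer combinations of such elements.\<close>

locale monoid_ring_quot = W: monoid W + frag_quot "carrier W" Rel "int_monoid_ring W"
  for W :: "'w monoid" and Rel +
  assumes Rel_left: "\<lbrakk>u \<in> carrier W; r \<in> Rel\<rbrakk> \<Longrightarrow> frag_bilin (\<lambda>u v. u \<otimes>\<^bsub>W\<^esub> v) (frag_of u) r \<in> Null"
    and Rel_right: "\<lbrakk>u \<in> carrier W; r \<in> Rel\<rbrakk> \<Longrightarrow> frag_bilin (\<lambda>u v. u \<otimes>\<^bsub>W\<^esub> v) r (frag_of u) \<in> Null"
begin

lemma ideal_Null: "ideal Null (int_monoid_ring W)"
proof (rule idealI)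
  show "ring (int_monoid_ring W)" by (rule ring_int_monoid_ring) (rule W.monoid_axioms)
  show "subgroup Null (add_monoid (int_monoid_ring W))"
    using abelian_subgroup_Null by (simp add: abelian_subgroup_def additive_subgroup_def)
  show "x \<otimes>\<^bsub>int_monoid_ring W\<^esub> n \<in> Null" if "n \<in> Null" "x \<in> carrier (int_monoid_ring W)" for n x
    using frag_bilin_Null_right[OF frag_quot_axioms Rel_left, of "carrier W" n x] that
    by (simp add: carrier_int_monoid_ring mult_int_monoid_ring)
  show "n \<otimes>\<^bsub>int_monoid_ring W\<^esub> x \<in> Null" if "n \<in> Null" "x \<in> carrier (int_monoid_ring W)" for n x
    using frag_bilin_Null_left[OF frag_quot_axioms Rel_right, of "carrier W" n x] that
    by (simp add: carrier_int_monoid_ring mult_int_monoid_ring)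
qed

lemma ring_Q: "ring Q"
  by (rule ideal.quotient_is_ring) (rule ideal_Null)

sublocale Q: ring Q by (rule ring_Q)

lemma one_Q: "\<one>\<^bsub>Q\<^esub> = cls (frag_of \<one>\<^bsub>W\<^esub>)"
  by (simp add: FactRing_def one_int_monoid_ring)

lemma cls_mult:
  assumes "Poly_Mapping.keys f \<subseteq> carrier W" "Poly_Mapping.keys g \<subseteq> carrier W"
  shows "cls f \<otimes>\<^bsub>Q\<^esub> cls g = cls (frag_bilin (\<lambda>u v. u \<otimes>\<^bsub>W\<^esub> v) f g)"
  using ideal.rcoset_mult_add[OF ideal_Null, of f g] assms
  by (simp add: FactRing_def carrier_int_monoid_ring mult_int_monoid_ring)

lemma cls_mult_of:
  "\<lbrakk>u \<in> carrier W; v \<in> carrier W\<rbrakk> \<Longrightarrow> cls (frag_of u) \<otimes>\<^bsub>Q\<^esub> cls (frag_of v) = cls (frag_of (u \<otimes>\<^bsub>W\<^esub> v))"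
  by (simp add: cls_mult)

text \<open>Both sides of the multiplicativity equation are additive in each variable, so it is
  enough that \<open>h\<close> is multiplicative on \<open>W\<close>.\<close>

lemma Q_ring_lift:
  assumes B: "ring B" and h: "\<And>s. s \<in> carrier W \<Longrightarrow> h s \<in> carrier B"
    and mult: "\<And>s t. \<lbrakk>s \<in> carrier W; t \<in> carrier W\<rbrakk> \<Longrightarrow> h (s \<otimes>\<^bsub>W\<^esub> t) = h s \<otimes>\<^bsub>B\<^esub> h t"
    and one: "h \<one>\<^bsub>W\<^esub> = \<one>\<^bsub>B\<^esub>"
    and rel: "\<And>r. r \<in> Rel \<Longrightarrow> ext_vanishes B (carrier W) h r"
  obtains \<Phi> where "\<Phi> \<in> ring_hom Q B" "\<And>s. s \<in> carrier W \<Longrightarrow> \<Phi> (cls (frag_of s)) = h s"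
proof -
  interpret B: ring B by fact
  obtain \<Phi> where add: "additive_map Q B \<Phi>" and \<Phi>: "\<And>s. s \<in> carrier W \<Longrightarrow> \<Phi> (cls (frag_of s)) = h s"
    by (rule Q_lift[OF B.is_abelian_group, of h]) (auto intro: h rel)
  have cl: "\<Phi> p \<in> carrier B" if "p \<in> carrier Q" for p
    using additive_map_closed[OF add that] .
  have mult_\<Phi>: "\<Phi> (p \<otimes>\<^bsub>Q\<^esub> q) = \<Phi> p \<otimes>\<^bsub>B\<^esub> \<Phi> q" if p: "p \<in> carrier Q" and q: "q \<in> carrier Q" for p q
    using p
  proof (rule Q_additive_eqI)
    show "abelian_group B" by (rule B.is_abelian_group)
    show "additive_map Q B (\<lambda>p. \<Phi> (p \<otimes>\<^bsub>Q\<^esub> q))" "additive_map Q B (\<lambda>p. \<Phi> p \<otimes>\<^bsub>B\<^esub> \<Phi> q)"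
      using q cl additive_map_add[OF add] by (auto intro!: additive_mapI simp: Q.l_distr B.l_distr)
    show "\<Phi> (cls (frag_of s) \<otimes>\<^bsub>Q\<^esub> q) = \<Phi> (cls (frag_of s)) \<otimes>\<^bsub>B\<^esub> \<Phi> q" if s: "s \<in> carrier W" for s
      using q
    proof (rule Q_additive_eqI)
      show "abelian_group B" by (rule B.is_abelian_group)
      have [simp]: "cls (frag_of s) \<in> carrier Q" using s by (rule cls_of_closed)
      show "additive_map Q B (\<lambda>q. \<Phi> (cls (frag_of s) \<otimes>\<^bsub>Q\<^esub> q))"
        "additive_map Q B (\<lambda>q. \<Phi> (cls (frag_of s)) \<otimes>\<^bsub>B\<^esub> \<Phi> q)"
        using cl additive_map_add[OF add] by (auto intro!: additive_mapI simp: Q.r_distr B.r_distr)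
    qed (use s in \<open>simp add: \<Phi> cls_mult_of mult\<close>)
  qed
  show ?thesis
  proof
    show "\<Phi> \<in> ring_hom Q B"
      by (rule ring_hom_memI)
        (auto simp: cl mult_\<Phi> additive_map_add[OF add] one_Q \<Phi> one)
  qed (rule \<Phi>)
qed

end

section \<open>Tensor algebras\<close>

locale tensor_alg = bimodule R V
  for R :: "('r, 'c) ring_scheme" and V :: "('r, 'v, 'd) bimod_scheme"
begin

abbreviation "WM \<equiv> word_monoid R V"

lemma carrier_WM: "carrier WM = carrier R \<times> lists (carrier V)"
  and one_WM: "\<one>\<^bsub>WM\<^esub> = (\<one>\<^bsub>R\<^esub>, [])"
  by (simp_all add: word_monoid_def)

lemma mult_WM:
  "(r, []) \<otimes>\<^bsub>WM\<^esub> (s, vs) = (r \<otimes>\<^bsub>R\<^esub> s, vs)"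
  "(r, us @ [u]) \<otimes>\<^bsub>WM\<^esub> (s, vs) = (r, us @ [u \<triangleleft>\<^bsub>V\<^esub> s] @ vs)"
  by (simp_all add: word_monoid_def)

text \<open>The next coefficient multiplies if the word before it is empty and acts on the last
  letter otherwise. Associativity across the two regimes is \<open>ract_mult\<close>.\<close>

lemma monoid_WM: "monoid WM"
proof (rule monoidI)
  fix x y assume "x \<in> carrier WM" "y \<in> carrier WM"
  then show "x \<otimes>\<^bsub>WM\<^esub> y \<in> carrier WM"
    by (cases x; cases y; cases "snd x" rule: rev_exhaust)
      (auto simp: carrier_WM mult_WM ract_closed simp del: append.simps)
next
  fix x y z assume "x \<in> carrier WM" "y \<in> carrier WM" "z \<in> carrier WM"
  then show "x \<otimes>\<^bsub>WM\<^esub> y \<otimes>\<^bsub>WM\<^esub> z = x \<otimes>\<^bsub>WM\<^esub> (y \<otimes>\<^bsub>WM\<^esub> z)"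
  proof -
    obtain r us s vs t ws where x: "x = (r, us)" and y: "y = (s, vs)" and z: "z = (t, ws)"
      by (cases x; cases y; cases z) auto
    \<comment> \<open>The simplifier turns appended singletons into cons form; these variants of
      \<open>mult_WM\<close> match the result.\<close>
    have m2: "(r, us @ u # vs' @ [v]) \<otimes>\<^bsub>WM\<^esub> (t, ws) = (r, us @ u # vs' @ [v \<triangleleft>\<^bsub>V\<^esub> t] @ ws)" for r us u vs' v
      using mult_WM(2)[of r "us @ u # vs'" v t ws] by simp
    have m3: "(r, [u]) \<otimes>\<^bsub>WM\<^esub> (t, ws) = (r, [u \<triangleleft>\<^bsub>V\<^esub> t] @ ws)" for r u
      using mult_WM(2)[of r "[]" u t ws] by simp
    show ?thesis
      using \<open>x \<in> _\<close> \<open>y \<in> _\<close> \<open>z \<in> _\<close> unfolding x y z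
      by (cases us rule: rev_exhaust; cases vs rule: rev_exhaust)
        (auto simp: carrier_WM mult_WM m2 m3 R.m_assoc ract_mult)
  qed
next
  fix x assume "x \<in> carrier WM"
  then show "\<one>\<^bsub>WM\<^esub> \<otimes>\<^bsub>WM\<^esub> x = x" "x \<otimes>\<^bsub>WM\<^esub> \<one>\<^bsub>WM\<^esub> = x"
    by (cases x; cases "snd x" rule: rev_exhaust;
        auto simp: carrier_WM one_WM mult_WM ract_one)+
qed (simp add: carrier_WM one_WM)

lemma tensor_power_rels_cases [consumes 1, case_names coeff entry left inner]:
  assumes "x \<in> tensor_power_rels R V"
    and "\<And>r s vs. \<lbrakk>x = frag_of (r \<oplus>\<^bsub>R\<^esub> s, vs) - frag_of (r, vs) - frag_of (s, vs);
      r \<in> carrier R; s \<in> carrier R; vs \<in> lists (carrier V)\<rbrakk> \<Longrightarrow> P"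
    and "\<And>r us v w vs. \<lbrakk>x = frag_of (r, us @ [v \<oplus>\<^bsub>V\<^esub> w] @ vs) - frag_of (r, us @ [v] @ vs) - frag_of (r, us @ [w] @ vs);
      r \<in> carrier R; us \<in> lists (carrier V); v \<in> carrier V; w \<in> carrier V; vs \<in> lists (carrier V)\<rbrakk> \<Longrightarrow> P"
    and "\<And>r s v vs. \<lbrakk>x = frag_of (r \<otimes>\<^bsub>R\<^esub> s, [v] @ vs) - frag_of (r, [s \<triangleright>\<^bsub>V\<^esub> v] @ vs);
      r \<in> carrier R; s \<in> carrier R; v \<in> carrier V; vs \<in> lists (carrier V)\<rbrakk> \<Longrightarrow> P"
    and "\<And>r s us v w vs. \<lbrakk>x = frag_of (r, us @ [v \<triangleleft>\<^bsub>V\<^esub> s, w] @ vs) - frag_of (r, us @ [v, s \<triangleright>\<^bsub>V\<^esub> w] @ vs);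
      r \<in> carrier R; s \<in> carrier R; us \<in> lists (carrier V); v \<in> carrier V; w \<in> carrier V; vs \<in> lists (carrier V)\<rbrakk> \<Longrightarrow> P"
  shows P
  using assms(1) unfolding tensor_power_rels_def by (elim UnE CollectE exE conjE) (fact assms(2-5))+

lemma tensor_power_rels_intros:
  "\<lbrakk>r \<in> carrier R; s \<in> carrier R; vs \<in> lists (carrier V)\<rbrakk> \<Longrightarrow>
    frag_of (r \<oplus>\<^bsub>R\<^esub> s, vs) - frag_of (r, vs) - frag_of (s, vs) \<in> tensor_power_rels R V"
  "\<lbrakk>r \<in> carrier R; us \<in> lists (carrier V); v \<in> carrier V; w \<in> carrier V; vs \<in> lists (carrier V)\<rbrakk> \<Longrightarrow>
    frag_of (r, us @ [v \<oplus>\<^bsub>V\<^esub> w] @ vs) - frag_of (r, us @ [v] @ vs) - frag_of (r, us @ [w] @ vs) \<in> tensor_power_rels R V"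
  "\<lbrakk>r \<in> carrier R; s \<in> carrier R; v \<in> carrier V; vs \<in> lists (carrier V)\<rbrakk> \<Longrightarrow>
    frag_of (r \<otimes>\<^bsub>R\<^esub> s, [v] @ vs) - frag_of (r, [s \<triangleright>\<^bsub>V\<^esub> v] @ vs) \<in> tensor_power_rels R V"
  "\<lbrakk>r \<in> carrier R; s \<in> carrier R; us \<in> lists (carrier V); v \<in> carrier V; w \<in> carrier V; vs \<in> lists (carrier V)\<rbrakk> \<Longrightarrow>
    frag_of (r, us @ [v \<triangleleft>\<^bsub>V\<^esub> s, w] @ vs) - frag_of (r, us @ [v, s \<triangleright>\<^bsub>V\<^esub> w] @ vs) \<in> tensor_power_rels R V"
  unfolding tensor_power_rels_def by blast+

lemma tensor_power_rels_keys:
  assumes "x \<in> tensor_power_rels R V"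
  shows "Poly_Mapping.keys x \<subseteq> carrier WM"
proof -
  show ?thesis
    using assms
    by (cases rule: tensor_power_rels_cases; simp only:; intro keys_frag_diff3 keys_frag_diff2)
      (auto simp: carrier_WM lact_closed ract_closed)
qed

text \<open>An empty word only changes the coefficient of the relator. A nonempty word absorbs that
  coefficient into its last letter, which turns a \<open>coeff\<close> relator into an
  \<open>entry\<close> relator and a \<open>left\<close> relator into an \<open>inner\<close>
  one.\<close>

lemma word_left:
  assumes u: "u \<in> carrier WM" and x: "x \<in> tensor_power_rels R V"
  shows "frag_bilin (\<lambda>u v. u \<otimes>\<^bsub>WM\<^esub> v) (frag_of u) x \<in> tensor_power_rels R V"
proof -
  obtain t ws where ut: "u = (t, ws)" and t: "t \<in> carrier R" "ws \<in> lists (carrier V)"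
    using u by (cases u) (auto simp: carrier_WM)
  show ?thesis
  proof (cases ws rule: rev_exhaust)
    case Nil
    show ?thesis using x
    proof (cases rule: tensor_power_rels_cases)
      case (coeff r s vs)
      then show ?thesis using tensor_power_rels_intros(1)[of "t \<otimes>\<^bsub>R\<^esub> r" "t \<otimes>\<^bsub>R\<^esub> s" vs] t
        by (simp add: ut Nil frag_bilin_simps mult_WM R.r_distr)
    next
      case (entry r us v w vs)
      then show ?thesis using tensor_power_rels_intros(2)[of "t \<otimes>\<^bsub>R\<^esub> r" us v w vs] t
        by (simp add: ut Nil frag_bilin_simps mult_WM)
    next
      case (left r s v vs)
      then show ?thesis using tensor_power_rels_intros(3)[of "t \<otimes>\<^bsub>R\<^esub> r" s v vs] t
        by (simp add: ut Nil frag_bilin_simps mult_WM R.m_assoc)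
    next
      case (inner r s us v w vs)
      then show ?thesis using tensor_power_rels_intros(4)[of "t \<otimes>\<^bsub>R\<^esub> r" s us v w vs] t
        by (simp add: ut Nil frag_bilin_simps mult_WM)
    qed
  next
    case (snoc a b)
    have ab: "a \<in> lists (carrier V)" "b \<in> carrier V" using t snoc by auto
    show ?thesis using x
    proof (cases rule: tensor_power_rels_cases)
      case (coeff r s vs)
      then show ?thesis using tensor_power_rels_intros(2)[of t a "b \<triangleleft>\<^bsub>V\<^esub> r" "b \<triangleleft>\<^bsub>V\<^esub> s" vs] t ab
        by (simp add: ut snoc frag_bilin_simps mult_WM ract_add_r ract_closed)
    next
      case (entry r us v w vs)
      then show ?thesis using tensor_power_rels_intros(2)[of t "a @ [b \<triangleleft>\<^bsub>V\<^esub> r] @ us" v w vs] t ab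
        by (simp add: ut snoc frag_bilin_simps mult_WM ract_closed)
    next
      case (left r s v vs)
      then show ?thesis using tensor_power_rels_intros(4)[of t s a "b \<triangleleft>\<^bsub>V\<^esub> r" v vs] t ab
        by (simp add: ut snoc frag_bilin_simps mult_WM ract_mult ract_closed)
    next
      case (inner r s us v w vs)
      then show ?thesis using tensor_power_rels_intros(4)[of t s "a @ [b \<triangleleft>\<^bsub>V\<^esub> r] @ us" v w vs] t ab
        by (simp add: ut snoc frag_bilin_simps mult_WM ract_closed)
    qed
  qed
qed

text \<open>Now the coefficient \<open>t\<close> is absorbed at the right end of the relator. In the
  case \<open>Nil\<close> the relation itself sits at that end: then \<open>t\<close> distributes
  over the sum in \<open>coeff\<close> and \<open>entry\<close>, and it passes the left action by
  \<open>lact_ract\<close> in \<open>left\<close> and \<open>inner\<close>.\<close>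

lemma word_right:
  assumes u: "u \<in> carrier WM" and x: "x \<in> tensor_power_rels R V"
  shows "frag_bilin (\<lambda>u v. u \<otimes>\<^bsub>WM\<^esub> v) x (frag_of u) \<in> tensor_power_rels R V"
proof -
  obtain t ws where ut: "u = (t, ws)" and t: "t \<in> carrier R" "ws \<in> lists (carrier V)"
    using u by (cases u) (auto simp: carrier_WM)
  have m: "(r, us @ v # vs @ [w]) \<otimes>\<^bsub>WM\<^esub> (s, xs) = (r, us @ v # vs @ w \<triangleleft>\<^bsub>V\<^esub> s # xs)"
    "(r, us @ v # v' # vs @ [w]) \<otimes>\<^bsub>WM\<^esub> (s, xs) = (r, us @ v # v' # vs @ w \<triangleleft>\<^bsub>V\<^esub> s # xs)"
    "(r, us @ [v, w]) \<otimes>\<^bsub>WM\<^esub> (s, xs) = (r, us @ v # w \<triangleleft>\<^bsub>V\<^esub> s # xs)"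
    "(r, v # vs @ [w]) \<otimes>\<^bsub>WM\<^esub> (s, xs) = (r, v # vs @ w \<triangleleft>\<^bsub>V\<^esub> s # xs)"
    "(r, [w]) \<otimes>\<^bsub>WM\<^esub> (s, xs) = (r, w \<triangleleft>\<^bsub>V\<^esub> s # xs)"
    for r us v v' vs w s xs
    using mult_WM(2)[of r "us @ v # vs" w s xs] mult_WM(2)[of r "us @ v # v' # vs" w s xs]
      mult_WM(2)[of r "us @ [v]" w s xs] mult_WM(2)[of r "v # vs" w s xs] mult_WM(2)[of r "[]" w s xs] by simp_all
  show ?thesis using x
  proof (cases rule: tensor_power_rels_cases)
    case (coeff r s vs)
    then show ?thesis
    proof (cases vs rule: rev_exhaust)
      case Nil
      then show ?thesis using coeff tensor_power_rels_intros(1)[of "r \<otimes>\<^bsub>R\<^esub> t" "s \<otimes>\<^bsub>R\<^esub> t" ws] t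
        by (simp add: ut frag_bilin_simps mult_WM R.l_distr)
    next
      case (snoc vs' v)
      then show ?thesis using coeff tensor_power_rels_intros(1)[of r s "vs' @ [v \<triangleleft>\<^bsub>V\<^esub> t] @ ws"] t
        by (simp add: ut frag_bilin_simps mult_WM ract_closed)
    qed
  next
    case (entry r us v w vs)
    then show ?thesis
    proof (cases vs rule: rev_exhaust)
      case Nil
      then show ?thesis using entry tensor_power_rels_intros(2)[of r us "v \<triangleleft>\<^bsub>V\<^esub> t" "w \<triangleleft>\<^bsub>V\<^esub> t" ws] t
        by (simp add: ut frag_bilin_simps mult_WM ract_closed ract_add_l)
    next
      case (snoc vs' z)
      then show ?thesis using entry tensor_power_rels_intros(2)[of r us v w "vs' @ [z \<triangleleft>\<^bsub>V\<^esub> t] @ ws"] t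
        by (simp add: ut frag_bilin_simps m ract_closed)
    qed
  next
    case (left r s v vs)
    then show ?thesis
    proof (cases vs rule: rev_exhaust)
      case Nil
      then show ?thesis using left tensor_power_rels_intros(3)[of r s "v \<triangleleft>\<^bsub>V\<^esub> t" ws] t
        by (simp add: ut frag_bilin_simps m ract_closed lact_ract)
    next
      case (snoc vs' z)
      then show ?thesis using left tensor_power_rels_intros(3)[of r s v "vs' @ [z \<triangleleft>\<^bsub>V\<^esub> t] @ ws"] t
        by (simp add: ut frag_bilin_simps m ract_closed)
    qed
  next
    case (inner r s us v w vs)
    then show ?thesis
    proof (cases vs rule: rev_exhaust)
      case Nil
      then show ?thesis using inner tensor_power_rels_intros(4)[of r s us v "w \<triangleleft>\<^bsub>V\<^esub> t" ws] t
        by (simp add: ut frag_bilin_simps m ract_closed lact_ract)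
    next
      case (snoc vs' z)
      then show ?thesis using inner tensor_power_rels_intros(4)[of r s us v w "vs' @ [z \<triangleleft>\<^bsub>V\<^esub> t] @ ws"] t
        by (simp add: ut frag_bilin_simps m ract_closed)
    qed
  qed
qed

sublocale mq: monoid_ring_quot WM "tensor_power_rels R V"
proof -
  interpret W: monoid WM by (rule monoid_WM)
  interpret f: frag_quot "carrier WM" "tensor_power_rels R V" "int_monoid_ring WM"
    by unfold_locales (auto simp only: add_monoid_int_monoid_ring dest: tensor_power_rels_keys)
  show "monoid_ring_quot WM (tensor_power_rels R V)"
    by unfold_locales (auto intro: f.Null_Rel word_left word_right)
qed

lemmas mq_fold = tensor_power_null_def[symmetric] tensor_algebra_def[symmetric]
  ta_scalar_def[symmetric] ta_vector_def[symmetric]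

abbreviation "TA \<equiv> tensor_algebra R V"
abbreviation "tsc \<equiv> ta_scalar R V"
abbreviation "tvec \<equiv> ta_vector R V"
abbreviation "tcls f \<equiv> tensor_power_null R V +>\<^bsub>int_monoid_ring WM\<^esub> f"

lemma ring_TA: "ring TA"
  using mq.ring_Q unfolding mq_fold .

sublocale TA: ring TA by (rule ring_TA)

lemma tcls_closed: "s \<in> carrier WM \<Longrightarrow> tcls (frag_of s) \<in> carrier TA"
  using mq.cls_of_closed unfolding mq_fold .

lemmas tcls_mult = mq.cls_mult_of[unfolded mq_fold]

lemma tsc_closed: "r \<in> carrier R \<Longrightarrow> tsc r \<in> carrier TA"
  unfolding ta_scalar_def by (rule tcls_closed) (simp add: carrier_WM)

lemma tvec_closed: "v \<in> carrier V \<Longrightarrow> tvec v \<in> carrier TA"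
  unfolding ta_vector_def by (rule tcls_closed) (simp add: carrier_WM)

lemma tcls_eq_iff: "tcls f = tcls g \<longleftrightarrow> f - g \<in> tensor_power_null R V"
  using mq.cls_eq_iff unfolding mq_fold .

lemma tcls_rel2:
  assumes "frag_of a - frag_of b \<in> tensor_power_rels R V"
  shows "tcls (frag_of a) = tcls (frag_of b)"
  using mq.Null_Rel[OF assms] unfolding tcls_eq_iff mq_fold .

lemma tcls_rel3:
  assumes "frag_of a - frag_of b - frag_of c \<in> tensor_power_rels R V" "b \<in> carrier WM" "c \<in> carrier WM"
  shows "tcls (frag_of a) = tcls (frag_of b) \<oplus>\<^bsub>TA\<^esub> tcls (frag_of c)"
proof -
  have "tcls (frag_of a) = tcls (frag_of b + frag_of c)"
    using mq.Null_Rel[OF assms(1)] unfolding tcls_eq_iff mq_fold by (simp add: algebra_simps)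
  then show ?thesis
    using mq.cls_add[of "frag_of b" "frag_of c"] assms(2,3) unfolding mq_fold by simp
qed

lemma tsc_hom: "tsc \<in> ring_hom R TA"
proof (rule ring_hom_memI)
  fix r s assume rs: "r \<in> carrier R" "s \<in> carrier R"
  show "tsc (r \<otimes>\<^bsub>R\<^esub> s) = tsc r \<otimes>\<^bsub>TA\<^esub> tsc s"
    using rs unfolding ta_scalar_def by (simp add: tcls_mult carrier_WM mult_WM)
  show "tsc (r \<oplus>\<^bsub>R\<^esub> s) = tsc r \<oplus>\<^bsub>TA\<^esub> tsc s"
    using rs unfolding ta_scalar_def
    by (intro tcls_rel3 tensor_power_rels_intros(1)) (auto simp: carrier_WM)
next
  show "tsc \<one>\<^bsub>R\<^esub> = \<one>\<^bsub>TA\<^esub>"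
    using mq.one_Q unfolding mq_fold by (simp add: ta_scalar_def one_WM)
qed (rule tsc_closed)

lemma tvec_additive: "additive_map V TA tvec"
proof (rule additive_mapI)
  fix v w assume vw: "v \<in> carrier V" "w \<in> carrier V"
  show "tvec (v \<oplus>\<^bsub>V\<^esub> w) = tvec v \<oplus>\<^bsub>TA\<^esub> tvec w"
    using vw tensor_power_rels_intros(2)[of "\<one>\<^bsub>R\<^esub>" "[]" v w "[]"] unfolding ta_vector_def
    by (intro tcls_rel3) (auto simp: carrier_WM)
qed (rule tvec_closed)

lemma tvec_lact:
  assumes "r \<in> carrier R" "v \<in> carrier V"
  shows "tvec (r \<triangleright>\<^bsub>V\<^esub> v) = tsc r \<otimes>\<^bsub>TA\<^esub> tvec v"
  using assms tcls_rel2[OF tensor_power_rels_intros(3)[of "\<one>\<^bsub>R\<^esub>" r v "[]"]]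
  unfolding ta_vector_def ta_scalar_def by (simp add: tcls_mult carrier_WM mult_WM)

lemma tvec_ract:
  assumes "r \<in> carrier R" "v \<in> carrier V"
  shows "tvec (v \<triangleleft>\<^bsub>V\<^esub> r) = tvec v \<otimes>\<^bsub>TA\<^esub> tsc r"
  using assms mult_WM(2)[of "\<one>\<^bsub>R\<^esub>" "[]" v r "[]"]
  unfolding ta_vector_def ta_scalar_def by (simp add: tcls_mult carrier_WM)

text \<open>A word is the product of its coefficient and its letters. Zero arises as the difference
  of the unit with itself, so it needs no case.\<close>

lemma TA_induct [consumes 1, case_names scalar vector minus mult]:
  assumes p: "p \<in> carrier TA" and sc: "\<And>r. r \<in> carrier R \<Longrightarrow> P (tsc r)"
    and vec: "\<And>v. v \<in> carrier V \<Longrightarrow> P (tvec v)"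
    and minus: "\<And>p q. \<lbrakk>p \<in> carrier TA; q \<in> carrier TA; P p; P q\<rbrakk> \<Longrightarrow> P (p \<ominus>\<^bsub>TA\<^esub> q)"
    and mult: "\<And>p q. \<lbrakk>p \<in> carrier TA; q \<in> carrier TA; P p; P q\<rbrakk> \<Longrightarrow> P (p \<otimes>\<^bsub>TA\<^esub> q)"
  shows "P p"
proof -
  have word: "P (tcls (frag_of (r, vs)))" if "r \<in> carrier R" "vs \<in> lists (carrier V)" for r vs
    using that(2)
  proof (induction vs rule: rev_induct)
    case Nil
    then show ?case using sc[OF that(1)] by (simp add: ta_scalar_def)
  next
    case (snoc v vs)
    \<comment> \<open>The coefficient absorbed by the last letter of \<open>vs\<close> is the unit,
      so multiplying by a one-letter word just appends the letter.\<close>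
    have "(r, vs) \<otimes>\<^bsub>WM\<^esub> (\<one>\<^bsub>R\<^esub>, [v]) = (r, vs @ [v])"
      using snoc(2) that(1) by (cases vs rule: rev_exhaust) (auto simp: mult_WM ract_one)
    then have "tcls (frag_of (r, vs @ [v])) = tcls (frag_of (r, vs)) \<otimes>\<^bsub>TA\<^esub> tvec v"
      using snoc(2) that(1) tcls_mult[of "(r, vs)" "(\<one>\<^bsub>R\<^esub>, [v])"] by (simp add: carrier_WM ta_vector_def)
    then show ?case
      using snoc mult[of "tcls (frag_of (r, vs))" "tvec v"] vec[of v] that(1)
      by (simp add: tcls_closed carrier_WM tvec_closed)
  qed
  have zero: "P \<zero>\<^bsub>TA\<^esub>"
    using minus[of "tsc \<one>\<^bsub>R\<^esub>" "tsc \<one>\<^bsub>R\<^esub>"] sc[of "\<one>\<^bsub>R\<^esub>"] tsc_closed[of "\<one>\<^bsub>R\<^esub>"]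
      by (simp add: TA.minus_eq TA.r_neg)
  show ?thesis
    using mq.Q_induct[unfolded mq_fold, of p P, OF p zero] word minus by (auto simp: carrier_WM)
qed

text \<open>The word (r, [v1, ..., vn]) goes to \<phi> r times the product of the \<psi> vi.
  Compatibility with the left action settles the \<open>left\<close> relators, both compatibilities
  together the \<open>inner\<close> ones, and the right one also gives multiplicativity on
  words.\<close>

lemma TA_lift:
  assumes B: "ring B" and \<phi>: "\<phi> \<in> ring_hom R B" and \<psi>: "additive_map V B \<psi>"
    and lact: "\<And>r v. \<lbrakk>r \<in> carrier R; v \<in> carrier V\<rbrakk> \<Longrightarrow> \<psi> (r \<triangleright>\<^bsub>V\<^esub> v) = \<phi> r \<otimes>\<^bsub>B\<^esub> \<psi> v"
    and ract: "\<And>r v. \<lbrakk>r \<in> carrier R; v \<in> carrier V\<rbrakk> \<Longrightarrow> \<psi> (v \<triangleleft>\<^bsub>V\<^esub> r) = \<psi> v \<otimes>\<^bsub>B\<^esub> \<phi> r"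
  obtains \<Phi> where "\<Phi> \<in> ring_hom TA B" "\<And>r. r \<in> carrier R \<Longrightarrow> \<Phi> (tsc r) = \<phi> r"
    "\<And>v. v \<in> carrier V \<Longrightarrow> \<Phi> (tvec v) = \<psi> v"
proof -
  interpret B: ring B by fact
  define pr where "pr vs = foldr (\<lambda>v b. \<psi> v \<otimes>\<^bsub>B\<^esub> b) vs \<one>\<^bsub>B\<^esub>" for vs
  note cl [simp] = ring_hom_closed[OF \<phi>] additive_map_closed[OF \<psi>]
  have pr_simps [simp]: "pr [] = \<one>\<^bsub>B\<^esub>" "pr (v # vs) = \<psi> v \<otimes>\<^bsub>B\<^esub> pr vs" for v vs
    by (simp_all add: pr_def)
  have pr_closed [simp]: "pr vs \<in> carrier B" if "vs \<in> lists (carrier V)" for vs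
    using that by (induction vs) auto
  have pr_append: "pr (us @ vs) = pr us \<otimes>\<^bsub>B\<^esub> pr vs" if "us \<in> lists (carrier V)" "vs \<in> lists (carrier V)" for us vs
    using that by (induction us) (auto simp: B.m_assoc)
  define h where "h = (\<lambda>(r, vs). \<phi> r \<otimes>\<^bsub>B\<^esub> pr vs)"
  have h: "h (r, vs) = \<phi> r \<otimes>\<^bsub>B\<^esub> pr vs" for r vs by (simp add: h_def)
  have h_closed: "h s \<in> carrier B" if "s \<in> carrier WM" for s
    using that by (cases s) (auto simp: h carrier_WM in_lists_conv_set)
  have h_mult: "h (s \<otimes>\<^bsub>WM\<^esub> t) = h s \<otimes>\<^bsub>B\<^esub> h t" if "s \<in> carrier WM" "t \<in> carrier WM" for s t
  proof -
    obtain r us q vs where st: "s = (r, us)" "t = (q, vs)" by (cases s; cases t)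
    have car: "r \<in> carrier R" "us \<in> lists (carrier V)" "q \<in> carrier R" "vs \<in> lists (carrier V)"
      using that by (auto simp: st carrier_WM)
    show ?thesis
    proof (cases us rule: rev_exhaust)
      case Nil
      then show ?thesis using car by (simp add: st mult_WM h ring_hom_mult[OF \<phi>] B.m_assoc)
    next
      case (snoc us' u)
      have car': "us' \<in> lists (carrier V)" "u \<in> carrier V" using snoc car by auto
      then show ?thesis using car unfolding st snoc mult_WM h
        by (simp add: pr_append ract ract_closed B.m_assoc)
    qed
  qed
  have h_one: "h \<one>\<^bsub>WM\<^esub> = \<one>\<^bsub>B\<^esub>"
    by (simp add: one_WM h ring_hom_one[OF \<phi>])
  note G = B.is_abelian_group
  have rel: "ext_vanishes B (carrier WM) h x" if x: "x \<in> tensor_power_rels R V" for x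
  proof -
    show ?thesis using x
    proof (cases rule: tensor_power_rels_cases)
      case (coeff r s vs)
      then show ?thesis unfolding coeff(1)
        by (intro ext_vanishes_diff3 G) (auto simp: carrier_WM h ring_hom_add[OF \<phi>] B.l_distr)
    next
      case (entry r us v w vs)
      then show ?thesis unfolding entry(1)
        by (intro ext_vanishes_diff3 G) (auto simp: carrier_WM h pr_append additive_map_add[OF \<psi>] B.l_distr B.r_distr)
    next
      case (left r s v vs)
      then show ?thesis unfolding left(1)
        by (intro ext_vanishes_diff2 G) (auto simp: carrier_WM h ring_hom_mult[OF \<phi>] lact lact_closed B.m_assoc)
    next
      case (inner r s us v w vs)
      then show ?thesis unfolding inner(1)
        by (intro ext_vanishes_diff2 G) (auto simp: carrier_WM h pr_append ract lact ract_closed lact_closed B.m_assoc)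
    qed
  qed
  obtain \<Phi> where "\<Phi> \<in> ring_hom TA B" and \<Phi>: "\<And>s. s \<in> carrier WM \<Longrightarrow> \<Phi> (tcls (frag_of s)) = h s"
    by (rule mq.Q_ring_lift[unfolded mq_fold, OF B, of h]) (auto intro: h_closed h_mult h_one rel)
  with that[OF this(1)] show ?thesis
    by (auto simp: ta_scalar_def ta_vector_def carrier_WM h ring_hom_one[OF \<phi>])
qed

end

section \<open>The enveloping algebra\<close>

lemma carrier_opp [simp]: "carrier (opp R) = carrier R"
  and mult_opp [simp]: "x \<otimes>\<^bsub>opp R\<^esub> y = y \<otimes>\<^bsub>R\<^esub> x"
  and one_opp [simp]: "\<one>\<^bsub>opp R\<^esub> = \<one>\<^bsub>R\<^esub>"
  and add_opp [simp]: "x \<oplus>\<^bsub>opp R\<^esub> y = x \<oplus>\<^bsub>R\<^esub> y"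
  and zero_opp [simp]: "\<zero>\<^bsub>opp R\<^esub> = \<zero>\<^bsub>R\<^esub>"
  by (simp_all add: opp_def)

lemma scalar_opp [simp]: "scalar (opp A) k = scalar A k"
  by (simp add: scalar_def opp_def)

lemma add_monoid_opp: "add_monoid (opp R) = add_monoid R"
  by (simp add: opp_def)

lemma finsum_opp [simp]: "finsum (opp R) f I = finsum R f I"
  unfolding finsum_def add_monoid_opp ..

lemma ring_opp:
  assumes "ring R" shows "ring (opp R)"
proof -
  interpret ring R by fact
  show ?thesis
  proof (rule ringI)
    show "abelian_group (opp R)"
      by (rule abelian_groupI) (use abelian_groupE[OF is_abelian_group] in simp_all)
    show "Group.monoid (opp R)"
      by (rule monoidI) (auto simp: m_assoc)
  qed (auto simp: l_distr r_distr)
qed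

lemma over_simps [simp]:
  "carrier (over A M) = carrier M" "x \<oplus>\<^bsub>over A M\<^esub> y = x \<oplus>\<^bsub>M\<^esub> y" "\<zero>\<^bsub>over A M\<^esub> = \<zero>\<^bsub>M\<^esub>"
  "k \<triangleright>\<^bsub>over A M\<^esub> x = scalar A k \<triangleright>\<^bsub>M\<^esub> x" "x \<triangleleft>\<^bsub>over A M\<^esub> k = x \<triangleleft>\<^bsub>M\<^esub> scalar A k"
  by (simp_all add: restrict_scalars_def)

lemma reg_bimod_simps [simp]:
  "carrier (reg_bimod R) = carrier R" "x \<oplus>\<^bsub>reg_bimod R\<^esub> y = x \<oplus>\<^bsub>R\<^esub> y" "\<zero>\<^bsub>reg_bimod R\<^esub> = \<zero>\<^bsub>R\<^esub>"
  "r \<triangleright>\<^bsub>reg_bimod R\<^esub> x = r \<otimes>\<^bsub>R\<^esub> x" "x \<triangleleft>\<^bsub>reg_bimod R\<^esub> r = x \<otimes>\<^bsub>R\<^esub> r"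
  by (simp_all add: reg_bimod_def)

lemma abelian_group_over:
  assumes "abelian_group M" shows "abelian_group (over A M)"
  by (rule abelian_group_cong[OF assms]) (simp_all add: restrict_scalars_def)

lemma additive_map_over_left [simp]: "additive_map (over A M) G f \<longleftrightarrow> additive_map M G f"
  by (simp add: additive_map_def)

lemma additive_map_ring_hom: "f \<in> ring_hom R S \<Longrightarrow> additive_map R S f"
  by (auto simp: additive_map_def ring_hom_def)

lemma (in ring) additive_map_mult_left: "a \<in> carrier R \<Longrightarrow> additive_map R R (\<lambda>x. a \<otimes> x)"
  by (intro additive_mapI) (simp_all add: r_distr)

lemma (in ring) additive_map_mult_right: "a \<in> carrier R \<Longrightarrow> additive_map R R (\<lambda>x. x \<otimes> a)"
  by (intro additive_mapI) (simp_all add: l_distr)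

context unital_algebra
begin

lemma scalar_closed: "k \<in> carrier K \<Longrightarrow> scalar A k \<in> carrier A"
  by (simp add: scalar_def)

lemma scalar_commute: "\<lbrakk>k \<in> carrier K; a \<in> carrier A\<rbrakk> \<Longrightarrow> scalar A k \<otimes>\<^bsub>A\<^esub> a = a \<otimes>\<^bsub>A\<^esub> scalar A k"
  using smult_mult_l[of k "\<one>\<^bsub>A\<^esub>" a] smult_mult_r[of k a "\<one>\<^bsub>A\<^esub>"] by (simp add: scalar_def)

abbreviation "E \<equiv> env_algebra K A"
abbreviation "regA \<equiv> over A (reg_bimod A)"
abbreviation "regAop \<equiv> over (opp A) (reg_bimod (opp A))"

lemma tensor_pair_env: "tensor_pair K regA regAop"
proof -
  have "abelian_group (reg_bimod A)"
    by (rule abelian_group_cong[OF A.is_abelian_group]) (simp_all add: reg_bimod_def)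
  moreover have "abelian_group (reg_bimod (opp A))"
    by (rule abelian_group_cong[OF ring.is_abelian_group[OF ring_opp[OF A.ring_axioms]]])
      (simp_all add: reg_bimod_def)
  ultimately show ?thesis
    by (intro tensor_pair.intro abelian_group_over) (simp_all add: scalar_closed)
qed

sublocale env: tensor_pair K regA regAop by (rule tensor_pair_env)

lemma carrier_env_monoid: "carrier (A \<times>\<times> opp A) = carrier A \<times> carrier A"
  and mult_env_monoid: "(a, b) \<otimes>\<^bsub>A \<times>\<times> opp A\<^esub> (c, d) = (a \<otimes>\<^bsub>A\<^esub> c, d \<otimes>\<^bsub>A\<^esub> b)"
  and one_env_monoid: "\<one>\<^bsub>A \<times>\<times> opp A\<^esub> = (\<one>\<^bsub>A\<^esub>, \<one>\<^bsub>A\<^esub>)"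
  by (simp_all add: DirProd_def)

lemma env_rels_cases [consumes 1, case_names left right scalar]:
  assumes "x \<in> tensor_rels K regA regAop"
    and "\<And>m m' n. \<lbrakk>x = frag_of (m \<oplus>\<^bsub>A\<^esub> m', n) - frag_of (m, n) - frag_of (m', n);
      m \<in> carrier A; m' \<in> carrier A; n \<in> carrier A\<rbrakk> \<Longrightarrow> P"
    and "\<And>m n n'. \<lbrakk>x = frag_of (m, n \<oplus>\<^bsub>A\<^esub> n') - frag_of (m, n) - frag_of (m, n');
      m \<in> carrier A; n \<in> carrier A; n' \<in> carrier A\<rbrakk> \<Longrightarrow> P"
    and "\<And>m k n. \<lbrakk>x = frag_of (m \<otimes>\<^bsub>A\<^esub> scalar A k, n) - frag_of (m, n \<otimes>\<^bsub>A\<^esub> scalar A k);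
      m \<in> carrier A; k \<in> carrier K; n \<in> carrier A\<rbrakk> \<Longrightarrow> P"
  shows P
  by (rule env.tensor_rels_cases[OF assms(1)];
      unfold over_simps reg_bimod_simps carrier_opp add_opp mult_opp scalar_opp) (rule assms(2-4); assumption)+

lemma env_rels_intros:
  "\<lbrakk>m \<in> carrier A; m' \<in> carrier A; n \<in> carrier A\<rbrakk> \<Longrightarrow>
    frag_of (m \<oplus>\<^bsub>A\<^esub> m', n) - frag_of (m, n) - frag_of (m', n) \<in> tensor_rels K regA regAop"
  "\<lbrakk>m \<in> carrier A; n \<in> carrier A; n' \<in> carrier A\<rbrakk> \<Longrightarrow>
    frag_of (m, n \<oplus>\<^bsub>A\<^esub> n') - frag_of (m, n) - frag_of (m, n') \<in> tensor_rels K regA regAop"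
  "\<lbrakk>m \<in> carrier A; k \<in> carrier K; n \<in> carrier A\<rbrakk> \<Longrightarrow>
    frag_of (m \<otimes>\<^bsub>A\<^esub> scalar A k, n) - frag_of (m, n \<otimes>\<^bsub>A\<^esub> scalar A k) \<in> tensor_rels K regA regAop"
  using env.tensor_rels_intros
  by (unfold over_simps reg_bimod_simps carrier_opp add_opp mult_opp scalar_opp)

text \<open>Multiplication sends relators to relators; for the \<open>scalar\<close> ones this holds
  because the image of the field in \<open>A\<close> is central.\<close>

lemma env_word_left:
  assumes "u \<in> carrier (A \<times>\<times> opp A)" "x \<in> tensor_rels K regA regAop"
  shows "frag_bilin (\<lambda>u v. u \<otimes>\<^bsub>A \<times>\<times> opp A\<^esub> v) (frag_of u) x \<in> tensor_rels K regA regAop"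
proof -
  obtain a b where u: "u = (a, b)" "a \<in> carrier A" "b \<in> carrier A"
    using assms(1) by (auto simp: carrier_env_monoid)
  show ?thesis using assms(2)
  proof (cases rule: env_rels_cases)
    case (left m m' n)
    then show ?thesis using u env_rels_intros(1)[of "a \<otimes>\<^bsub>A\<^esub> m" "a \<otimes>\<^bsub>A\<^esub> m'" "n \<otimes>\<^bsub>A\<^esub> b"]
      by (simp add: frag_bilin_simps mult_env_monoid A.r_distr)
  next
    case (right m n n')
    then show ?thesis using u env_rels_intros(2)[of "a \<otimes>\<^bsub>A\<^esub> m" "n \<otimes>\<^bsub>A\<^esub> b" "n' \<otimes>\<^bsub>A\<^esub> b"]
      by (simp add: frag_bilin_simps mult_env_monoid A.l_distr)
  next
    case (scalar m k n)
    have "n \<otimes>\<^bsub>A\<^esub> scalar A k \<otimes>\<^bsub>A\<^esub> b = n \<otimes>\<^bsub>A\<^esub> b \<otimes>\<^bsub>A\<^esub> scalar A k"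
      using scalar u by (simp add: A.m_assoc scalar_closed scalar_commute)
    then show ?thesis using scalar u env_rels_intros(3)[of "a \<otimes>\<^bsub>A\<^esub> m" k "n \<otimes>\<^bsub>A\<^esub> b"]
      by (simp add: frag_bilin_simps mult_env_monoid A.m_assoc scalar_closed)
  qed
qed

lemma env_word_right:
  assumes "u \<in> carrier (A \<times>\<times> opp A)" "x \<in> tensor_rels K regA regAop"
  shows "frag_bilin (\<lambda>u v. u \<otimes>\<^bsub>A \<times>\<times> opp A\<^esub> v) x (frag_of u) \<in> tensor_rels K regA regAop"
proof -
  obtain a b where u: "u = (a, b)" "a \<in> carrier A" "b \<in> carrier A"
    using assms(1) by (auto simp: carrier_env_monoid)
  show ?thesis using assms(2)
  proof (cases rule: env_rels_cases)
    case (left m m' n)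
    then show ?thesis using u env_rels_intros(1)[of "m \<otimes>\<^bsub>A\<^esub> a" "m' \<otimes>\<^bsub>A\<^esub> a" "b \<otimes>\<^bsub>A\<^esub> n"]
      by (simp add: frag_bilin_simps mult_env_monoid A.l_distr)
  next
    case (right m n n')
    then show ?thesis using u env_rels_intros(2)[of "m \<otimes>\<^bsub>A\<^esub> a" "b \<otimes>\<^bsub>A\<^esub> n" "b \<otimes>\<^bsub>A\<^esub> n'"]
      by (simp add: frag_bilin_simps mult_env_monoid A.r_distr)
  next
    case (scalar m k n)
    have "m \<otimes>\<^bsub>A\<^esub> scalar A k \<otimes>\<^bsub>A\<^esub> a = m \<otimes>\<^bsub>A\<^esub> a \<otimes>\<^bsub>A\<^esub> scalar A k"
      using scalar u by (simp add: A.m_assoc scalar_closed scalar_commute)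
    then show ?thesis using scalar u env_rels_intros(3)[of "m \<otimes>\<^bsub>A\<^esub> a" k "b \<otimes>\<^bsub>A\<^esub> n"]
      by (simp add: frag_bilin_simps mult_env_monoid A.m_assoc scalar_closed)
  qed
qed

text \<open>The enveloping algebra is seen in two ways, as a tensor product over the field and as a
  quotient of a monoid ring by the same relations. The second view makes it a ring.\<close>

sublocale eq: monoid_ring_quot "A \<times>\<times> opp A" "tensor_rels K regA regAop"
proof -
  interpret W: monoid "A \<times>\<times> opp A"
    by (rule DirProd_monoid) (use ring.is_monoid[OF ring_opp[OF A.ring_axioms]] A.is_monoid in auto)
  interpret f: frag_quot "carrier (A \<times>\<times> opp A)" "tensor_rels K regA regAop" "int_monoid_ring (A \<times>\<times> opp A)"
    by unfold_locales
      (use env.tensor_rels_keys in \<open>auto simp only: add_monoid_int_monoid_ring carrier_env_monoid over_simps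
        reg_bimod_simps carrier_opp\<close>)
  show "monoid_ring_quot (A \<times>\<times> opp A) (tensor_rels K regA regAop)"
    by unfold_locales (rule f.Null_Rel, erule (1) env_word_left env_word_right)+
qed

lemma eq_Null: "eq.Null = tensor_null K regA regAop"
  by (simp add: tensor_null_def carrier_env_monoid)

lemma eq_Q: "eq.Q = E"
  unfolding env_algebra_def eq_Null ..

text \<open>Cosets depend only on the additive group, which \<open>int_monoid_ring\<close> and
  \<open>free_ab\<close> share, so lemmas from both views apply to the same classes.\<close>

lemma eq_cls: "eq.cls f = tens_cls K regA regAop f"
  unfolding eq_Null tens_cls_def a_r_coset_def add_monoid_int_monoid_ring add_monoid_free_ab
  by (simp add: carrier_env_monoid)

lemma ring_E: "ring E"
  using eq.ring_Q unfolding eq_Q .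

sublocale E: ring E by (rule ring_E)

lemma env_closed: "\<lbrakk>a \<in> carrier A; b \<in> carrier A\<rbrakk> \<Longrightarrow> env K A a b \<in> carrier E"
  using eq.cls_of_closed[of "(a, b)"] unfolding eq_Q eq_cls env_def by (simp add: carrier_env_monoid)

lemma env_mult:
  "\<lbrakk>a \<in> carrier A; b \<in> carrier A; c \<in> carrier A; d \<in> carrier A\<rbrakk> \<Longrightarrow>
    env K A a b \<otimes>\<^bsub>E\<^esub> env K A c d = env K A (a \<otimes>\<^bsub>A\<^esub> c) (d \<otimes>\<^bsub>A\<^esub> b)"
  using eq.cls_mult_of[of "(a, b)" "(c, d)"] unfolding eq_Q eq_cls env_def
  by (simp add: carrier_env_monoid mult_env_monoid)

lemma env_one: "env K A \<one>\<^bsub>A\<^esub> \<one>\<^bsub>A\<^esub> = \<one>\<^bsub>E\<^esub>"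
  using eq.one_Q unfolding eq_Q eq_cls env_def by (simp add: one_env_monoid)

lemma add_E: 
  assumes "Poly_Mapping.keys f \<subseteq> carrier A \<times> carrier A" "Poly_Mapping.keys g \<subseteq> carrier A \<times> carrier A"
  shows "tens_cls K regA regAop f \<oplus>\<^bsub>E\<^esub> tens_cls K regA regAop g = tens_cls K regA regAop (f + g)"
  using eq.cls_add[of f g] assms unfolding eq_Q eq_cls by (simp add: carrier_env_monoid)

lemma env_additive_left: "b \<in> carrier A \<Longrightarrow> additive_map A E (\<lambda>a. env K A a b)"
  using env.tens_add_left[of _ _ b] unfolding env_def[symmetric]
  by (intro additive_mapI env_closed) (auto simp: env_def add_E env.tens_cls_add)

lemma env_additive_right: "a \<in> carrier A \<Longrightarrow> additive_map A E (\<lambda>b. env K A a b)"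
  using env.tens_add_right[of a] unfolding env_def[symmetric]
  by (intro additive_mapI env_closed) (auto simp: env_def add_E env.tens_cls_add)

lemma env_scalar:
  "k \<in> carrier K \<Longrightarrow> env K A (scalar A k) \<one>\<^bsub>A\<^esub> = env K A \<one>\<^bsub>A\<^esub> (scalar A k)"
  using env.tens_balanced[of "\<one>\<^bsub>A\<^esub>" k "\<one>\<^bsub>A\<^esub>"] unfolding env_def by (simp add: scalar_closed)

lemma carrier_E_E:
  assumes "e \<in> carrier E"
  obtains f where "Poly_Mapping.keys f \<subseteq> carrier A \<times> carrier A" "e = tens_cls K regA regAop f"
proof -
  have "e \<in> {tens_cls K regA regAop f |f. Poly_Mapping.keys f \<subseteq> carrier A \<times> carrier A}"
    using assms eq.carrier_Q[unfolded eq_Q eq_cls, unfolded carrier_env_monoid] by simp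
  then show ?thesis using that by blast
qed

lemma E_additive_eqI:
  assumes "abelian_group G" "additive_map E G f" "additive_map E G g"
    and "\<And>a b. \<lbrakk>a \<in> carrier A; b \<in> carrier A\<rbrakk> \<Longrightarrow> f (env K A a b) = g (env K A a b)"
    and "e \<in> carrier E"
  shows "f e = g e"
  using assms(5,1-3)
proof (rule eq.Q_additive_eqI[unfolded eq_Q eq_cls])
  show "f (tens_cls K regA regAop (frag_of s)) = g (tens_cls K regA regAop (frag_of s))"
    if "s \<in> carrier (A \<times>\<times> opp A)" for s
    using that assms(4)[of "fst s" "snd s"] unfolding env_def carrier_env_monoid by (metis mem_Times_iff prod.collapse)
qed

lemma E_induct [consumes 1, case_names env minus]:
  assumes "e \<in> carrier E"
    and env: "\<And>a b. \<lbrakk>a \<in> carrier A; b \<in> carrier A\<rbrakk> \<Longrightarrow> P (env K A a b)"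
    and minus: "\<And>p q. \<lbrakk>p \<in> carrier E; q \<in> carrier E; P p; P q\<rbrakk> \<Longrightarrow> P (p \<ominus>\<^bsub>E\<^esub> q)"
  shows "P e"
proof -
  have "P \<zero>\<^bsub>E\<^esub>"
    using minus[of "\<one>\<^bsub>E\<^esub>" "\<one>\<^bsub>E\<^esub>"] env[of "\<one>\<^bsub>A\<^esub>" "\<one>\<^bsub>A\<^esub>"] by (simp add: env_one E.minus_eq E.r_neg)
  then show ?thesis
  proof (rule eq.Q_induct[unfolded eq_Q eq_cls, OF assms(1)])
    show "P (tens_cls K regA regAop (frag_of s))" if "s \<in> carrier (A \<times>\<times> opp A)" for s
      using that env unfolding env_def by (auto simp: carrier_env_monoid)
  qed (fact minus)
qed

text \<open>Agreement of \<open>el\<close> and \<open>bar\<close> on scalars is what the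
  \<open>scalar\<close> relators require, and commutation of their images is what multiplicativity
  requires.\<close>

lemma E_lift:
  assumes B: "ring B" and el: "el \<in> ring_hom A B" and bar: "bar \<in> ring_hom A (opp B)"
    and comm: "\<And>a b. \<lbrakk>a \<in> carrier A; b \<in> carrier A\<rbrakk> \<Longrightarrow> el a \<otimes>\<^bsub>B\<^esub> bar b = bar b \<otimes>\<^bsub>B\<^esub> el a"
    and scal: "\<And>k. k \<in> carrier K \<Longrightarrow> el (scalar A k) = bar (scalar A k)"
  obtains \<Phi> where "\<Phi> \<in> ring_hom E B"
    "\<And>a b. \<lbrakk>a \<in> carrier A; b \<in> carrier A\<rbrakk> \<Longrightarrow> \<Phi> (env K A a b) = el a \<otimes>\<^bsub>B\<^esub> bar b"
proof -
  interpret B: ring B by fact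
  define h where "h = (\<lambda>(a, b). el a \<otimes>\<^bsub>B\<^esub> bar b)"
  have h: "h (a, b) = el a \<otimes>\<^bsub>B\<^esub> bar b" for a b by (simp add: h_def)
  note cl [simp] = ring_hom_closed[OF el] ring_hom_closed[OF bar, simplified]
  note hom = ring_hom_mult[OF el] ring_hom_mult[OF bar, simplified]
    ring_hom_add[OF el] ring_hom_add[OF bar, simplified] ring_hom_one[OF el] ring_hom_one[OF bar, simplified]
  have rel: "ext_vanishes B (carrier (A \<times>\<times> opp A)) h x" if x: "x \<in> tensor_rels K regA regAop" for x
    using x
  proof (cases rule: env_rels_cases)
    case (left m m' n)
    then show ?thesis unfolding left(1)
      by (intro ext_vanishes_diff3 B.is_abelian_group) (auto simp: carrier_env_monoid h hom B.l_distr)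
  next
    case (right m m' n)
    then show ?thesis unfolding right(1)
      by (intro ext_vanishes_diff3 B.is_abelian_group) (auto simp: carrier_env_monoid h hom B.r_distr)
  next
    case (scalar m k n)
    then show ?thesis unfolding scalar(1)
      by (intro ext_vanishes_diff2 B.is_abelian_group)
        (auto simp: carrier_env_monoid h hom scalar_closed scal B.m_assoc)
  qed
  have closed: "h s \<in> carrier B" if "s \<in> carrier (A \<times>\<times> opp A)" for s
    using that by (auto simp: carrier_env_monoid h)
  have one: "h \<one>\<^bsub>A \<times>\<times> opp A\<^esub> = \<one>\<^bsub>B\<^esub>"
    by (simp add: one_env_monoid h hom)
  have mult: "h (s \<otimes>\<^bsub>A \<times>\<times> opp A\<^esub> t) = h s \<otimes>\<^bsub>B\<^esub> h t"
    if st: "s \<in> carrier (A \<times>\<times> opp A)" "t \<in> carrier (A \<times>\<times> opp A)" for s t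
  proof -
    obtain a b c d where ab: "s = (a, b)" "t = (c, d)" "a \<in> carrier A" "b \<in> carrier A" "c \<in> carrier A" "d \<in> carrier A"
      using st by (auto simp: carrier_env_monoid)
    \<comment> \<open>The second component is multiplied in the opposite order and
      \<open>bar\<close> reverses it once more, so only \<open>el c\<close> and \<open>bar b\<close>
      have to be interchanged.\<close>
    have "h (s \<otimes>\<^bsub>A \<times>\<times> opp A\<^esub> t) = el a \<otimes>\<^bsub>B\<^esub> (el c \<otimes>\<^bsub>B\<^esub> bar b) \<otimes>\<^bsub>B\<^esub> bar d"
      using ab by (simp add: mult_env_monoid h hom B.m_assoc)
    also have "\<dots> = h s \<otimes>\<^bsub>B\<^esub> h t"
      using ab by (simp add: h comm[of c b] B.m_assoc)
    finally show ?thesis .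
  qed
  obtain \<Phi> where "\<Phi> \<in> ring_hom E B" "\<And>s. s \<in> carrier (A \<times>\<times> opp A) \<Longrightarrow> \<Phi> (tens_cls K regA regAop (frag_of s)) = h s"
    using eq.Q_ring_lift[OF B, of h, unfolded eq_Q eq_cls, OF closed mult one rel] by blast
  with that show ?thesis by (auto simp: env_def h carrier_env_monoid)
qed

end

section \<open>The bimodule generating \<open>H\<close>\<close>

text \<open>Used in both orders, once for each summand of the generating bimodule
  \<open>zed_bimod\<close>.\<close>

locale bimodule_pair = Y: algebra_bimodule K A Y + Z: algebra_bimodule K A Z
  for K :: "('k, 'c) ring_scheme" and A :: "('k, 'a, 'd) module_scheme"
    and Y :: "('a, 'y, 'e) bimod_scheme" and Z :: "('a, 'z, 'f) bimod_scheme"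
begin

abbreviation "T \<equiv> tensor K (over A Y) (over A Z)"
abbreviation "tyz \<equiv> tens K (over A Y) (over A Z)"

text \<open>\<open>LA\<close> is the outer action, on the far left of the first factor and the far
  right of the second; \<open>RA\<close> is the inner action, on the two sides facing the tensor
  sign.\<close>

definition "LA = tens_lift K (over A Y) (over A Z) (\<lambda>(a, a') (y, z). (a \<triangleright>\<^bsub>Y\<^esub> y, z \<triangleleft>\<^bsub>Z\<^esub> a'))"
definition "RA = tens_lift K (over A Y) (over A Z) (\<lambda>(y, z) (b, b'). (y \<triangleleft>\<^bsub>Y\<^esub> b, b' \<triangleright>\<^bsub>Z\<^esub> z))"

lemma tensor_pair_T: "tensor_pair K (over A Y) (over A Z)"
  by (intro tensor_pair.intro abelian_group_over Y.M.abelian_group_axioms Z.M.abelian_group_axioms)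
    (simp_all add: Y.ract_closed Z.lact_closed Y.scalar_closed)

sublocale T: tensor_pair K "over A Y" "over A Z" by (rule tensor_pair_T)

sublocale T: abelian_group T by (rule T.abelian_group_tensor)

lemmas T_rels_cases [consumes 1, case_names left right scalar] =
  T.tensor_rels_cases[unfolded over_simps]

lemmas T_rels_intros = T.tensor_rels_intros[THEN T.fq.Null_Rel, unfolded over_simps]

lemmas bimod_simps =
  Y.lact_closed Y.ract_closed Y.lact_add_l Y.lact_add_r Y.ract_add_l Y.ract_add_r Y.lact_ract
  Z.lact_closed Z.ract_closed Z.lact_add_l Z.lact_add_r Z.ract_add_l Z.ract_add_r Z.lact_ract
  Y.scalar_closed

lemma T_fold: "T.fq.cls f = tens_cls K (over A Y) (over A Z) f"
  by (simp add: tens_cls_def tensor_null_def)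

lemma LA_cls:
  assumes "Poly_Mapping.keys f \<subseteq> carrier A \<times> carrier A" "Poly_Mapping.keys g \<subseteq> carrier Y \<times> carrier Z"
  shows "LA (tens_cls K Y.regA Y.regAop f) (tens_cls K (over A Y) (over A Z) g)
    = tens_cls K (over A Y) (over A Z) (frag_bilin (\<lambda>(a, a') (y, z). (a \<triangleright>\<^bsub>Y\<^esub> y, z \<triangleleft>\<^bsub>Z\<^esub> a')) f g)"
proof -
  let ?h = "\<lambda>(a, a') (y, z). (a \<triangleright>\<^bsub>Y\<^esub> y, z \<triangleleft>\<^bsub>Z\<^esub> a')"
  have 1: "frag_bilin ?h r (frag_of v) \<in> T.fq.Null"
    if "r \<in> tensor_rels K Y.regA Y.regAop" "v \<in> carrier (over A Y) \<times> carrier (over A Z)" for r v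
  proof -
    obtain y z where v: "v = (y, z)" "y \<in> carrier Y" "z \<in> carrier Z" using \<open>v \<in> _\<close> by auto
    show ?thesis using \<open>r \<in> _\<close>
    proof (cases rule: Y.env_rels_cases)
      case (left m m' n)
      then show ?thesis using v T_rels_intros(1)[of "m \<triangleright>\<^bsub>Y\<^esub> y" "m' \<triangleright>\<^bsub>Y\<^esub> y" "z \<triangleleft>\<^bsub>Z\<^esub> n"]
        by (simp add: frag_bilin_simps bimod_simps)
    next
      case (right m n n')
      then show ?thesis using v T_rels_intros(2)[of "m \<triangleright>\<^bsub>Y\<^esub> y" "z \<triangleleft>\<^bsub>Z\<^esub> n" "z \<triangleleft>\<^bsub>Z\<^esub> n'"]
        by (simp add: frag_bilin_simps bimod_simps)
    next
      case (scalar m k n)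
      \<comment> \<open>The action is outer, whereas scalars cross the tensor sign on the inner
        side; centrality of the scalars on both bimodules carries \<open>k\<close> there.\<close>
      have "(m \<otimes>\<^bsub>A\<^esub> scalar A k) \<triangleright>\<^bsub>Y\<^esub> y = (m \<triangleright>\<^bsub>Y\<^esub> y) \<triangleleft>\<^bsub>Y\<^esub> scalar A k"
        using v scalar by (simp add: Y.lact_mult Y.scalar_central bimod_simps)
      moreover have "z \<triangleleft>\<^bsub>Z\<^esub> (n \<otimes>\<^bsub>A\<^esub> scalar A k) = scalar A k \<triangleright>\<^bsub>Z\<^esub> (z \<triangleleft>\<^bsub>Z\<^esub> n)"
        using v scalar by (simp add: Z.ract_mult Z.scalar_central bimod_simps)
      ultimately show ?thesis using v scalar T_rels_intros(3)[of "m \<triangleright>\<^bsub>Y\<^esub> y" k "z \<triangleleft>\<^bsub>Z\<^esub> n"]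
        by (simp add: frag_bilin_simps bimod_simps)
    qed
  qed
  have 2: "frag_bilin ?h (frag_of u) r \<in> T.fq.Null"
    if "u \<in> carrier (A \<times>\<times> opp A)" "r \<in> tensor_rels K (over A Y) (over A Z)" for u r
  proof -
    obtain a b where u: "u = (a, b)" "a \<in> carrier A" "b \<in> carrier A"
      using \<open>u \<in> _\<close> by (auto simp: Y.carrier_env_monoid)
    show ?thesis using \<open>r \<in> _\<close>
    proof (cases rule: T_rels_cases)
      case (left m m' n)
      then show ?thesis using u T_rels_intros(1)[of "a \<triangleright>\<^bsub>Y\<^esub> m" "a \<triangleright>\<^bsub>Y\<^esub> m'" "n \<triangleleft>\<^bsub>Z\<^esub> b"]
        by (simp add: frag_bilin_simps bimod_simps)
    next
      case (right m n n')
      then show ?thesis using u T_rels_intros(2)[of "a \<triangleright>\<^bsub>Y\<^esub> m" "n \<triangleleft>\<^bsub>Z\<^esub> b" "n' \<triangleleft>\<^bsub>Z\<^esub> b"]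
        by (simp add: frag_bilin_simps bimod_simps)
    next
      case (scalar m k n)
      then show ?thesis using u T_rels_intros(3)[of "a \<triangleright>\<^bsub>Y\<^esub> m" k "n \<triangleleft>\<^bsub>Z\<^esub> b"]
        by (simp add: frag_bilin_simps bimod_simps)
    qed
  qed
  show ?thesis
    using T.fq.UN_cls_frag_bilin[OF Y.eq.frag_quot_axioms T.fq.frag_quot_axioms 1 2, of f g] assms
    unfolding LA_def tens_lift_def T_fold Y.eq_cls by (simp add: Y.carrier_env_monoid)
qed

lemma RA_cls:
  assumes "Poly_Mapping.keys f \<subseteq> carrier A \<times> carrier A" "Poly_Mapping.keys g \<subseteq> carrier Y \<times> carrier Z"
  shows "RA (tens_cls K (over A Y) (over A Z) g) (tens_cls K Y.regA Y.regAop f)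
    = tens_cls K (over A Y) (over A Z) (frag_bilin (\<lambda>(y, z) (b, b'). (y \<triangleleft>\<^bsub>Y\<^esub> b, b' \<triangleright>\<^bsub>Z\<^esub> z)) g f)"
proof -
  let ?h = "\<lambda>(y, z) (b, b'). (y \<triangleleft>\<^bsub>Y\<^esub> b, b' \<triangleright>\<^bsub>Z\<^esub> z)"
  have 1: "frag_bilin ?h (frag_of v) r \<in> T.fq.Null"
    if "v \<in> carrier (over A Y) \<times> carrier (over A Z)" "r \<in> tensor_rels K Y.regA Y.regAop" for r v
  proof -
    obtain y z where v: "v = (y, z)" "y \<in> carrier Y" "z \<in> carrier Z" using \<open>v \<in> _\<close> by auto
    show ?thesis using \<open>r \<in> _\<close>
    proof (cases rule: Y.env_rels_cases)
      case (left m m' n)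
      then show ?thesis using v T_rels_intros(1)[of "y \<triangleleft>\<^bsub>Y\<^esub> m" "y \<triangleleft>\<^bsub>Y\<^esub> m'" "n \<triangleright>\<^bsub>Z\<^esub> z"]
        by (simp add: frag_bilin_simps bimod_simps)
    next
      case (right m n n')
      then show ?thesis using v T_rels_intros(2)[of "y \<triangleleft>\<^bsub>Y\<^esub> m" "n \<triangleright>\<^bsub>Z\<^esub> z" "n' \<triangleright>\<^bsub>Z\<^esub> z"]
        by (simp add: frag_bilin_simps bimod_simps)
    next
      case (scalar m k n)
      have "y \<triangleleft>\<^bsub>Y\<^esub> (m \<otimes>\<^bsub>A\<^esub> scalar A k) = (y \<triangleleft>\<^bsub>Y\<^esub> m) \<triangleleft>\<^bsub>Y\<^esub> scalar A k"
        using v scalar by (simp add: Y.ract_mult bimod_simps)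
      moreover have "(n \<otimes>\<^bsub>A\<^esub> scalar A k) \<triangleright>\<^bsub>Z\<^esub> z = scalar A k \<triangleright>\<^bsub>Z\<^esub> (n \<triangleright>\<^bsub>Z\<^esub> z)"
        using v scalar by (simp add: Y.scalar_commute[symmetric] Z.lact_mult bimod_simps)
      ultimately show ?thesis using v scalar T_rels_intros(3)[of "y \<triangleleft>\<^bsub>Y\<^esub> m" k "n \<triangleright>\<^bsub>Z\<^esub> z"]
        by (simp add: frag_bilin_simps bimod_simps)
    qed
  qed
  have 2: "frag_bilin ?h r (frag_of u) \<in> T.fq.Null"
    if "r \<in> tensor_rels K (over A Y) (over A Z)" "u \<in> carrier (A \<times>\<times> opp A)" for u r
  proof -
    obtain a b where u: "u = (a, b)" "a \<in> carrier A" "b \<in> carrier A"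
      using \<open>u \<in> _\<close> by (auto simp: Y.carrier_env_monoid)
    show ?thesis using \<open>r \<in> _\<close>
    proof (cases rule: T_rels_cases)
      case (left m m' n)
      then show ?thesis using u T_rels_intros(1)[of "m \<triangleleft>\<^bsub>Y\<^esub> a" "m' \<triangleleft>\<^bsub>Y\<^esub> a" "b \<triangleright>\<^bsub>Z\<^esub> n"]
        by (simp add: frag_bilin_simps bimod_simps)
    next
      case (right m n n')
      then show ?thesis using u T_rels_intros(2)[of "m \<triangleleft>\<^bsub>Y\<^esub> a" "b \<triangleright>\<^bsub>Z\<^esub> n" "b \<triangleright>\<^bsub>Z\<^esub> n'"]
        by (simp add: frag_bilin_simps bimod_simps)
    next
      case (scalar m k n)
      have "(m \<triangleleft>\<^bsub>Y\<^esub> scalar A k) \<triangleleft>\<^bsub>Y\<^esub> a = (m \<triangleleft>\<^bsub>Y\<^esub> a) \<triangleleft>\<^bsub>Y\<^esub> scalar A k"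
        using u scalar by (simp add: Y.scalar_central[symmetric] bimod_simps)
      moreover have "b \<triangleright>\<^bsub>Z\<^esub> (scalar A k \<triangleright>\<^bsub>Z\<^esub> n) = scalar A k \<triangleright>\<^bsub>Z\<^esub> (b \<triangleright>\<^bsub>Z\<^esub> n)"
        using u scalar by (simp add: Z.scalar_central bimod_simps)
      ultimately show ?thesis using u scalar T_rels_intros(3)[of "m \<triangleleft>\<^bsub>Y\<^esub> a" k "b \<triangleright>\<^bsub>Z\<^esub> n"]
        by (simp add: frag_bilin_simps bimod_simps)
    qed
  qed
  show ?thesis
    using T.fq.UN_cls_frag_bilin[OF T.fq.frag_quot_axioms Y.eq.frag_quot_axioms 2 1, of g f] assms
    unfolding RA_def tens_lift_def T_fold Y.eq_cls by (simp add: Y.carrier_env_monoid)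
qed

lemma tyz_closed: "\<lbrakk>y \<in> carrier Y; z \<in> carrier Z\<rbrakk> \<Longrightarrow> tyz y z \<in> carrier T"
  using T.tens_closed by simp

lemma LA_env:
  "\<lbrakk>a \<in> carrier A; b \<in> carrier A; y \<in> carrier Y; z \<in> carrier Z\<rbrakk> \<Longrightarrow>
    LA (env K A a b) (tyz y z) = tyz (a \<triangleright>\<^bsub>Y\<^esub> y) (z \<triangleleft>\<^bsub>Z\<^esub> b)"
  unfolding env_def by (simp add: LA_cls)

lemma RA_env:
  "\<lbrakk>a \<in> carrier A; b \<in> carrier A; y \<in> carrier Y; z \<in> carrier Z\<rbrakk> \<Longrightarrow>
    RA (tyz y z) (env K A a b) = tyz (y \<triangleleft>\<^bsub>Y\<^esub> a) (b \<triangleright>\<^bsub>Z\<^esub> z)"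
  unfolding env_def by (simp add: RA_cls)

lemma keys_act:
  assumes "Poly_Mapping.keys f \<subseteq> carrier A \<times> carrier A" "Poly_Mapping.keys g \<subseteq> carrier Y \<times> carrier Z"
  shows "Poly_Mapping.keys (frag_bilin (\<lambda>(a, a') (y, z). (a \<triangleright>\<^bsub>Y\<^esub> y, z \<triangleleft>\<^bsub>Z\<^esub> a')) f g) \<subseteq> carrier Y \<times> carrier Z"
    "Poly_Mapping.keys (frag_bilin (\<lambda>(y, z) (b, b'). (y \<triangleleft>\<^bsub>Y\<^esub> b, b' \<triangleright>\<^bsub>Z\<^esub> z)) g f) \<subseteq> carrier Y \<times> carrier Z"
  subgoal by (rule keys_frag_bilin[OF assms]) (auto simp: bimod_simps)
  subgoal by (rule keys_frag_bilin[OF assms(2,1)]) (auto simp: bimod_simps)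
  done

lemma keys_plus: "\<lbrakk>Poly_Mapping.keys f \<subseteq> S; Poly_Mapping.keys g \<subseteq> S\<rbrakk> \<Longrightarrow> Poly_Mapping.keys (f + g) \<subseteq> S"
  using keys_add[of f g] by blast

lemma LA_additive_left: "p \<in> carrier T \<Longrightarrow> additive_map Y.E T (\<lambda>e. LA e p)"
  by (intro additive_mapI; elim Y.carrier_E_E T.carrier_tensor_E)
    (simp_all add: LA_cls Y.add_E T.tens_cls_add T.tens_cls_closed keys_act keys_plus frag_bilin_add_left)

lemma LA_additive_right: "e \<in> carrier Y.E \<Longrightarrow> additive_map T T (\<lambda>p. LA e p)"
  by (intro additive_mapI; elim Y.carrier_E_E T.carrier_tensor_E)
    (simp_all add: LA_cls Y.add_E T.tens_cls_add T.tens_cls_closed keys_act keys_plus frag_bilin_add_right)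

lemma RA_additive_left: "e \<in> carrier Y.E \<Longrightarrow> additive_map T T (\<lambda>p. RA p e)"
  by (intro additive_mapI; elim Y.carrier_E_E T.carrier_tensor_E)
    (simp_all add: RA_cls Y.add_E T.tens_cls_add T.tens_cls_closed keys_act keys_plus frag_bilin_add_left)

lemma RA_additive_right: "p \<in> carrier T \<Longrightarrow> additive_map Y.E T (\<lambda>e. RA p e)"
  by (intro additive_mapI; elim Y.carrier_E_E T.carrier_tensor_E)
    (simp_all add: RA_cls Y.add_E T.tens_cls_add T.tens_cls_closed keys_act keys_plus frag_bilin_add_right)

lemma LA_closed: "\<lbrakk>e \<in> carrier Y.E; p \<in> carrier T\<rbrakk> \<Longrightarrow> LA e p \<in> carrier T"
  using additive_map_closed[OF LA_additive_left] .

lemma RA_closed: "\<lbrakk>e \<in> carrier Y.E; p \<in> carrier T\<rbrakk> \<Longrightarrow> RA p e \<in> carrier T"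
  using additive_map_closed[OF RA_additive_left] .

lemma T_eqI:
  assumes "additive_map T T f" "additive_map T T g"
    and "\<And>m n. \<lbrakk>m \<in> carrier Y; n \<in> carrier Z\<rbrakk> \<Longrightarrow> f (tyz m n) = g (tyz m n)"
    and "p \<in> carrier T"
  shows "f p = g p"
  using T.tensor_additive_eqI[OF T.abelian_group_axioms assms(1,2) _ assms(4)] assms(3) by simp

lemma id_additive: "additive_map M M (\<lambda>x. x)"
  by (simp add: additive_map_def)

lemma LA_one: "p \<in> carrier T \<Longrightarrow> LA \<one>\<^bsub>Y.E\<^esub> p = p"
  by (rule T_eqI[where f = "LA \<one>\<^bsub>Y.E\<^esub>" and g = "\<lambda>p. p", OF LA_additive_right id_additive])
    (simp_all add: LA_env Y.env_one[symmetric] Y.env_closed Y.lact_one Z.ract_one)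

lemma RA_one: "p \<in> carrier T \<Longrightarrow> RA p \<one>\<^bsub>Y.E\<^esub> = p"
  by (rule T_eqI[where f = "\<lambda>p. RA p \<one>\<^bsub>Y.E\<^esub>" and g = "\<lambda>p. p", OF RA_additive_left id_additive])
    (simp_all add: RA_env Y.env_one[symmetric] Y.env_closed Y.ract_one Z.lact_one)

text \<open>Reduces the bimodule axioms to elements \<open>env K A a b\<close> and elementary
  tensors, where they become the axioms of \<open>Y\<close> and \<open>Z\<close>.\<close>

lemma E_T_eqI:
  assumes G: "abelian_group G"
    and f: "\<And>p. p \<in> carrier T \<Longrightarrow> additive_map Y.E G (\<lambda>e. f e p)" "\<And>e. e \<in> carrier Y.E \<Longrightarrow> additive_map T G (f e)"
    and g: "\<And>p. p \<in> carrier T \<Longrightarrow> additive_map Y.E G (\<lambda>e. g e p)" "\<And>e. e \<in> carrier Y.E \<Longrightarrow> additive_map T G (g e)"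
    and eq: "\<And>a b y z. \<lbrakk>a \<in> carrier A; b \<in> carrier A; y \<in> carrier Y; z \<in> carrier Z\<rbrakk> \<Longrightarrow>
      f (env K A a b) (tyz y z) = g (env K A a b) (tyz y z)"
    and e: "e \<in> carrier Y.E" and p: "p \<in> carrier T"
  shows "f e p = g e p"
proof (rule Y.E_additive_eqI[OF G f(1)[OF p] g(1)[OF p] _ e])
  fix a b assume ab: "a \<in> carrier A" "b \<in> carrier A"
  note ec = Y.env_closed[OF ab]
  show "f (env K A a b) p = g (env K A a b) p"
    by (rule T.tensor_additive_eqI[OF G f(2)[OF ec] g(2)[OF ec] _ p]) (simp add: eq ab)
qed

lemma LA_mult:
  assumes e: "e \<in> carrier Y.E" and e': "e' \<in> carrier Y.E" and p: "p \<in> carrier T"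
  shows "LA (e \<otimes>\<^bsub>Y.E\<^esub> e') p = LA e (LA e' p)"
proof (rule E_T_eqI[where f = "\<lambda>e p. LA (e \<otimes>\<^bsub>Y.E\<^esub> e') p" and g = "\<lambda>e p. LA e (LA e' p)", OF T.abelian_group_axioms _ _ _ _ _ e p])
  fix a b y z assume ab: "a \<in> carrier A" "b \<in> carrier A" and yz: "y \<in> carrier Y" "z \<in> carrier Z"
  note ec = Y.env_closed[OF ab] and t = tyz_closed[OF yz]
  show "LA (env K A a b \<otimes>\<^bsub>Y.E\<^esub> e') (tyz y z) = LA (env K A a b) (LA e' (tyz y z))"
    \<comment> \<open>\<open>E_T_eqI\<close> has made \<open>e\<close> and \<open>p\<close>
      elementary; the remaining variable \<open>e'\<close> is treated by additivity alone.\<close>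
    by (rule Y.E_additive_eqI[OF T.abelian_group_axioms
          additive_map_comp[OF Y.E.additive_map_mult_left[OF ec] LA_additive_left[OF t]]
          additive_map_comp[OF LA_additive_left[OF t] LA_additive_right[OF ec]] _ e'])
      (use yz ab in \<open>simp add: Y.env_mult LA_env bimod_simps Y.lact_mult Z.ract_mult\<close>)
qed (blast intro: additive_map_comp[OF Y.E.additive_map_mult_right LA_additive_left]
    additive_map_comp[OF LA_additive_right LA_additive_right] LA_additive_right LA_additive_left
    Y.E.m_closed LA_closed e')+

lemma RA_mult:
  assumes e: "e \<in> carrier Y.E" and e': "e' \<in> carrier Y.E" and p: "p \<in> carrier T"
  shows "RA p (e \<otimes>\<^bsub>Y.E\<^esub> e') = RA (RA p e) e'"
proof (rule E_T_eqI[where f = "\<lambda>e p. RA p (e \<otimes>\<^bsub>Y.E\<^esub> e')" and g = "\<lambda>e p. RA (RA p e) e'", OF T.abelian_group_axioms _ _ _ _ _ e p])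
  fix a b y z assume ab: "a \<in> carrier A" "b \<in> carrier A" and yz: "y \<in> carrier Y" "z \<in> carrier Z"
  note ec = Y.env_closed[OF ab] and t = tyz_closed[OF yz]
  show "RA (tyz y z) (env K A a b \<otimes>\<^bsub>Y.E\<^esub> e') = RA (RA (tyz y z) (env K A a b)) e'"
    by (rule Y.E_additive_eqI[OF T.abelian_group_axioms
          additive_map_comp[OF Y.E.additive_map_mult_left[OF ec] RA_additive_right[OF t]]
          RA_additive_right[OF RA_closed[OF ec t]] _ e'])
      (use yz ab in \<open>simp add: Y.env_mult RA_env bimod_simps Y.ract_mult Z.lact_mult\<close>)
qed (blast intro: additive_map_comp[OF Y.E.additive_map_mult_right RA_additive_right]
    additive_map_comp[OF RA_additive_right RA_additive_left] additive_map_comp[OF RA_additive_left RA_additive_left]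
    RA_additive_left Y.E.m_closed e')+

lemma LA_RA:
  assumes e: "e \<in> carrier Y.E" and e': "e' \<in> carrier Y.E" and p: "p \<in> carrier T"
  shows "RA (LA e p) e' = LA e (RA p e')"
proof (rule E_T_eqI[where f = "\<lambda>e p. RA (LA e p) e'" and g = "\<lambda>e p. LA e (RA p e')", OF T.abelian_group_axioms _ _ _ _ _ e p])
  fix a b y z assume ab: "a \<in> carrier A" "b \<in> carrier A" and yz: "y \<in> carrier Y" "z \<in> carrier Z"
  note ec = Y.env_closed[OF ab] and t = tyz_closed[OF yz]
  show "RA (LA (env K A a b) (tyz y z)) e' = LA (env K A a b) (RA (tyz y z) e')"
    by (rule Y.E_additive_eqI[OF T.abelian_group_axioms RA_additive_right[OF LA_closed[OF ec t]]
          additive_map_comp[OF RA_additive_right[OF t] LA_additive_right[OF ec]] _ e'])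
      (use yz ab in \<open>simp add: LA_env RA_env bimod_simps\<close>)
qed (blast intro: additive_map_comp[OF LA_additive_left RA_additive_left]
    additive_map_comp[OF LA_additive_right RA_additive_left] additive_map_comp[OF RA_additive_left LA_additive_right]
    LA_additive_left RA_closed e')+

text \<open>Supplies the compatibility with both actions that \<open>TA_lift\<close> asks for, from
  its instances on elementary tensors.\<close>

lemma lift_actions:
  assumes B: "ring B" and \<phi>: "\<phi> \<in> ring_hom Y.E B" and \<psi>: "additive_map T B \<psi>"
    and lact: "\<And>a b y z. \<lbrakk>a \<in> carrier A; b \<in> carrier A; y \<in> carrier Y; z \<in> carrier Z\<rbrakk> \<Longrightarrow>
      \<psi> (tyz (a \<triangleright>\<^bsub>Y\<^esub> y) (z \<triangleleft>\<^bsub>Z\<^esub> b)) = \<phi> (env K A a b) \<otimes>\<^bsub>B\<^esub> \<psi> (tyz y z)"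
    and ract: "\<And>a b y z. \<lbrakk>a \<in> carrier A; b \<in> carrier A; y \<in> carrier Y; z \<in> carrier Z\<rbrakk> \<Longrightarrow>
      \<psi> (tyz (y \<triangleleft>\<^bsub>Y\<^esub> a) (b \<triangleright>\<^bsub>Z\<^esub> z)) = \<psi> (tyz y z) \<otimes>\<^bsub>B\<^esub> \<phi> (env K A a b)"
    and e: "e \<in> carrier Y.E" and p: "p \<in> carrier T"
  shows "\<psi> (LA e p) = \<phi> e \<otimes>\<^bsub>B\<^esub> \<psi> p" and "\<psi> (RA p e) = \<psi> p \<otimes>\<^bsub>B\<^esub> \<phi> e"
proof -
  interpret B: ring B by fact
  note \<phi>' = additive_map_ring_hom[OF \<phi>] and \<phi>_cl = ring_hom_closed[OF \<phi>] and \<psi>_cl = additive_map_closed[OF \<psi>]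
  show "\<psi> (LA e p) = \<phi> e \<otimes>\<^bsub>B\<^esub> \<psi> p"
    by (rule E_T_eqI[where f = "\<lambda>e p. \<psi> (LA e p)" and g = "\<lambda>e p. \<phi> e \<otimes>\<^bsub>B\<^esub> \<psi> p", OF B.is_abelian_group _ _ _ _ _ e p])
      (auto simp: LA_env lact \<phi>_cl \<psi>_cl intro: additive_map_comp[OF LA_additive_left \<psi>] additive_map_comp[OF LA_additive_right \<psi>]
        additive_map_comp[OF \<phi>' B.additive_map_mult_right] additive_map_comp[OF \<psi> B.additive_map_mult_left])
  show "\<psi> (RA p e) = \<psi> p \<otimes>\<^bsub>B\<^esub> \<phi> e"
    by (rule E_T_eqI[where f = "\<lambda>e p. \<psi> (RA p e)" and g = "\<lambda>e p. \<psi> p \<otimes>\<^bsub>B\<^esub> \<phi> e", OF B.is_abelian_group _ _ _ _ _ e p])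
      (auto simp: RA_env ract \<phi>_cl \<psi>_cl intro: additive_map_comp[OF RA_additive_left \<psi>] additive_map_comp[OF RA_additive_right \<psi>]
        additive_map_comp[OF \<phi>' B.additive_map_mult_left] additive_map_comp[OF \<psi> B.additive_map_mult_right])
qed

lemmas LA_add = additive_map_add[OF LA_additive_left] additive_map_add[OF LA_additive_right]
lemmas RA_add = additive_map_add[OF RA_additive_left] additive_map_add[OF RA_additive_right]

end

lemma (in ideal) quot_lift:
  assumes S: "ring S" and \<phi>: "\<phi> \<in> ring_hom R S" and kill: "\<And>x. x \<in> I \<Longrightarrow> \<phi> x = \<zero>\<^bsub>S\<^esub>"
  obtains \<psi> where "\<psi> \<in> ring_hom (R Quot I) S" "\<And>x. x \<in> carrier R \<Longrightarrow> \<psi> (I +> x) = \<phi> x"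
proof -
  interpret S: ring S by fact
  define \<psi> where "\<psi> c = \<phi> (SOME x. x \<in> c)" for c
  have \<psi>: "\<psi> (I +> x) = \<phi> x" if x: "x \<in> carrier R" for x
  proof -
    have "(SOME y. y \<in> I +> x) \<in> I +> x"
      by (rule someI) (rule a_rcos_self[OF x])
    then obtain h where "h \<in> I" "(SOME y. y \<in> I +> x) = h \<oplus> x"
      by (auto simp: a_r_coset_def r_coset_def)
    then show ?thesis
      using x by (simp add: \<psi>_def ring_hom_add[OF \<phi>] kill Icarr ring_hom_closed[OF \<phi>])
  qed
  show ?thesis
  proof
    have car: "\<exists>x\<in>carrier R. c = I +> x" if "c \<in> carrier (R Quot I)" for c
      using that by (auto simp: FactRing_def A_RCOSETS_def' a_r_coset_def)
    note rh = rcos_ring_hom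
    show "\<psi> \<in> ring_hom (R Quot I) S"
    proof (rule ring_hom_memI)
      fix c d assume "c \<in> carrier (R Quot I)" "d \<in> carrier (R Quot I)"
      then obtain x y where xy: "x \<in> carrier R" "c = I +> x" "y \<in> carrier R" "d = I +> y"
        using car by metis
      then show "\<psi> (c \<otimes>\<^bsub>R Quot I\<^esub> d) = \<psi> c \<otimes>\<^bsub>S\<^esub> \<psi> d" "\<psi> (c \<oplus>\<^bsub>R Quot I\<^esub> d) = \<psi> c \<oplus>\<^bsub>S\<^esub> \<psi> d"
        by (simp_all add: ring_hom_mult[OF rh, symmetric] ring_hom_add[OF rh, symmetric] \<psi>
            ring_hom_mult[OF \<phi>] ring_hom_add[OF \<phi>])
    next
      fix c assume "c \<in> carrier (R Quot I)"
      then obtain x where "x \<in> carrier R" "c = I +> x" using car by metis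
      then show "\<psi> c \<in> carrier S" by (simp add: \<psi> ring_hom_closed[OF \<phi>])
    next
      show "\<psi> \<one>\<^bsub>R Quot I\<^esub> = \<one>\<^bsub>S\<^esub>"
        by (simp add: ring_hom_one[OF rh, symmetric] \<psi> ring_hom_one[OF \<phi>])
    qed
  qed (rule \<psi>)
qed

section \<open>Dual bimodules\<close>

locale dual_bimodules = Om: algebra_bimodule K A Om + X: algebra_bimodule K A X
  for K :: "('k, 'kk) ring_scheme" and A :: "('k, 'a, 'aa) module_scheme"
    and Om :: "('a, 'w, 'ww) bimod_scheme" and X :: "('a, 'x, 'xx) bimod_scheme" +
  fixes D :: "('a, 'w, 'x) dual_data"
  assumes pivotal_dual: "pivotal_dual A Om X D"
begin

lemma coev_closed: "i < coev_len D \<Longrightarrow> coev_w D i \<in> carrier Om" "i < coev_len D \<Longrightarrow> coev_x D i \<in> carrier X"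
  and coevu_closed: "j < coevu_len D \<Longrightarrow> coevu_y D j \<in> carrier X" "j < coevu_len D \<Longrightarrow> coevu_r D j \<in> carrier Om"
  using pivotal_dual by (auto simp: pivotal_dual_def bimod_copairing_def)

lemma coev_central: "r \<in> carrier A \<Longrightarrow>
    (\<Oplus>\<^bsub>tensor A Om X\<^esub>i\<in>{..<coev_len D}. tens A Om X (r \<triangleright>\<^bsub>Om\<^esub> coev_w D i) (coev_x D i))
  = (\<Oplus>\<^bsub>tensor A Om X\<^esub>i\<in>{..<coev_len D}. tens A Om X (coev_w D i) (coev_x D i \<triangleleft>\<^bsub>X\<^esub> r))"
  using pivotal_dual by (auto simp: pivotal_dual_def bimod_copairing_def)

lemma ev_closed: "\<lbrakk>x \<in> carrier X; w \<in> carrier Om\<rbrakk> \<Longrightarrow> ev D x w \<in> carrier A"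
  and evu_closed: "\<lbrakk>x \<in> carrier X; w \<in> carrier Om\<rbrakk> \<Longrightarrow> evu D w x \<in> carrier A"
  using pivotal_dual by (auto simp: pivotal_dual_def bimod_pairing_def rhom_def lhom_def)

lemma Om_eq_coevu: "w \<in> carrier Om \<Longrightarrow> (\<Oplus>\<^bsub>Om\<^esub>j\<in>{..<coevu_len D}. evu D w (coevu_y D j) \<triangleright>\<^bsub>Om\<^esub> coevu_r D j) = w"
  and X_eq_coevu: "x \<in> carrier X \<Longrightarrow> (\<Oplus>\<^bsub>X\<^esub>j\<in>{..<coevu_len D}. coevu_y D j \<triangleleft>\<^bsub>X\<^esub> evu D (coevu_r D j) x) = x"
  using pivotal_dual unfolding pivotal_dual_def by (rule_tac sym, blast)+

sublocale XW: bimodule_pair K A X Om by unfold_locales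
sublocale WX: bimodule_pair K A Om X by unfold_locales

abbreviation "E \<equiv> env_algebra K A"
abbreviation "Z \<equiv> zed_bimod K A Om X"
abbreviation "tenv \<equiv> tz_env K A Om X"
abbreviation "txw \<equiv> tz_xw K A Om X"
abbreviation "twx \<equiv> tz_wx K A Om X"
abbreviation "zxw \<equiv> zed_xw K A Om X"
abbreviation "zwx \<equiv> zed_wx K A Om X"
abbreviation "hcls \<equiv> H_cls K A Om X D"
abbreviation "hrels \<equiv> H_relators K A Om X D"
abbreviation "hideal \<equiv> H_ideal K A Om X D"

lemma Z_simps:
  "carrier Z = carrier XW.T \<times> carrier WX.T"
  "(p, q) \<oplus>\<^bsub>Z\<^esub> (p', q') = (p \<oplus>\<^bsub>XW.T\<^esub> p', q \<oplus>\<^bsub>WX.T\<^esub> q')"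
  "\<zero>\<^bsub>Z\<^esub> = (\<zero>\<^bsub>XW.T\<^esub>, \<zero>\<^bsub>WX.T\<^esub>)"
  "e \<triangleright>\<^bsub>Z\<^esub> (p, q) = (XW.LA e p, WX.LA e q)"
  "(p, q) \<triangleleft>\<^bsub>Z\<^esub> e = (XW.RA p e, WX.RA q e)"
  by (simp_all add: zed_bimod_def RDirProd_def DirProd_def monoid.defs
      XW.LA_def XW.RA_def WX.LA_def WX.RA_def)

lemma abelian_group_Z: "abelian_group Z"
proof (rule abelian_groupI)
  fix u assume "u \<in> carrier Z"
  then show "\<exists>v\<in>carrier Z. v \<oplus>\<^bsub>Z\<^esub> u = \<zero>\<^bsub>Z\<^esub>"
    by (auto simp: Z_simps XW.T.l_neg WX.T.l_neg intro!: bexI[of _ "\<ominus>\<^bsub>XW.T\<^esub> fst u"] bexI[of _ "\<ominus>\<^bsub>WX.T\<^esub> snd u"])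
qed (auto simp: Z_simps XW.T.a_ac WX.T.a_ac)

lemma bimodule_Z: "bimodule E Z"
proof -
  interpret Z: abelian_group Z by (rule abelian_group_Z)
  show ?thesis
    by unfold_locales
      (auto simp: Z_simps XW.LA_closed XW.RA_closed XW.LA_add XW.RA_add XW.LA_mult XW.RA_mult
        XW.LA_one XW.RA_one XW.LA_RA WX.LA_closed WX.RA_closed WX.LA_add WX.RA_add WX.LA_mult WX.RA_mult
        WX.LA_one WX.RA_one WX.LA_RA)
qed

sublocale ta: tensor_alg E Z
  by (rule tensor_alg.intro) (rule bimodule_Z)

abbreviation "H \<equiv> H_alg K A Om X D"
abbreviation "hel \<equiv> H_el K A Om X D"
abbreviation "hbar \<equiv> H_bar K A Om X D"
abbreviation "hxw \<equiv> H_xw K A Om X D"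
abbreviation "hwx \<equiv> H_wx K A Om X D"

lemma zed_xw_closed: "\<lbrakk>x \<in> carrier X; w \<in> carrier Om\<rbrakk> \<Longrightarrow> zxw x w \<in> carrier Z"
  and zed_wx_closed: "\<lbrakk>x \<in> carrier X; w \<in> carrier Om\<rbrakk> \<Longrightarrow> zwx w x \<in> carrier Z"
  by (simp_all add: zed_xw_def zed_wx_def Z_simps XW.tyz_closed WX.tyz_closed)

lemma tz_env_closed: "\<lbrakk>a \<in> carrier A; b \<in> carrier A\<rbrakk> \<Longrightarrow> tenv a b \<in> carrier ta.TA"
  and tz_xw_closed: "\<lbrakk>x \<in> carrier X; w \<in> carrier Om\<rbrakk> \<Longrightarrow> txw x w \<in> carrier ta.TA"
  and tz_wx_closed: "\<lbrakk>x \<in> carrier X; w \<in> carrier Om\<rbrakk> \<Longrightarrow> twx w x \<in> carrier ta.TA"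
  by (simp_all add: tz_env_def tz_xw_def tz_wx_def ta.tsc_closed ta.tvec_closed Om.env_closed
      zed_xw_closed zed_wx_closed)

lemma H_relators_closed: "hrels \<subseteq> carrier ta.TA"
  unfolding H_relators_def Let_def tz_def
  by (auto intro!: ta.TA.minus_closed ta.TA.finsum_closed ta.TA.m_closed tz_env_closed tz_xw_closed
      tz_wx_closed ev_closed evu_closed coev_closed coevu_closed)

lemma ideal_H: "ideal (hideal) ta.TA"
  unfolding H_ideal_def tz_def by (rule ta.TA.genideal_ideal) (rule H_relators_closed)

lemma ring_H: "ring H"
  unfolding H_alg_def tz_def by (rule ideal.quotient_is_ring) (rule ideal_H)

sublocale H: ring H by (rule ring_H)

lemma H_cls_hom: "hcls \<in> ring_hom ta.TA H"
  using ideal.rcos_ring_hom[OF ideal_H] unfolding H_alg_def H_cls_def tz_def by simp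

lemmas H_cls_additive = additive_map_ring_hom[OF H_cls_hom]

lemma H_cls_relator:
  assumes "t \<ominus>\<^bsub>ta.TA\<^esub> u \<in> hrels" "t \<in> carrier ta.TA" "u \<in> carrier ta.TA"
  shows "hcls t = hcls u"
proof -
  have "t \<ominus>\<^bsub>ta.TA\<^esub> u \<in> hideal"
    using ta.TA.genideal_self[OF H_relators_closed] assms(1) unfolding H_ideal_def tz_def by blast
  then show ?thesis
    using ta.TA.quotient_eq_iff_same_a_r_cos[OF ideal_H assms(2,3)] unfolding H_cls_def tz_def by simp
qed

lemma hel_closed: "a \<in> carrier A \<Longrightarrow> hel a \<in> carrier H"
  and hbar_closed: "a \<in> carrier A \<Longrightarrow> hbar a \<in> carrier H"
  and hxw_closed: "\<lbrakk>x \<in> carrier X; w \<in> carrier Om\<rbrakk> \<Longrightarrow> hxw x w \<in> carrier H"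
  and hwx_closed: "\<lbrakk>x \<in> carrier X; w \<in> carrier Om\<rbrakk> \<Longrightarrow> hwx w x \<in> carrier H"
  unfolding H_el_def H_bar_def H_xw_def H_wx_def
  by (simp_all add: additive_map_closed[OF H_cls_additive] tz_env_closed tz_xw_closed tz_wx_closed)

lemma hel_hbar: "\<lbrakk>a \<in> carrier A; b \<in> carrier A\<rbrakk> \<Longrightarrow> hcls (tenv a b) = hel a \<otimes>\<^bsub>H\<^esub> hbar b"
  unfolding H_el_def H_bar_def
  by (simp add: ring_hom_mult[OF H_cls_hom, symmetric] tz_env_closed)
    (simp add: tz_env_def ring_hom_mult[OF ta.tsc_hom, symmetric] Om.env_closed Om.env_mult)

text \<open>Descends through the layers of the construction: a class comes from the tensor algebra,
  whose scalars are differences of products of \<open>hel a\<close> and \<open>hbar b\<close> and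
  whose vectors have two components, each built from elementary tensors.\<close>

lemma H_induct [consumes 1, case_names el bar xw wx minus mult]:
  assumes h: "h \<in> carrier H"
    and el: "\<And>a. a \<in> carrier A \<Longrightarrow> P (hel a)"
    and bar: "\<And>a. a \<in> carrier A \<Longrightarrow> P (hbar a)"
    and xw: "\<And>x w. \<lbrakk>x \<in> carrier X; w \<in> carrier Om\<rbrakk> \<Longrightarrow> P (hxw x w)"
    and wx: "\<And>x w. \<lbrakk>x \<in> carrier X; w \<in> carrier Om\<rbrakk> \<Longrightarrow> P (hwx w x)"
    and minus: "\<And>g h. \<lbrakk>g \<in> carrier H; h \<in> carrier H; P g; P h\<rbrakk> \<Longrightarrow> P (g \<ominus>\<^bsub>H\<^esub> h)"
    and mult: "\<And>g h. \<lbrakk>g \<in> carrier H; h \<in> carrier H; P g; P h\<rbrakk> \<Longrightarrow> P (g \<otimes>\<^bsub>H\<^esub> h)"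
  shows "P h"
proof -
  let ?c = "hcls"
  note cl = additive_map_closed[OF H_cls_additive]
  note cminus = additive_map_minus[OF ta.TA.is_abelian_group H.is_abelian_group H_cls_additive]
  obtain t where t: "t \<in> carrier ta.TA" "h = ?c t"
    using h by (auto simp: H_alg_def H_cls_def tz_def FactRing_def A_RCOSETS_def' a_r_coset_def)
  have Pminus: "P (?c (s \<ominus>\<^bsub>ta.TA\<^esub> t))"
    if "s \<in> carrier ta.TA" "t \<in> carrier ta.TA" "P (?c s)" "P (?c t)" for s t
    using minus[OF cl cl] that by (simp add: cminus)
  have zero: "P \<zero>\<^bsub>H\<^esub>"
    using minus[of "hel \<one>\<^bsub>A\<^esub>" "hel \<one>\<^bsub>A\<^esub>"] el[of "\<one>\<^bsub>A\<^esub>"] hel_closed[of "\<one>\<^bsub>A\<^esub>"]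
    by (simp add: H.minus_eq H.r_neg)
  have env: "P (?c (ta.tsc e))" if "e \<in> carrier E" for e
    using that
  proof (induction rule: Om.E_induct)
    case (env a b)
    then show ?case using hel_hbar[of a b] mult el bar by (simp add: tz_env_def hel_closed hbar_closed)
  next
    case (minus e e')
    have "ta.tsc (e \<ominus>\<^bsub>E\<^esub> e') = ta.tsc e \<ominus>\<^bsub>ta.TA\<^esub> ta.tsc e'"
      using minus(1,2)
      by (rule additive_map_minus[OF Om.E.is_abelian_group ta.TA.is_abelian_group additive_map_ring_hom[OF ta.tsc_hom]])
    then show ?case using Pminus minus by (simp add: ta.tsc_closed)
  qed
  have vminus: "ta.tvec (u \<ominus>\<^bsub>Z\<^esub> v) = ta.tvec u \<ominus>\<^bsub>ta.TA\<^esub> ta.tvec v" if "u \<in> carrier Z" "v \<in> carrier Z" for u v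
    using that by (rule additive_map_minus[OF abelian_group_Z ta.TA.is_abelian_group ta.tvec_additive])
  have Zuminus: "\<ominus>\<^bsub>Z\<^esub> (p, q) = (\<ominus>\<^bsub>XW.T\<^esub> p, \<ominus>\<^bsub>WX.T\<^esub> q)" if "p \<in> carrier XW.T" "q \<in> carrier WX.T" for p q
    by (rule ta.M.minus_equality) (use that in \<open>simp_all add: Z_simps XW.T.l_neg WX.T.l_neg\<close>)
  have Zminus: "(p, q) \<ominus>\<^bsub>Z\<^esub> (p', q') = (p \<ominus>\<^bsub>XW.T\<^esub> p', q \<ominus>\<^bsub>WX.T\<^esub> q')"
    if "p \<in> carrier XW.T" "q \<in> carrier WX.T" "p' \<in> carrier XW.T" "q' \<in> carrier WX.T" for p q p' q'
    using that by (simp add: ta.M.minus_eq Zuminus Z_simps XW.T.minus_eq WX.T.minus_eq)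
  have Pzero: "P (?c (ta.tvec (\<zero>\<^bsub>XW.T\<^esub>, \<zero>\<^bsub>WX.T\<^esub>)))"
    using zero additive_map_zero[OF abelian_group_Z ta.TA.is_abelian_group ta.tvec_additive]
      additive_map_zero[OF ta.TA.is_abelian_group H.is_abelian_group H_cls_additive] by (simp add: Z_simps)
  have left: "P (?c (ta.tvec (p, \<zero>\<^bsub>WX.T\<^esub>)))" if "p \<in> carrier XW.T" for p
    using that
  proof (induction rule: XW.T.tensor_induct)
    case (tens m n)
    then show ?case using xw by (simp add: H_xw_def tz_xw_def zed_xw_def)
  next
    case (minus p q)
    have "(p \<ominus>\<^bsub>XW.T\<^esub> q, \<zero>\<^bsub>WX.T\<^esub>) = (p, \<zero>\<^bsub>WX.T\<^esub>) \<ominus>\<^bsub>Z\<^esub> (q, \<zero>\<^bsub>WX.T\<^esub>)"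
      using minus by (simp add: Zminus WX.T.minus_eq WX.T.r_neg)
    then show ?case using minus by (simp add: vminus Pminus ta.tvec_closed Z_simps)
  qed (rule Pzero)
  have right: "P (?c (ta.tvec (\<zero>\<^bsub>XW.T\<^esub>, p)))" if "p \<in> carrier WX.T" for p
    using that
  proof (induction rule: WX.T.tensor_induct)
    case (tens m n)
    then show ?case using wx by (simp add: H_wx_def tz_wx_def zed_wx_def)
  next
    case (minus p q)
    have "(\<zero>\<^bsub>XW.T\<^esub>, p \<ominus>\<^bsub>WX.T\<^esub> q) = (\<zero>\<^bsub>XW.T\<^esub>, p) \<ominus>\<^bsub>Z\<^esub> (\<zero>\<^bsub>XW.T\<^esub>, q)"
      using minus by (simp add: Zminus XW.T.minus_eq XW.T.r_neg)
    then show ?case using minus by (simp add: vminus Pminus ta.tvec_closed Z_simps)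
  qed (rule Pzero)
  have "P (?c t)"
    using t(1)
  proof (induction rule: ta.TA_induct)
    case (vector v)
    obtain p q where v: "v = (p, q)" "p \<in> carrier XW.T" "q \<in> carrier WX.T"
      using vector by (auto simp: Z_simps)
    \<comment> \<open>A difference instead of a sum, hence the negated \<open>q\<close>, because the
      induction offers differences only.\<close>
    then have "v = (p, \<zero>\<^bsub>WX.T\<^esub>) \<ominus>\<^bsub>Z\<^esub> (\<zero>\<^bsub>XW.T\<^esub>, \<ominus>\<^bsub>WX.T\<^esub> q)"
      by (simp add: Zminus XW.T.minus_eq WX.T.minus_eq)
    then show ?case using v left right by (simp add: vminus Pminus ta.tvec_closed Z_simps)
  next
    case (mult p q)
    then show ?case using assms(7)[OF cl cl] by (simp add: ring_hom_mult[OF H_cls_hom])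
  qed (use env Pminus in auto)
  then show ?thesis by (simp add: t)
qed

end

text \<open>\<open>H\<close> is the initial ring carrying this structure (\<open>H_relations_H\<close>, \<open>H_lift\<close>, \<open>H_induct\<close>).\<close>

locale H_relations = dual_bimodules K A Om X D + B: ring B
  for K :: "('k, 'kk) ring_scheme" and A :: "('k, 'a, 'aa) module_scheme"
    and Om :: "('a, 'w, 'ww) bimod_scheme" and X :: "('a, 'x, 'xx) bimod_scheme"
    and D :: "('a, 'w, 'x) dual_data" and B :: "('b, 'bb) ring_scheme" (structure) +
  fixes el bar :: "'a \<Rightarrow> 'b" and xw :: "'x \<Rightarrow> 'w \<Rightarrow> 'b" and wx :: "'w \<Rightarrow> 'x \<Rightarrow> 'b"
  assumes el: "el \<in> ring_hom A B" and bar: "bar \<in> ring_hom A (opp B)"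
    and el_bar: "\<lbrakk>a \<in> carrier A; b \<in> carrier A\<rbrakk> \<Longrightarrow> el a \<otimes> bar b = bar b \<otimes> el a"
    and el_scalar: "k \<in> carrier K \<Longrightarrow> el (scalar A k) = bar (scalar A k)"
    and xw_left: "w \<in> carrier Om \<Longrightarrow> additive_map X B (\<lambda>x. xw x w)"
    and xw_right: "x \<in> carrier X \<Longrightarrow> additive_map Om B (\<lambda>w. xw x w)"
    and wx_left: "x \<in> carrier X \<Longrightarrow> additive_map Om B (\<lambda>w. wx w x)"
    and wx_right: "w \<in> carrier Om \<Longrightarrow> additive_map X B (\<lambda>x. wx w x)"
    and el_xw: "\<lbrakk>a \<in> carrier A; x \<in> carrier X; w \<in> carrier Om\<rbrakk> \<Longrightarrow> el a \<otimes> xw x w = xw (a \<triangleright>\<^bsub>X\<^esub> x) w"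
    and xw_el: "\<lbrakk>a \<in> carrier A; x \<in> carrier X; w \<in> carrier Om\<rbrakk> \<Longrightarrow> xw x w \<otimes> el a = xw (x \<triangleleft>\<^bsub>X\<^esub> a) w"
    and bar_xw: "\<lbrakk>a \<in> carrier A; x \<in> carrier X; w \<in> carrier Om\<rbrakk> \<Longrightarrow> bar a \<otimes> xw x w = xw x (w \<triangleleft>\<^bsub>Om\<^esub> a)"
    and xw_bar: "\<lbrakk>a \<in> carrier A; x \<in> carrier X; w \<in> carrier Om\<rbrakk> \<Longrightarrow> xw x w \<otimes> bar a = xw x (a \<triangleright>\<^bsub>Om\<^esub> w)"
    and el_wx: "\<lbrakk>a \<in> carrier A; x \<in> carrier X; w \<in> carrier Om\<rbrakk> \<Longrightarrow> el a \<otimes> wx w x = wx (a \<triangleright>\<^bsub>Om\<^esub> w) x"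
    and wx_el: "\<lbrakk>a \<in> carrier A; x \<in> carrier X; w \<in> carrier Om\<rbrakk> \<Longrightarrow> wx w x \<otimes> el a = wx (w \<triangleleft>\<^bsub>Om\<^esub> a) x"
    and bar_wx: "\<lbrakk>a \<in> carrier A; x \<in> carrier X; w \<in> carrier Om\<rbrakk> \<Longrightarrow> bar a \<otimes> wx w x = wx w (x \<triangleleft>\<^bsub>X\<^esub> a)"
    and wx_bar: "\<lbrakk>a \<in> carrier A; x \<in> carrier X; w \<in> carrier Om\<rbrakk> \<Longrightarrow> wx w x \<otimes> bar a = wx w (a \<triangleright>\<^bsub>X\<^esub> x)"
    and wx_xw_coev: "\<lbrakk>x \<in> carrier X; w \<in> carrier Om\<rbrakk> \<Longrightarrow>
      (\<Oplus>i\<in>{..<coev_len D}. wx (coev_w D i) x \<otimes> xw (coev_x D i) w) = bar (evu D w x)"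
    and xw_wx_coevu: "\<lbrakk>x \<in> carrier X; w \<in> carrier Om\<rbrakk> \<Longrightarrow>
      (\<Oplus>j\<in>{..<coevu_len D}. xw x (coevu_r D j) \<otimes> wx w (coevu_y D j)) = el (ev D x w)"
    and xw_wx_coevu': "\<lbrakk>x \<in> carrier X; w \<in> carrier Om\<rbrakk> \<Longrightarrow>
      (\<Oplus>j\<in>{..<coevu_len D}. xw (coevu_y D j) w \<otimes> wx (coevu_r D j) x) = bar (ev D x w)"
    and wx_xw_coev': "\<lbrakk>x \<in> carrier X; w \<in> carrier Om\<rbrakk> \<Longrightarrow>
      (\<Oplus>i\<in>{..<coev_len D}. wx w (coev_x D i) \<otimes> xw x (coev_w D i)) = el (evu D w x)"
begin

lemma el_closed: "a \<in> carrier A \<Longrightarrow> el a \<in> carrier B"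
  and bar_closed: "a \<in> carrier A \<Longrightarrow> bar a \<in> carrier B"
  and xw_closed: "\<lbrakk>x \<in> carrier X; w \<in> carrier Om\<rbrakk> \<Longrightarrow> xw x w \<in> carrier B"
  and wx_closed: "\<lbrakk>x \<in> carrier X; w \<in> carrier Om\<rbrakk> \<Longrightarrow> wx w x \<in> carrier B"
  using ring_hom_closed[OF el] ring_hom_closed[OF bar] additive_map_closed[OF xw_right]
    additive_map_closed[OF wx_right] by auto

lemma el_one: "el \<one>\<^bsub>A\<^esub> = \<one>" and bar_one: "bar \<one>\<^bsub>A\<^esub> = \<one>"
  using ring_hom_one[OF el] ring_hom_one[OF bar] by auto

text \<open>Each layer contributes its universal property: \<open>E_lift\<close> on the enveloping
  algebra, \<open>tensor_lift\<close> on both summands of \<open>Z\<close>, \<open>TA_lift\<close>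
  on the tensor algebra and \<open>quot_lift\<close> on the ideal.\<close>

lemma H_lift:
  obtains \<Phi> where "\<Phi> \<in> ring_hom H B"
    "\<And>a. a \<in> carrier A \<Longrightarrow> \<Phi> (hel a) = el a" "\<And>a. a \<in> carrier A \<Longrightarrow> \<Phi> (hbar a) = bar a"
    "\<And>x w. \<lbrakk>x \<in> carrier X; w \<in> carrier Om\<rbrakk> \<Longrightarrow> \<Phi> (hxw x w) = xw x w"
    "\<And>x w. \<lbrakk>x \<in> carrier X; w \<in> carrier Om\<rbrakk> \<Longrightarrow> \<Phi> (hwx w x) = wx w x"
proof -
  note BG = B.is_abelian_group
  obtain \<phi> where \<phi>: "\<phi> \<in> ring_hom E B"
    and \<phi>_env: "\<And>a b. \<lbrakk>a \<in> carrier A; b \<in> carrier A\<rbrakk> \<Longrightarrow> \<phi> (env K A a b) = el a \<otimes> bar b"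
    using Om.E_lift[OF B.ring_axioms el bar el_bar el_scalar] by blast
  \<comment> \<open>The scalar moves from one argument to the other through the product, since
    \<open>el\<close> and \<open>bar\<close> agree on it.\<close>
  have bal1: "xw (x \<triangleleft>\<^bsub>X\<^esub> scalar A k) w = xw x (scalar A k \<triangleright>\<^bsub>Om\<^esub> w)"
    if "x \<in> carrier X" "k \<in> carrier K" "w \<in> carrier Om" for x k w
    using xw_el[of "scalar A k" x w] xw_bar[of "scalar A k" x w] that by (simp add: Om.scalar_closed el_scalar)
  have bal2: "wx (w \<triangleleft>\<^bsub>Om\<^esub> scalar A k) x = wx w (scalar A k \<triangleright>\<^bsub>X\<^esub> x)"
    if "x \<in> carrier X" "k \<in> carrier K" "w \<in> carrier Om" for x k w
    using wx_el[of "scalar A k" x w] wx_bar[of "scalar A k" x w] that by (simp add: Om.scalar_closed el_scalar)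
  obtain \<psi>1 where \<psi>1: "additive_map XW.T B \<psi>1"
    "\<And>x w. \<lbrakk>x \<in> carrier X; w \<in> carrier Om\<rbrakk> \<Longrightarrow> \<psi>1 (XW.tyz x w) = xw x w"
    by (rule XW.T.tensor_lift[OF BG, of xw]) (simp_all add: xw_left xw_right bal1)
  obtain \<psi>2 where \<psi>2: "additive_map WX.T B \<psi>2"
    "\<And>w x. \<lbrakk>w \<in> carrier Om; x \<in> carrier X\<rbrakk> \<Longrightarrow> \<psi>2 (WX.tyz w x) = wx w x"
    by (rule WX.T.tensor_lift[OF BG, of wx]) (simp_all add: wx_left wx_right bal2)
  note \<phi>_add = additive_map_ring_hom[OF \<phi>]
  note acl = X.lact_closed X.ract_closed Om.lact_closed Om.ract_closed el_closed bar_closed xw_closed wx_closed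
  have act1: "\<psi>1 (XW.LA e p) = \<phi> e \<otimes> \<psi>1 p \<and> \<psi>1 (XW.RA p e) = \<psi>1 p \<otimes> \<phi> e"
    if ep: "e \<in> carrier E" "p \<in> carrier XW.T" for e p
  proof -
    have "\<psi>1 (XW.tyz (a \<triangleright>\<^bsub>X\<^esub> x) (w \<triangleleft>\<^bsub>Om\<^esub> b)) = \<phi> (env K A a b) \<otimes> \<psi>1 (XW.tyz x w)"
      "\<psi>1 (XW.tyz (x \<triangleleft>\<^bsub>X\<^esub> a) (b \<triangleright>\<^bsub>Om\<^esub> w)) = \<psi>1 (XW.tyz x w) \<otimes> \<phi> (env K A a b)"
      if "a \<in> carrier A" "b \<in> carrier A" "x \<in> carrier X" "w \<in> carrier Om" for a b x w
      using that by (simp add: \<psi>1 \<phi>_env acl B.m_assoc bar_xw el_xw)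
        (use that in \<open>simp add: \<psi>1 \<phi>_env acl B.m_assoc[symmetric] xw_bar xw_el\<close>)
    from XW.lift_actions[OF B.ring_axioms \<phi> \<psi>1(1) this ep] show ?thesis ..
  qed
  have act2: "\<psi>2 (WX.LA e p) = \<phi> e \<otimes> \<psi>2 p \<and> \<psi>2 (WX.RA p e) = \<psi>2 p \<otimes> \<phi> e"
    if ep: "e \<in> carrier E" "p \<in> carrier WX.T" for e p
  proof -
    have "\<psi>2 (WX.tyz (a \<triangleright>\<^bsub>Om\<^esub> w) (x \<triangleleft>\<^bsub>X\<^esub> b)) = \<phi> (env K A a b) \<otimes> \<psi>2 (WX.tyz w x)"
      "\<psi>2 (WX.tyz (w \<triangleleft>\<^bsub>Om\<^esub> a) (b \<triangleright>\<^bsub>X\<^esub> x)) = \<psi>2 (WX.tyz w x) \<otimes> \<phi> (env K A a b)"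
      if "a \<in> carrier A" "b \<in> carrier A" "x \<in> carrier X" "w \<in> carrier Om" for a b x w
      using that by (simp add: \<psi>2 \<phi>_env acl B.m_assoc bar_wx el_wx)
        (use that in \<open>simp add: \<psi>2 \<phi>_env acl B.m_assoc[symmetric] wx_bar wx_el\<close>)
    from WX.lift_actions[OF B.ring_axioms \<phi> \<psi>2(1) this ep] show ?thesis ..
  qed
  define \<psi> where "\<psi> v = \<psi>1 (fst v) \<oplus> \<psi>2 (snd v)" for v
  note c12 = additive_map_closed[OF \<psi>1(1)] additive_map_closed[OF \<psi>2(1)]
    additive_map_add[OF \<psi>1(1)] additive_map_add[OF \<psi>2(1)]
  have \<psi>_add: "additive_map Z B \<psi>"
    by (rule additive_mapI) (auto simp: \<psi>_def Z_simps c12 B.a_ac)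
  have \<psi>_lact: "\<psi> (e \<triangleright>\<^bsub>Z\<^esub> v) = \<phi> e \<otimes> \<psi> v" if "e \<in> carrier E" "v \<in> carrier Z" for e v
    using that by (cases v) (auto simp: \<psi>_def Z_simps act1 act2 c12 B.r_distr additive_map_closed[OF \<phi>_add])
  have \<psi>_ract: "\<psi> (v \<triangleleft>\<^bsub>Z\<^esub> e) = \<psi> v \<otimes> \<phi> e" if "e \<in> carrier E" "v \<in> carrier Z" for e v
    using that by (cases v) (auto simp: \<psi>_def Z_simps act1 act2 c12 B.l_distr additive_map_closed[OF \<phi>_add])
  obtain \<Phi> where \<Phi>: "\<Phi> \<in> ring_hom ta.TA B"
    and \<Phi>_sc: "\<And>e. e \<in> carrier E \<Longrightarrow> \<Phi> (ta.tsc e) = \<phi> e"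
    and \<Phi>_vec: "\<And>v. v \<in> carrier Z \<Longrightarrow> \<Phi> (ta.tvec v) = \<psi> v"
    using ta.TA_lift[OF B.ring_axioms \<phi> \<psi>_add \<psi>_lact \<psi>_ract] by blast
  have \<Phi>_env: "\<Phi> (tenv a b) = el a \<otimes> bar b" if "a \<in> carrier A" "b \<in> carrier A" for a b
    using that by (simp add: tz_env_def \<Phi>_sc Om.env_closed \<phi>_env)
  have z1: "\<psi>1 \<zero>\<^bsub>XW.T\<^esub> = \<zero>" "\<psi>2 \<zero>\<^bsub>WX.T\<^esub> = \<zero>"
    using additive_map_zero[OF XW.T.abelian_group_axioms BG \<psi>1(1)]
      additive_map_zero[OF WX.T.abelian_group_axioms BG \<psi>2(1)] by auto
  have \<Phi>_xw: "\<Phi> (txw x w) = xw x w" if "x \<in> carrier X" "w \<in> carrier Om" for x w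
    using that zed_xw_closed[OF that] by (simp add: tz_xw_def \<Phi>_vec) (simp add: zed_xw_def \<psi>_def \<psi>1 z1 xw_closed)
  have \<Phi>_wx: "\<Phi> (twx w x) = wx w x" if "x \<in> carrier X" "w \<in> carrier Om" for x w
    using that zed_wx_closed[OF that] by (simp add: tz_wx_def \<Phi>_vec) (simp add: zed_wx_def \<psi>_def \<psi>2 z1 wx_closed)
  note \<Phi>_add = additive_map_ring_hom[OF \<Phi>]
  note \<Phi>_minus = additive_map_minus[OF ta.TA.is_abelian_group BG \<Phi>_add]
  note \<Phi>_sum = additive_map_finsum[OF ta.TA.is_abelian_group BG \<Phi>_add finite_lessThan]
  note tcl = tz_env_closed tz_xw_closed tz_wx_closed coev_closed coevu_closed ev_closed evu_closed
  have kill_rel: "\<Phi> t = \<zero>" if "t \<in> hrels" for t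
  proof -
    \<comment> \<open>All four relators have this shape, a sum of products of generators minus an
      element of the enveloping algebra.\<close>
    have sum: "\<Phi> ((\<Oplus>\<^bsub>ta.TA\<^esub>i\<in>{..<n}. f i \<otimes>\<^bsub>ta.TA\<^esub> g i) \<ominus>\<^bsub>ta.TA\<^esub> u) = \<zero>"
      if "\<And>i. i < n \<Longrightarrow> f i \<in> carrier ta.TA \<and> \<Phi> (f i) = f' i"
        "\<And>i. i < n \<Longrightarrow> g i \<in> carrier ta.TA \<and> \<Phi> (g i) = g' i"
        "u \<in> carrier ta.TA" "(\<Oplus>i\<in>{..<n}. f' i \<otimes> g' i) = \<Phi> u"
      for f g f' g' u and n :: nat
    proof -
      have "(\<Oplus>i\<in>{..<n}. \<Phi> (f i \<otimes>\<^bsub>ta.TA\<^esub> g i)) = (\<Oplus>i\<in>{..<n}. f' i \<otimes> g' i)"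
      proof (rule B.finsum_cong')
        have c: "f' i \<in> carrier B" "g' i \<in> carrier B" if "i < n" for i
          using ring_hom_closed[OF \<Phi>] \<open>\<And>i. i < n \<Longrightarrow> _ \<and> \<Phi> (f i) = _\<close>[OF that]
            \<open>\<And>i. i < n \<Longrightarrow> _ \<and> \<Phi> (g i) = _\<close>[OF that] by metis+
        then show "(\<lambda>i. f' i \<otimes> g' i) \<in> {..<n} \<rightarrow> carrier B" by simp
      qed (use that(1,2) ring_hom_mult[OF \<Phi>] in auto)
      moreover have "\<Phi> (\<Oplus>\<^bsub>ta.TA\<^esub>i\<in>{..<n}. f i \<otimes>\<^bsub>ta.TA\<^esub> g i) = (\<Oplus>i\<in>{..<n}. \<Phi> (f i \<otimes>\<^bsub>ta.TA\<^esub> g i))"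
        by (rule \<Phi>_sum) (use that(1,2) in auto)
      ultimately show ?thesis
        using that by (simp add: \<Phi>_minus Pi_def B.minus_eq B.r_neg additive_map_closed[OF \<Phi>_add])
    qed
    from that obtain x w where xw': "x \<in> carrier X" "w \<in> carrier Om" and t: "t \<in> {
        (\<Oplus>\<^bsub>ta.TA\<^esub>i\<in>{..<coev_len D}. twx (coev_w D i) x \<otimes>\<^bsub>ta.TA\<^esub> txw (coev_x D i) w)
          \<ominus>\<^bsub>ta.TA\<^esub> tenv \<one>\<^bsub>A\<^esub> (evu D w x),
        (\<Oplus>\<^bsub>ta.TA\<^esub>j\<in>{..<coevu_len D}. txw x (coevu_r D j) \<otimes>\<^bsub>ta.TA\<^esub> twx w (coevu_y D j))
          \<ominus>\<^bsub>ta.TA\<^esub> tenv (ev D x w) \<one>\<^bsub>A\<^esub>,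
        (\<Oplus>\<^bsub>ta.TA\<^esub>j\<in>{..<coevu_len D}. txw (coevu_y D j) w \<otimes>\<^bsub>ta.TA\<^esub> twx (coevu_r D j) x)
          \<ominus>\<^bsub>ta.TA\<^esub> tenv \<one>\<^bsub>A\<^esub> (ev D x w),
        (\<Oplus>\<^bsub>ta.TA\<^esub>i\<in>{..<coev_len D}. twx w (coev_x D i) \<otimes>\<^bsub>ta.TA\<^esub> txw x (coev_w D i))
          \<ominus>\<^bsub>ta.TA\<^esub> tenv (evu D w x) \<one>\<^bsub>A\<^esub>}"
      unfolding H_relators_def Let_def tz_def by blast
    note s = \<Phi>_env \<Phi>_xw \<Phi>_wx el_one bar_one el_closed bar_closed tcl xw'
    have r1: "\<Phi> ((\<Oplus>\<^bsub>ta.TA\<^esub>i\<in>{..<coev_len D}. twx (coev_w D i) x \<otimes>\<^bsub>ta.TA\<^esub> txw (coev_x D i) w)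
        \<ominus>\<^bsub>ta.TA\<^esub> tenv \<one>\<^bsub>A\<^esub> (evu D w x)) = \<zero>"
      by (rule sum[where f' = "\<lambda>i. wx (coev_w D i) x" and g' = "\<lambda>i. xw (coev_x D i) w"])
        (simp_all add: s wx_xw_coev)
    have r2: "\<Phi> ((\<Oplus>\<^bsub>ta.TA\<^esub>j\<in>{..<coevu_len D}. txw x (coevu_r D j) \<otimes>\<^bsub>ta.TA\<^esub> twx w (coevu_y D j))
        \<ominus>\<^bsub>ta.TA\<^esub> tenv (ev D x w) \<one>\<^bsub>A\<^esub>) = \<zero>"
      by (rule sum[where f' = "\<lambda>j. xw x (coevu_r D j)" and g' = "\<lambda>j. wx w (coevu_y D j)"])
        (simp_all add: s xw_wx_coevu)
    have r3: "\<Phi> ((\<Oplus>\<^bsub>ta.TA\<^esub>j\<in>{..<coevu_len D}. txw (coevu_y D j) w \<otimes>\<^bsub>ta.TA\<^esub> twx (coevu_r D j) x)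
        \<ominus>\<^bsub>ta.TA\<^esub> tenv \<one>\<^bsub>A\<^esub> (ev D x w)) = \<zero>"
      by (rule sum[where f' = "\<lambda>j. xw (coevu_y D j) w" and g' = "\<lambda>j. wx (coevu_r D j) x"])
        (simp_all add: s xw_wx_coevu')
    have r4: "\<Phi> ((\<Oplus>\<^bsub>ta.TA\<^esub>i\<in>{..<coev_len D}. twx w (coev_x D i) \<otimes>\<^bsub>ta.TA\<^esub> txw x (coev_w D i))
        \<ominus>\<^bsub>ta.TA\<^esub> tenv (evu D w x) \<one>\<^bsub>A\<^esub>) = \<zero>"
      by (rule sum[where f' = "\<lambda>i. wx w (coev_x D i)" and g' = "\<lambda>i. xw x (coev_w D i)"])
        (simp_all add: s wx_xw_coev')
    show ?thesis
      using t by (elim insertE emptyE) (simp_all only: r1 r2 r3 r4)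
  qed
  have kill: "\<Phi> t = \<zero>" if "t \<in> hideal" for t
  proof -
    interpret \<Phi>: ring_hom_ring ta.TA B \<Phi>
      by (rule ring_hom_ringI2) (use ta.ring_TA B.ring_axioms \<Phi> in auto)
    \<comment> \<open>The kernel of a ring homomorphism is an ideal, so containing the relators is
      enough.\<close>
    have "hrels \<subseteq> a_kernel ta.TA B \<Phi>"
      unfolding a_kernel_def' using kill_rel H_relators_closed by blast
    then have "hideal \<subseteq> a_kernel ta.TA B \<Phi>"
      unfolding H_ideal_def tz_def by (rule ta.TA.genideal_minimal[OF \<Phi>.kernel_is_ideal])
    then show ?thesis using that unfolding a_kernel_def' by blast
  qed
  obtain \<Psi> where \<Psi>': "\<Psi> \<in> ring_hom (ta.TA Quot hideal) B"
    "\<And>t. t \<in> carrier ta.TA \<Longrightarrow> \<Psi> (hideal +>\<^bsub>ta.TA\<^esub> t) = \<Phi> t"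
    by (rule ideal.quot_lift[OF ideal_H B.ring_axioms \<Phi> kill], assumption) (rule_tac that)
  have \<Psi>: "\<Psi> \<in> ring_hom H B" "\<And>t. t \<in> carrier ta.TA \<Longrightarrow> \<Psi> (hcls t) = \<Phi> t"
    unfolding H_alg_def H_cls_def tz_def by (rule \<Psi>'(1), erule \<Psi>'(2))
  show ?thesis
    by (rule that[OF \<Psi>(1)])
      (simp_all add: H_el_def H_bar_def H_xw_def H_wx_def \<Psi>(2) tz_env_closed tz_xw_closed tz_wx_closed
        \<Phi>_env \<Phi>_xw \<Phi>_wx el_one bar_one el_closed bar_closed)
qed

end

section \<open>The relations inside \<open>H\<close> itself\<close>

context dual_bimodules
begin

lemma zed_actions:
  assumes "a \<in> carrier A" "b \<in> carrier A" "x \<in> carrier X" "w \<in> carrier Om"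
  shows "env K A a b \<triangleright>\<^bsub>Z\<^esub> zxw x w = zxw (a \<triangleright>\<^bsub>X\<^esub> x) (w \<triangleleft>\<^bsub>Om\<^esub> b)"
    and "zxw x w \<triangleleft>\<^bsub>Z\<^esub> env K A a b = zxw (x \<triangleleft>\<^bsub>X\<^esub> a) (b \<triangleright>\<^bsub>Om\<^esub> w)"
    and "env K A a b \<triangleright>\<^bsub>Z\<^esub> zwx w x = zwx (a \<triangleright>\<^bsub>Om\<^esub> w) (x \<triangleleft>\<^bsub>X\<^esub> b)"
    and "zwx w x \<triangleleft>\<^bsub>Z\<^esub> env K A a b = zwx (w \<triangleleft>\<^bsub>Om\<^esub> a) (b \<triangleright>\<^bsub>X\<^esub> x)"
proof -
  have e: "env K A a b \<in> carrier E" using assms by (simp add: Om.env_closed)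
  note z = additive_map_zero[OF XW.T.abelian_group_axioms XW.T.abelian_group_axioms XW.LA_additive_right[OF e]]
    additive_map_zero[OF XW.T.abelian_group_axioms XW.T.abelian_group_axioms XW.RA_additive_left[OF e]]
    additive_map_zero[OF WX.T.abelian_group_axioms WX.T.abelian_group_axioms WX.LA_additive_right[OF e]]
    additive_map_zero[OF WX.T.abelian_group_axioms WX.T.abelian_group_axioms WX.RA_additive_left[OF e]]
  show "env K A a b \<triangleright>\<^bsub>Z\<^esub> zxw x w = zxw (a \<triangleright>\<^bsub>X\<^esub> x) (w \<triangleleft>\<^bsub>Om\<^esub> b)"
    "zxw x w \<triangleleft>\<^bsub>Z\<^esub> env K A a b = zxw (x \<triangleleft>\<^bsub>X\<^esub> a) (b \<triangleright>\<^bsub>Om\<^esub> w)"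
    "env K A a b \<triangleright>\<^bsub>Z\<^esub> zwx w x = zwx (a \<triangleright>\<^bsub>Om\<^esub> w) (x \<triangleleft>\<^bsub>X\<^esub> b)"
    "zwx w x \<triangleleft>\<^bsub>Z\<^esub> env K A a b = zwx (w \<triangleleft>\<^bsub>Om\<^esub> a) (b \<triangleright>\<^bsub>X\<^esub> x)"
    using assms by (simp_all add: zed_xw_def zed_wx_def Z_simps z XW.LA_env XW.RA_env WX.LA_env WX.RA_env)
qed

lemma zed_xw_add:
  "\<lbrakk>x \<in> carrier X; x' \<in> carrier X; w \<in> carrier Om\<rbrakk> \<Longrightarrow>
    zxw (x \<oplus>\<^bsub>X\<^esub> x') w = zxw x w \<oplus>\<^bsub>Z\<^esub> zxw x' w"
  "\<lbrakk>x \<in> carrier X; w \<in> carrier Om; w' \<in> carrier Om\<rbrakk> \<Longrightarrow>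
    zxw x (w \<oplus>\<^bsub>Om\<^esub> w') = zxw x w \<oplus>\<^bsub>Z\<^esub> zxw x w'"
  using XW.T.tens_add_left[of x x' w] XW.T.tens_add_right[of x w w'] by (simp_all add: zed_xw_def Z_simps)

lemma zed_wx_add:
  "\<lbrakk>w \<in> carrier Om; w' \<in> carrier Om; x \<in> carrier X\<rbrakk> \<Longrightarrow>
    zwx (w \<oplus>\<^bsub>Om\<^esub> w') x = zwx w x \<oplus>\<^bsub>Z\<^esub> zwx w' x"
  "\<lbrakk>w \<in> carrier Om; x \<in> carrier X; x' \<in> carrier X\<rbrakk> \<Longrightarrow>
    zwx w (x \<oplus>\<^bsub>X\<^esub> x') = zwx w x \<oplus>\<^bsub>Z\<^esub> zwx w x'"
  using WX.T.tens_add_left[of w w' x] WX.T.tens_add_right[of w x x'] by (simp_all add: zed_wx_def Z_simps)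

text \<open>Each law is inherited from the layer that imposed it: those of \<open>hel\<close> and
  \<open>hbar\<close> from the enveloping algebra, the actions from the tensor algebra, the four
  contractions from \<open>H_relators\<close>.\<close>

lemma H_relations_H: "H_relations K A Om X D H hel hbar hxw hwx"
proof -
  let ?c = "hcls"
  note cadd = additive_map_add[OF H_cls_additive] and cmult = ring_hom_mult[OF H_cls_hom]
  note tcl = tz_env_closed tz_xw_closed tz_wx_closed
  note defs = H_el_def H_bar_def H_xw_def H_wx_def
  note sadd = additive_map_add[OF additive_map_ring_hom[OF ta.tsc_hom]]
  note vadd = additive_map_add[OF ta.tvec_additive]
  have cone: "?c (tenv \<one>\<^bsub>A\<^esub> \<one>\<^bsub>A\<^esub>) = \<one>\<^bsub>H\<^esub>"
    using ring_hom_one[OF H_cls_hom] ring_hom_one[OF ta.tsc_hom] by (simp add: tz_env_def Om.env_one)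
  have el_hom: "hel \<in> ring_hom A H"
  proof (rule ring_hom_memI)
    fix a b assume ab: "a \<in> carrier A" "b \<in> carrier A"
    show "hel (a \<otimes>\<^bsub>A\<^esub> b) = hel a \<otimes>\<^bsub>H\<^esub> hel b"
      using ab unfolding defs by (simp add: cmult[symmetric] tcl)
        (simp add: tz_env_def ring_hom_mult[OF ta.tsc_hom, symmetric] Om.env_closed Om.env_mult)
    show "hel (a \<oplus>\<^bsub>A\<^esub> b) = hel a \<oplus>\<^bsub>H\<^esub> hel b"
      using ab unfolding defs by (simp add: cadd[symmetric] tcl)
        (simp add: tz_env_def sadd[symmetric] Om.env_closed additive_map_add[OF Om.env_additive_left])
  qed (simp_all add: hel_closed, simp add: H_el_def cone)
  have bar_hom: "hbar \<in> ring_hom A (opp H)"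
  proof (rule ring_hom_memI)
    fix a b assume ab: "a \<in> carrier A" "b \<in> carrier A"
    show "hbar (a \<otimes>\<^bsub>A\<^esub> b) = hbar a \<otimes>\<^bsub>opp H\<^esub> hbar b"
      using ab unfolding defs by (simp add: cmult[symmetric] tcl)
        (simp add: tz_env_def ring_hom_mult[OF ta.tsc_hom, symmetric] Om.env_closed Om.env_mult)
    show "hbar (a \<oplus>\<^bsub>A\<^esub> b) = hbar a \<oplus>\<^bsub>opp H\<^esub> hbar b"
      using ab unfolding defs by (simp add: cadd[symmetric] tcl)
        (simp add: tz_env_def sadd[symmetric] Om.env_closed additive_map_add[OF Om.env_additive_right])
  qed (simp_all add: hbar_closed, simp add: H_bar_def cone)
  have act: "hel a \<otimes>\<^bsub>H\<^esub> hxw x w = hxw (a \<triangleright>\<^bsub>X\<^esub> x) w" "hxw x w \<otimes>\<^bsub>H\<^esub> hel a = hxw (x \<triangleleft>\<^bsub>X\<^esub> a) w"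
    "hbar a \<otimes>\<^bsub>H\<^esub> hxw x w = hxw x (w \<triangleleft>\<^bsub>Om\<^esub> a)" "hxw x w \<otimes>\<^bsub>H\<^esub> hbar a = hxw x (a \<triangleright>\<^bsub>Om\<^esub> w)"
    "hel a \<otimes>\<^bsub>H\<^esub> hwx w x = hwx (a \<triangleright>\<^bsub>Om\<^esub> w) x" "hwx w x \<otimes>\<^bsub>H\<^esub> hel a = hwx (w \<triangleleft>\<^bsub>Om\<^esub> a) x"
    "hbar a \<otimes>\<^bsub>H\<^esub> hwx w x = hwx w (x \<triangleleft>\<^bsub>X\<^esub> a)" "hwx w x \<otimes>\<^bsub>H\<^esub> hbar a = hwx w (a \<triangleright>\<^bsub>X\<^esub> x)"
    if "a \<in> carrier A" "x \<in> carrier X" "w \<in> carrier Om" for a x w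
    using that unfolding defs
    by (simp_all add: cmult[symmetric] tcl)
      (simp_all add: tz_env_def tz_xw_def tz_wx_def ta.tvec_lact[symmetric] ta.tvec_ract[symmetric]
        Om.env_closed zed_xw_closed zed_wx_closed zed_actions
        X.lact_one X.ract_one Om.lact_one Om.ract_one)
  have comm: "hel a \<otimes>\<^bsub>H\<^esub> hbar b = hbar b \<otimes>\<^bsub>H\<^esub> hel a" if "a \<in> carrier A" "b \<in> carrier A" for a b
    using that unfolding defs by (simp add: cmult[symmetric] tcl)
      (simp add: tz_env_def ring_hom_mult[OF ta.tsc_hom, symmetric] Om.env_closed Om.env_mult)
  have scal: "hel (scalar A k) = hbar (scalar A k)" if "k \<in> carrier K" for k
    using that by (simp add: defs tz_env_def Om.env_scalar)
  note add_simps = defs tz_xw_def tz_wx_def cadd[symmetric] vadd[symmetric] ta.tvec_closed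
    zed_xw_closed zed_wx_closed zed_xw_add zed_wx_add
  have add1: "additive_map X H (\<lambda>x. hxw x w)" if "w \<in> carrier Om" for w
    by (rule additive_mapI) (use that in \<open>simp_all add: hxw_closed\<close>, use that in \<open>simp add: add_simps\<close>)
  have add2: "additive_map Om H (\<lambda>w. hxw x w)" if "x \<in> carrier X" for x
    by (rule additive_mapI) (use that in \<open>simp_all add: hxw_closed\<close>, use that in \<open>simp add: add_simps\<close>)
  have add3: "additive_map Om H (\<lambda>w. hwx w x)" if "x \<in> carrier X" for x
    by (rule additive_mapI) (use that in \<open>simp_all add: hwx_closed\<close>, use that in \<open>simp add: add_simps\<close>)
  have add4: "additive_map X H (\<lambda>x. hwx w x)" if "w \<in> carrier Om" for w
    by (rule additive_mapI) (use that in \<open>simp_all add: hwx_closed\<close>, use that in \<open>simp add: add_simps\<close>)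
  have csum: "?c (\<Oplus>\<^bsub>ta.TA\<^esub>i\<in>{..<n}. f i \<otimes>\<^bsub>ta.TA\<^esub> g i) = (\<Oplus>\<^bsub>H\<^esub>i\<in>{..<n}. ?c (f i) \<otimes>\<^bsub>H\<^esub> ?c (g i))"
    if "\<And>i. i < n \<Longrightarrow> f i \<in> carrier ta.TA" "\<And>i. i < n \<Longrightarrow> g i \<in> carrier ta.TA" for f g and n :: nat
  proof -
    have "?c (\<Oplus>\<^bsub>ta.TA\<^esub>i\<in>{..<n}. f i \<otimes>\<^bsub>ta.TA\<^esub> g i) = (\<Oplus>\<^bsub>H\<^esub>i\<in>{..<n}. ?c (f i \<otimes>\<^bsub>ta.TA\<^esub> g i))"
      by (rule additive_map_finsum[OF ta.TA.is_abelian_group H.is_abelian_group H_cls_additive])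
        (use that in auto)
    also have "\<dots> = (\<Oplus>\<^bsub>H\<^esub>i\<in>{..<n}. ?c (f i) \<otimes>\<^bsub>H\<^esub> ?c (g i))"
      by (rule H.finsum_cong') (use that additive_map_closed[OF H_cls_additive] in \<open>auto simp: cmult\<close>)
    finally show ?thesis .
  qed
  have rel: "(\<Oplus>\<^bsub>H\<^esub>i\<in>{..<n}. ?c (f i) \<otimes>\<^bsub>H\<^esub> ?c (g i)) = ?c u"
    if "(\<Oplus>\<^bsub>ta.TA\<^esub>i\<in>{..<n}. f i \<otimes>\<^bsub>ta.TA\<^esub> g i) \<ominus>\<^bsub>ta.TA\<^esub> u \<in> hrels"
      "\<And>i. i < n \<Longrightarrow> f i \<in> carrier ta.TA" "\<And>i. i < n \<Longrightarrow> g i \<in> carrier ta.TA" "u \<in> carrier ta.TA" for f g u and n :: nat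
  proof -
    have "?c (\<Oplus>\<^bsub>ta.TA\<^esub>i\<in>{..<n}. f i \<otimes>\<^bsub>ta.TA\<^esub> g i) = ?c u"
      by (rule H_cls_relator[OF that(1) _ that(4)]) (use that(2,3) in \<open>auto intro!: ta.TA.finsum_closed\<close>)
    moreover have "?c (\<Oplus>\<^bsub>ta.TA\<^esub>i\<in>{..<n}. f i \<otimes>\<^bsub>ta.TA\<^esub> g i) = (\<Oplus>\<^bsub>H\<^esub>i\<in>{..<n}. ?c (f i) \<otimes>\<^bsub>H\<^esub> ?c (g i))"
      by (rule csum) (fact that(2,3))+
    ultimately show ?thesis by simp
  qed
  have rels: "(\<Oplus>\<^bsub>H\<^esub>i\<in>{..<coev_len D}. hwx (coev_w D i) x \<otimes>\<^bsub>H\<^esub> hxw (coev_x D i) w) = hbar (evu D w x)"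
    "(\<Oplus>\<^bsub>H\<^esub>j\<in>{..<coevu_len D}. hxw x (coevu_r D j) \<otimes>\<^bsub>H\<^esub> hwx w (coevu_y D j)) = hel (ev D x w)"
    "(\<Oplus>\<^bsub>H\<^esub>j\<in>{..<coevu_len D}. hxw (coevu_y D j) w \<otimes>\<^bsub>H\<^esub> hwx (coevu_r D j) x) = hbar (ev D x w)"
    "(\<Oplus>\<^bsub>H\<^esub>i\<in>{..<coev_len D}. hwx w (coev_x D i) \<otimes>\<^bsub>H\<^esub> hxw x (coev_w D i)) = hel (evu D w x)"
    if "x \<in> carrier X" "w \<in> carrier Om" for x w
  proof -
    note tcl' = tcl coev_closed coevu_closed ev_closed evu_closed that
    show "(\<Oplus>\<^bsub>H\<^esub>i\<in>{..<coev_len D}. hwx (coev_w D i) x \<otimes>\<^bsub>H\<^esub> hxw (coev_x D i) w) = hbar (evu D w x)"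
      unfolding defs
      by (rule rel, unfold H_relators_def Let_def tz_def, rule UN_I[OF that(1)], rule UN_I[OF that(2)], rule insertI1)
        (simp_all add: tcl')
    show "(\<Oplus>\<^bsub>H\<^esub>j\<in>{..<coevu_len D}. hxw x (coevu_r D j) \<otimes>\<^bsub>H\<^esub> hwx w (coevu_y D j)) = hel (ev D x w)"
      unfolding defs
      by (rule rel, unfold H_relators_def Let_def tz_def, rule UN_I[OF that(1)], rule UN_I[OF that(2)],
          rule insertI2, rule insertI1) (simp_all add: tcl')
    show "(\<Oplus>\<^bsub>H\<^esub>j\<in>{..<coevu_len D}. hxw (coevu_y D j) w \<otimes>\<^bsub>H\<^esub> hwx (coevu_r D j) x) = hbar (ev D x w)"
      unfolding defs
      by (rule rel, unfold H_relators_def Let_def tz_def, rule UN_I[OF that(1)], rule UN_I[OF that(2)],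
          rule insertI2, rule insertI2, rule insertI1) (simp_all add: tcl')
    show "(\<Oplus>\<^bsub>H\<^esub>i\<in>{..<coev_len D}. hwx w (coev_x D i) \<otimes>\<^bsub>H\<^esub> hxw x (coev_w D i)) = hel (evu D w x)"
      unfolding defs
      by (rule rel, unfold H_relators_def Let_def tz_def, rule UN_I[OF that(1)], rule UN_I[OF that(2)],
          rule insertI2, rule insertI2, rule insertI2, rule insertI1) (simp_all add: tcl')
  qed
  show ?thesis
    by (intro H_relations.intro H_relations_axioms.intro dual_bimodules_axioms ring_H)
      (fact el_hom bar_hom comm scal add1 add2 add3 add4 act rels)+
qed

end

text \<open>Exchanging the two bimodules also exchanges the two dualities, and the relations of \<open>H\<close> are
  invariant under this. So each computation below is done for one of the two kinds of generators only.\<close>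

definition swap_dual :: "('a, 'w, 'x) dual_data \<Rightarrow> ('a, 'x, 'w) dual_data" where
  "swap_dual D = \<lparr>ev = evu D, evu = ev D, coev_len = coevu_len D, coev_w = coevu_y D, coev_x = coevu_r D,
     coevu_len = coev_len D, coevu_y = coev_w D, coevu_r = coev_x D\<rparr>"

lemma swap_dual_simps [simp]:
  "ev (swap_dual D) = evu D" "evu (swap_dual D) = ev D"
  "coev_len (swap_dual D) = coevu_len D" "coev_w (swap_dual D) = coevu_y D" "coev_x (swap_dual D) = coevu_r D"
  "coevu_len (swap_dual D) = coev_len D" "coevu_y (swap_dual D) = coev_w D" "coevu_r (swap_dual D) = coev_x D"
  by (simp_all add: swap_dual_def)

lemma (in dual_bimodules) dual_bimodules_swap: "dual_bimodules K A X Om (swap_dual D)"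
  by (intro dual_bimodules.intro dual_bimodules_axioms.intro X.algebra_bimodule_axioms Om.algebra_bimodule_axioms)
    (use pivotal_dual in \<open>auto simp: pivotal_dual_def simp del: split_paired_All\<close>)

lemma additive_map_opp: "additive_map G (opp R) f \<longleftrightarrow> additive_map G R f"
  by (simp add: additive_map_def)

context H_relations
begin

lemma H_relations_swap: "H_relations K A X Om (swap_dual D) B el bar wx xw"
  by (intro H_relations.intro H_relations_axioms.intro dual_bimodules_swap B.ring_axioms;
      (unfold swap_dual_simps)?)
    (fact el bar | erule (1) el_bar | erule el_scalar | erule xw_left xw_right wx_left wx_right
      | rule el_xw xw_el bar_xw xw_bar el_wx wx_el bar_wx wx_bar
        wx_xw_coev xw_wx_coevu xw_wx_coevu' wx_xw_coev'; assumption)+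

text \<open>Reversing products while exchanging letters interchanges \<open>wx_xw_coev\<close> with
  \<open>wx_xw_coev'\<close> and \<open>xw_wx_coevu\<close> with \<open>xw_wx_coevu'\<close>. The
  action laws are permuted as well; for instance \<open>el_xw\<close> becomes
  \<open>wx_bar\<close>.\<close>

lemma H_relations_opp: "H_relations K A Om X D (opp B) bar el (\<lambda>x w. wx w x) (\<lambda>w x. xw x w)"
proof -
  have el': "el \<in> ring_hom A (opp (opp B))" using el by (simp add: opp_def)
  show ?thesis
    by (intro H_relations.intro H_relations_axioms.intro dual_bimodules_axioms ring_opp B.ring_axioms;
        (unfold mult_opp finsum_opp additive_map_opp)?)
      (fact bar el' | erule (1) el_bar | erule el_scalar[symmetric]
        | erule xw_left xw_right wx_left wx_right
        | rule el_xw xw_el bar_xw xw_bar el_wx wx_el bar_wx wx_bar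
          wx_xw_coev xw_wx_coevu xw_wx_coevu' wx_xw_coev'; assumption)+
qed

end

section \<open>Operators on the tensor square\<close>

text \<open>Restriction to the carrier makes agreement there the same as equality, as the ring
  axioms need.\<close>

definition endo_ring :: "('a, 'c) ring_scheme \<Rightarrow> ('a \<Rightarrow> 'a) ring" where
  "endo_ring G = \<lparr>carrier = {f \<in> extensional (carrier G). additive_map G G f},
     monoid.mult = (\<lambda>f g. \<lambda>x\<in>carrier G. f (g x)), one = (\<lambda>x\<in>carrier G. x),
     ring.zero = (\<lambda>x\<in>carrier G. \<zero>\<^bsub>G\<^esub>), ring.add = (\<lambda>f g. \<lambda>x\<in>carrier G. f x \<oplus>\<^bsub>G\<^esub> g x)\<rparr>"

lemma endo_ring_simps:
  "f \<in> carrier (endo_ring G) \<longleftrightarrow> f \<in> extensional (carrier G) \<and> additive_map G G f"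
  "x \<in> carrier G \<Longrightarrow> (f \<otimes>\<^bsub>endo_ring G\<^esub> g) x = f (g x)"
  "x \<in> carrier G \<Longrightarrow> (f \<oplus>\<^bsub>endo_ring G\<^esub> g) x = f x \<oplus>\<^bsub>G\<^esub> g x"
  "x \<in> carrier G \<Longrightarrow> \<one>\<^bsub>endo_ring G\<^esub> x = x"
  "x \<in> carrier G \<Longrightarrow> \<zero>\<^bsub>endo_ring G\<^esub> x = \<zero>\<^bsub>G\<^esub>"
  by (simp_all add: endo_ring_def)

lemma endo_closed: "\<lbrakk>f \<in> carrier (endo_ring G); x \<in> carrier G\<rbrakk> \<Longrightarrow> f x \<in> carrier G"
  by (auto simp: endo_ring_simps additive_map_closed)

lemma endo_eqI:
  assumes "f \<in> extensional (carrier G)" "g \<in> extensional (carrier G)" "\<And>x. x \<in> carrier G \<Longrightarrow> f x = g x"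
  shows "f = g"
  using assms by (rule extensionalityI)

lemma (in abelian_group) ring_endo_ring: "ring (endo_ring G)"
proof -
  have ext: "f \<otimes>\<^bsub>endo_ring G\<^esub> g \<in> extensional (carrier G)" "f \<oplus>\<^bsub>endo_ring G\<^esub> g \<in> extensional (carrier G)"
    "\<one>\<^bsub>endo_ring G\<^esub> \<in> extensional (carrier G)" "\<zero>\<^bsub>endo_ring G\<^esub> \<in> extensional (carrier G)" for f g
    by (simp_all add: endo_ring_def)
  note cl = additive_map_closed[where G = G and H = G] and add = additive_map_add[where G = G and H = G]
  have mult_cl: "f \<otimes>\<^bsub>endo_ring G\<^esub> g \<in> carrier (endo_ring G)"
    if "f \<in> carrier (endo_ring G)" "g \<in> carrier (endo_ring G)" for f g
    using that by (auto simp: endo_ring_simps ext cl add intro!: additive_mapI)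
  have add_cl: "f \<oplus>\<^bsub>endo_ring G\<^esub> g \<in> carrier (endo_ring G)"
    if "f \<in> carrier (endo_ring G)" "g \<in> carrier (endo_ring G)" for f g
    using that by (auto simp: endo_ring_simps ext cl add a_ac intro!: additive_mapI)
  have one_cl: "\<one>\<^bsub>endo_ring G\<^esub> \<in> carrier (endo_ring G)" and zero_cl: "\<zero>\<^bsub>endo_ring G\<^esub> \<in> carrier (endo_ring G)"
    by (auto simp: endo_ring_simps ext intro!: additive_mapI)
  have e: "f \<in> carrier (endo_ring G) \<Longrightarrow> f \<in> extensional (carrier G)" for f
    by (simp add: endo_ring_simps)
  show ?thesis
  proof (rule ringI)
    show "abelian_group (endo_ring G)"
    proof (rule abelian_groupI)
      fix f assume f: "f \<in> carrier (endo_ring G)"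
      define g where "g = (\<lambda>x\<in>carrier G. \<ominus> f x)"
      have "g \<in> carrier (endo_ring G)"
        using f by (auto simp: endo_ring_simps g_def cl add minus_add intro!: additive_mapI)
      moreover have "g \<oplus>\<^bsub>endo_ring G\<^esub> f = \<zero>\<^bsub>endo_ring G\<^esub>"
        by (rule endo_eqI[where G = G]) (use f in \<open>simp_all add: ext endo_ring_simps g_def cl l_neg\<close>)
      ultimately show "\<exists>g\<in>carrier (endo_ring G). g \<oplus>\<^bsub>endo_ring G\<^esub> f = \<zero>\<^bsub>endo_ring G\<^esub>" by blast
    qed (auto intro!: endo_eqI[where G = G] simp: add_cl zero_cl ext e endo_closed endo_ring_simps(3,5) a_ac)
    show "Group.monoid (endo_ring G)"
      by (rule monoidI)
        (auto intro!: endo_eqI[where G = G] simp: mult_cl one_cl ext e endo_closed endo_ring_simps(2,4))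
  qed (auto intro!: endo_eqI[where G = G] simp: ext e endo_closed endo_ring_simps(2,3) add_cl mult_cl,
      simp add: endo_ring_simps endo_closed add)
qed

lemma (in abelian_group) endo_finsum:
  assumes "finite I" "\<And>i. i \<in> I \<Longrightarrow> f i \<in> carrier (endo_ring G)" "x \<in> carrier G"
  shows "(\<Oplus>\<^bsub>endo_ring G\<^esub>i\<in>I. f i) x = (\<Oplus>i\<in>I. f i x)"
proof -
  interpret R: ring "endo_ring G" by (rule ring_endo_ring)
  show ?thesis
    using assms(1,2)
    by (induction I rule: finite_induct)
      (simp_all add: endo_ring_simps(3,5) assms(3) Pi_def endo_closed)
qed

context H_relations
begin

abbreviation "M \<equiv> bar_bimod B el bar"
abbreviation "P \<equiv> tensor A M M"
abbreviation tn :: "'b \<Rightarrow> 'b \<Rightarrow> ('b \<times> 'b \<Rightarrow>\<^sub>0 int) set" (infixl \<open>\<diamondop>\<close> 68)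
  where "tn \<equiv> tens A M M"

lemma M_simps [simp]:
  "carrier M = carrier B" "x \<oplus>\<^bsub>M\<^esub> y = x \<oplus> y" "\<zero>\<^bsub>M\<^esub> = \<zero>"
  "a \<triangleright>\<^bsub>M\<^esub> x = el a \<otimes> x" "x \<triangleleft>\<^bsub>M\<^esub> a = bar a \<otimes> x"
  by (simp_all add: bar_bimod_def)

lemma additive_map_M [simp]: "additive_map M G f \<longleftrightarrow> additive_map B G f"
  by (simp add: additive_map_def)

lemma tensor_pair_M: "tensor_pair A M M"
proof -
  have "abelian_group M"
    by (rule abelian_group_cong[OF B.is_abelian_group]) (simp_all add: bar_bimod_def)
  then show ?thesis
    by (intro tensor_pair.intro) (simp_all add: el_closed bar_closed)
qed

sublocale P: tensor_pair A M M by (rule tensor_pair_M)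
sublocale P: abelian_group P by (rule P.abelian_group_tensor)

lemmas tn_closed [simp] = P.tens_closed[simplified]
lemmas tn_balanced = P.tens_balanced[simplified]
lemmas tn_left = P.tens_additive_left[simplified]
lemmas tn_right = P.tens_additive_right[simplified]
lemmas P_lift = P.tensor_lift[simplified]

lemma P_eqI:
  assumes "additive_map P P f" "additive_map P P g"
    and "\<And>m n. \<lbrakk>m \<in> carrier B; n \<in> carrier B\<rbrakk> \<Longrightarrow> f (m \<diamondop> n) = g (m \<diamondop> n)"
    and "p \<in> carrier P"
  shows "f p = g p"
  using P.tensor_additive_eqI[OF P.abelian_group_axioms assms(1,2) _ assms(4)] assms(3) by simp

lemma tn_sum_left:
  assumes "\<And>i. i < n \<Longrightarrow> f i \<in> carrier B" "g \<in> carrier B" "h \<in> carrier B"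
  shows "((\<Oplus>i\<in>{..<n}. f i) \<otimes> g) \<diamondop> h = (\<Oplus>\<^bsub>P\<^esub>i\<in>{..<n::nat}. (f i \<otimes> g) \<diamondop> h)"
  using additive_map_finsum[OF B.is_abelian_group P.abelian_group_axioms
      additive_map_comp[OF B.additive_map_mult_right[OF assms(2)] tn_left[OF assms(3)]], of "{..<n}" f] assms
  by auto

lemma tn_sum_right:
  assumes "\<And>i. i < n \<Longrightarrow> f i \<in> carrier B" "g \<in> carrier B" "h \<in> carrier B"
  shows "h \<diamondop> ((\<Oplus>i\<in>{..<n}. f i) \<otimes> g) = (\<Oplus>\<^bsub>P\<^esub>i\<in>{..<n::nat}. h \<diamondop> (f i \<otimes> g))"
  using additive_map_finsum[OF B.is_abelian_group P.abelian_group_axioms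
      additive_map_comp[OF B.additive_map_mult_right[OF assms(2)] tn_right[OF assms(3)]], of "{..<n}" f] assms
  by auto

text \<open>Left multiplication by \<open>\<Sum>i<n. u i \<otimes> v i\<close> on the tensor square. It is well defined only
  under the Takeuchi condition \<open>takeuchi\<close>.\<close>

definition lmul_on :: "nat \<Rightarrow> (nat \<Rightarrow> 'b) \<Rightarrow> (nat \<Rightarrow> 'b) \<Rightarrow> ('b \<times> 'b \<Rightarrow>\<^sub>0 int) set \<Rightarrow> ('b \<times> 'b \<Rightarrow>\<^sub>0 int) set" where
  "lmul_on n u v = restrict (SOME \<phi>. additive_map P P \<phi> \<and>
     (\<forall>x\<in>carrier B. \<forall>y\<in>carrier B. \<phi> (x \<diamondop> y) = (\<Oplus>\<^bsub>P\<^esub>i\<in>{..<n}. (u i \<otimes> x) \<diamondop> (v i \<otimes> y)))) (carrier P)"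

text \<open>The usual condition is the case of \<open>x\<close> and \<open>y\<close> equal to one.
  Quantifying over both gives the form in which balancedness of left multiplication is used, without
  right multiplication on the tensor square.\<close>

definition takeuchi :: "nat \<Rightarrow> (nat \<Rightarrow> 'b) \<Rightarrow> (nat \<Rightarrow> 'b) \<Rightarrow> bool" where
  "takeuchi n u v \<longleftrightarrow> (\<forall>i<n. u i \<in> carrier B \<and> v i \<in> carrier B) \<and>
     (\<forall>s\<in>carrier A. \<forall>x\<in>carrier B. \<forall>y\<in>carrier B.
        (\<Oplus>\<^bsub>P\<^esub>i\<in>{..<n}. (u i \<otimes> (bar s \<otimes> x)) \<diamondop> (v i \<otimes> y))
      = (\<Oplus>\<^bsub>P\<^esub>i\<in>{..<n}. (u i \<otimes> x) \<diamondop> (v i \<otimes> (el s \<otimes> y))))"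

lemma takeuchi_closed: "\<lbrakk>takeuchi n u v; i < n\<rbrakk> \<Longrightarrow> u i \<in> carrier B" "\<lbrakk>takeuchi n u v; i < n\<rbrakk> \<Longrightarrow> v i \<in> carrier B"
  by (auto simp: takeuchi_def)

lemma
  assumes t: "takeuchi n u v"
  shows lmul_on_endo: "lmul_on n u v \<in> carrier (endo_ring P)"
    and lmul_on_tens: "\<And>x y. \<lbrakk>x \<in> carrier B; y \<in> carrier B\<rbrakk> \<Longrightarrow>
      lmul_on n u v (x \<diamondop> y) = (\<Oplus>\<^bsub>P\<^esub>i\<in>{..<n}. (u i \<otimes> x) \<diamondop> (v i \<otimes> y))"
proof -
  note cl = takeuchi_closed[OF t]
  let ?h = "\<lambda>x y. \<Oplus>\<^bsub>P\<^esub>i\<in>{..<n}. (u i \<otimes> x) \<diamondop> (v i \<otimes> y)"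
  have l: "additive_map B P (\<lambda>x. ?h x y)" if "y \<in> carrier B" for y
    by (rule P.additive_map_finsum_fun[OF B.abelian_monoid_axioms])
      (auto intro!: additive_map_comp[OF B.additive_map_mult_left tn_left] cl that)
  have r: "additive_map B P (\<lambda>y. ?h x y)" if "x \<in> carrier B" for x
    by (rule P.additive_map_finsum_fun[OF B.abelian_monoid_axioms])
      (auto intro!: additive_map_comp[OF B.additive_map_mult_left tn_right] cl that)
  have b: "?h (bar s \<otimes> x) y = ?h x (el s \<otimes> y)" if "x \<in> carrier B" "s \<in> carrier A" "y \<in> carrier B" for x s y
    using t that by (simp add: takeuchi_def)
  obtain \<phi> where "additive_map P P \<phi>" "\<And>x y. \<lbrakk>x \<in> carrier B; y \<in> carrier B\<rbrakk> \<Longrightarrow> \<phi> (x \<diamondop> y) = ?h x y"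
    using P_lift[OF P.abelian_group_axioms l r b] by blast
  then have ex: "\<exists>\<phi>. additive_map P P \<phi> \<and> (\<forall>x\<in>carrier B. \<forall>y\<in>carrier B. \<phi> (x \<diamondop> y) = ?h x y)"
    by blast
  define \<psi> where "\<psi> = (SOME \<phi>. additive_map P P \<phi> \<and> (\<forall>x\<in>carrier B. \<forall>y\<in>carrier B. \<phi> (x \<diamondop> y) = ?h x y))"
  have \<psi>: "additive_map P P \<psi>" "\<And>x y. \<lbrakk>x \<in> carrier B; y \<in> carrier B\<rbrakk> \<Longrightarrow> \<psi> (x \<diamondop> y) = ?h x y"
    using someI_ex[OF ex] unfolding \<psi>_def by auto
  have L: "lmul_on n u v = restrict \<psi> (carrier P)"
    by (simp add: lmul_on_def \<psi>_def)
  show "lmul_on n u v \<in> carrier (endo_ring P)"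
    using \<psi>(1) by (auto simp: L endo_ring_simps additive_map_def)
  show "lmul_on n u v (x \<diamondop> y) = ?h x y" if "x \<in> carrier B" "y \<in> carrier B" for x y
    using that by (simp add: L \<psi>)
qed

lemma endo_additive: "f \<in> carrier (endo_ring P) \<Longrightarrow> additive_map P P f"
  by (simp add: endo_ring_simps)

lemma endo_ext: "f \<in> carrier (endo_ring P) \<Longrightarrow> f \<in> extensional (carrier P)"
  by (simp add: endo_ring_simps)

lemma endo_P_eqI:
  assumes f: "f \<in> carrier (endo_ring P)" and g: "g \<in> carrier (endo_ring P)"
    and eq: "\<And>m n. \<lbrakk>m \<in> carrier B; n \<in> carrier B\<rbrakk> \<Longrightarrow> f (m \<diamondop> n) = g (m \<diamondop> n)"
  shows "f = g"
  by (rule endo_eqI[OF endo_ext[OF f] endo_ext[OF g]])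
    (rule P_eqI[OF endo_additive[OF f] endo_additive[OF g] eq])

lemma lmul_on_sum:
  assumes t: "takeuchi n u v" and "\<And>k. k < m \<Longrightarrow> f k \<in> carrier B" "\<And>k. k < m \<Longrightarrow> g k \<in> carrier B"
  shows "lmul_on n u v (\<Oplus>\<^bsub>P\<^esub>k\<in>{..<m::nat}. f k \<diamondop> g k)
    = (\<Oplus>\<^bsub>P\<^esub>k\<in>{..<m}. \<Oplus>\<^bsub>P\<^esub>i\<in>{..<n}. (u i \<otimes> f k) \<diamondop> (v i \<otimes> g k))"
proof -
  have "lmul_on n u v (\<Oplus>\<^bsub>P\<^esub>k\<in>{..<m}. f k \<diamondop> g k) = (\<Oplus>\<^bsub>P\<^esub>k\<in>{..<m}. lmul_on n u v (f k \<diamondop> g k))"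
    by (rule additive_map_finsum[OF P.abelian_group_axioms P.abelian_group_axioms endo_additive[OF lmul_on_endo[OF t]]])
      (use assms in auto)
  also have "\<dots> = (\<Oplus>\<^bsub>P\<^esub>k\<in>{..<m}. \<Oplus>\<^bsub>P\<^esub>i\<in>{..<n}. (u i \<otimes> f k) \<diamondop> (v i \<otimes> g k))"
    by (rule P.finsum_cong')
      (use assms takeuchi_closed[OF t] in \<open>auto simp: lmul_on_tens intro!: P.finsum_closed\<close>)
  finally show ?thesis .
qed

definition "el_mul a = lmul_on 1 (\<lambda>_. el a) (\<lambda>_. \<one>)"
definition "bar_mul a = lmul_on 1 (\<lambda>_. \<one>) (\<lambda>_. bar a)"
definition "xw_mul x w = lmul_on (coev_len D) (\<lambda>i. xw x (coev_w D i)) (\<lambda>i. xw (coev_x D i) w)"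
definition "wx_mul w x = lmul_on (coevu_len D) (\<lambda>j. wx w (coevu_y D j)) (\<lambda>j. wx (coevu_r D j) x)"

lemma sum_lessThan_1: "f 0 \<in> carrier P \<Longrightarrow> (\<Oplus>\<^bsub>P\<^esub>i\<in>{..<1::nat}. f i) = f 0"
  by (simp add: lessThan_Suc)

lemma takeuchi_el: "a \<in> carrier A \<Longrightarrow> takeuchi 1 (\<lambda>_. el a) (\<lambda>_. \<one>)"
  unfolding takeuchi_def
  by (simp add: sum_lessThan_1 el_closed bar_closed B.m_assoc[symmetric] el_bar)
    (simp add: B.m_assoc el_closed bar_closed tn_balanced)

lemma takeuchi_bar: "a \<in> carrier A \<Longrightarrow> takeuchi 1 (\<lambda>_. \<one>) (\<lambda>_. bar a)"
  unfolding takeuchi_def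
  by (simp add: sum_lessThan_1 el_closed bar_closed B.m_assoc[symmetric] el_bar[symmetric])
    (simp add: B.m_assoc el_closed bar_closed tn_balanced)

text \<open>Centrality of coev(1) lets \<open>s\<close> pass from the dual basis vector in the first
  factor to the one in the second. To use it, the sum is recognised as the image of coev(1) under a
  map on \<open>tensor A Om X\<close>.\<close>

lemma takeuchi_xw:
  assumes x: "x \<in> carrier X" and w: "w \<in> carrier Om"
  shows "takeuchi (coev_len D) (\<lambda>i. xw x (coev_w D i)) (\<lambda>i. xw (coev_x D i) w)"
  unfolding takeuchi_def
proof (intro conjI allI impI ballI)
  fix s g h assume s: "s \<in> carrier A" and g: "g \<in> carrier B" and h: "h \<in> carrier B"
  interpret OX: tensor_pair A Om X
    by (intro tensor_pair.intro Om.M.abelian_group_axioms X.M.abelian_group_axioms)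
      (simp_all add: Om.ract_closed X.lact_closed)
  let ?k = "\<lambda>w' x'. (xw x w' \<otimes> g) \<diamondop> (xw x' w \<otimes> h)"
  have l: "additive_map Om P (\<lambda>w'. ?k w' x')" if "x' \<in> carrier X" for x'
    by (rule additive_map_comp[OF additive_map_comp[OF xw_right[OF x] B.additive_map_mult_right[OF g]] tn_left])
      (simp add: that w h xw_closed)
  have r: "additive_map X P (\<lambda>x'. ?k w' x')" if "w' \<in> carrier Om" for w'
    by (rule additive_map_comp[OF additive_map_comp[OF xw_left[OF w] B.additive_map_mult_right[OF h]] tn_right])
      (simp add: that x g xw_closed)
  \<comment> \<open>The relation crossed here is that of the tensor square: \<open>r\<close> leaves
    the first factor as \<open>bar r\<close> and enters the second as \<open>el r\<close>.\<close>
  have b: "?k (w' \<triangleleft>\<^bsub>Om\<^esub> r) x' = ?k w' (r \<triangleright>\<^bsub>X\<^esub> x')" if "w' \<in> carrier Om" "r \<in> carrier A" "x' \<in> carrier X" for w' r x'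
    using that x w g h
    by (simp add: bar_xw[symmetric] el_xw[symmetric] B.m_assoc xw_closed bar_closed el_closed tn_balanced)
  obtain \<phi> where \<phi>: "additive_map (tensor A Om X) P \<phi>"
    "\<And>w' x'. \<lbrakk>w' \<in> carrier Om; x' \<in> carrier X\<rbrakk> \<Longrightarrow> \<phi> (tens A Om X w' x') = ?k w' x'"
    using OX.tensor_lift[OF P.abelian_group_axioms l r b] by blast
  note \<phi>_sum = additive_map_finsum[OF OX.abelian_group_tensor P.abelian_group_axioms \<phi>(1) finite_lessThan]
  have "(\<Oplus>\<^bsub>P\<^esub>i\<in>{..<coev_len D}. (xw x (coev_w D i) \<otimes> (bar s \<otimes> g)) \<diamondop> (xw (coev_x D i) w \<otimes> h))
      = (\<Oplus>\<^bsub>P\<^esub>i\<in>{..<coev_len D}. \<phi> (tens A Om X (s \<triangleright>\<^bsub>Om\<^esub> coev_w D i) (coev_x D i)))"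
    by (rule P.finsum_cong')
      (use s g h x w in \<open>auto simp: \<phi> coev_closed Om.lact_closed xw_closed xw_bar[symmetric] bar_closed B.m_assoc\<close>)
  also have "\<dots> = \<phi> (\<Oplus>\<^bsub>tensor A Om X\<^esub>i\<in>{..<coev_len D}. tens A Om X (s \<triangleright>\<^bsub>Om\<^esub> coev_w D i) (coev_x D i))"
    by (rule \<phi>_sum[symmetric]) (use s in \<open>auto simp: coev_closed Om.lact_closed intro!: OX.tens_closed\<close>)
  also have "\<dots> = \<phi> (\<Oplus>\<^bsub>tensor A Om X\<^esub>i\<in>{..<coev_len D}. tens A Om X (coev_w D i) (coev_x D i \<triangleleft>\<^bsub>X\<^esub> s))"
    by (simp only: coev_central[OF s])
  also have "\<dots> = (\<Oplus>\<^bsub>P\<^esub>i\<in>{..<coev_len D}. \<phi> (tens A Om X (coev_w D i) (coev_x D i \<triangleleft>\<^bsub>X\<^esub> s)))"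
    by (rule \<phi>_sum) (use s in \<open>auto simp: coev_closed X.ract_closed intro!: OX.tens_closed\<close>)
  also have "\<dots> = (\<Oplus>\<^bsub>P\<^esub>i\<in>{..<coev_len D}. (xw x (coev_w D i) \<otimes> g) \<diamondop> (xw (coev_x D i) w \<otimes> (el s \<otimes> h)))"
    by (rule P.finsum_cong')
      (use s g h x w in \<open>auto simp: \<phi> coev_closed X.ract_closed xw_closed xw_el[symmetric] el_closed B.m_assoc\<close>)
  finally show "(\<Oplus>\<^bsub>P\<^esub>i\<in>{..<coev_len D}. (xw x (coev_w D i) \<otimes> (bar s \<otimes> g)) \<diamondop> (xw (coev_x D i) w \<otimes> h))
      = (\<Oplus>\<^bsub>P\<^esub>i\<in>{..<coev_len D}. (xw x (coev_w D i) \<otimes> g) \<diamondop> (xw (coev_x D i) w \<otimes> (el s \<otimes> h)))" .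
qed (use x w in \<open>auto simp: coev_closed xw_closed\<close>)

text \<open>Lets statements about \<open>xw_mul\<close> for the exchanged data be read as statements
  about \<open>wx_mul\<close> for the original data; the next lemma does the converse.\<close>

lemma wx_mul_swap: "H_relations.wx_mul A D B el bar wx = H_relations.xw_mul A (swap_dual D) B el bar wx"
  by (intro ext) (simp add: wx_mul_def H_relations.xw_mul_def[OF H_relations_swap])

lemma xw_mul_swap: "H_relations.xw_mul A D B el bar xw = H_relations.wx_mul A (swap_dual D) B el bar xw"
  by (intro ext) (simp add: xw_mul_def H_relations.wx_mul_def[OF H_relations_swap])

lemma takeuchi_wx:
  assumes "w \<in> carrier Om" "x \<in> carrier X"
  shows "takeuchi (coevu_len D) (\<lambda>j. wx w (coevu_y D j)) (\<lambda>j. wx (coevu_r D j) x)"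
  using H_relations.takeuchi_xw[OF H_relations_swap assms] by simp

end

section \<open>The operators of the generators satisfy the relations\<close>

context H_relations
begin

abbreviation "EndP \<equiv> endo_ring P"

lemma ring_EndP: "ring EndP" by (rule P.ring_endo_ring)

lemma el_mul_endo: "a \<in> carrier A \<Longrightarrow> el_mul a \<in> carrier EndP"
  and bar_mul_endo: "a \<in> carrier A \<Longrightarrow> bar_mul a \<in> carrier EndP"
  and xw_mul_endo: "\<lbrakk>x \<in> carrier X; w \<in> carrier Om\<rbrakk> \<Longrightarrow> xw_mul x w \<in> carrier EndP"
  and wx_mul_endo: "\<lbrakk>x \<in> carrier X; w \<in> carrier Om\<rbrakk> \<Longrightarrow> wx_mul w x \<in> carrier EndP"
  unfolding el_mul_def bar_mul_def xw_mul_def wx_mul_def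
  by (simp_all add: lmul_on_endo takeuchi_el takeuchi_bar takeuchi_xw takeuchi_wx del: One_nat_def)

lemma el_mul_tens: "\<lbrakk>a \<in> carrier A; g \<in> carrier B; h \<in> carrier B\<rbrakk> \<Longrightarrow> el_mul a (g \<diamondop> h) = (el a \<otimes> g) \<diamondop> h"
  unfolding el_mul_def by (simp add: lmul_on_tens[OF takeuchi_el] sum_lessThan_1 el_closed del: One_nat_def)

lemma bar_mul_tens: "\<lbrakk>a \<in> carrier A; g \<in> carrier B; h \<in> carrier B\<rbrakk> \<Longrightarrow> bar_mul a (g \<diamondop> h) = g \<diamondop> (bar a \<otimes> h)"
  unfolding bar_mul_def by (simp add: lmul_on_tens[OF takeuchi_bar] sum_lessThan_1 bar_closed del: One_nat_def)

lemma xw_mul_tens: "\<lbrakk>x \<in> carrier X; w \<in> carrier Om; g \<in> carrier B; h \<in> carrier B\<rbrakk> \<Longrightarrow>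
    xw_mul x w (g \<diamondop> h) = (\<Oplus>\<^bsub>P\<^esub>i\<in>{..<coev_len D}. (xw x (coev_w D i) \<otimes> g) \<diamondop> (xw (coev_x D i) w \<otimes> h))"
  unfolding xw_mul_def by (rule lmul_on_tens[OF takeuchi_xw])

lemma wx_mul_tens: "\<lbrakk>x \<in> carrier X; w \<in> carrier Om; g \<in> carrier B; h \<in> carrier B\<rbrakk> \<Longrightarrow>
    wx_mul w x (g \<diamondop> h) = (\<Oplus>\<^bsub>P\<^esub>j\<in>{..<coevu_len D}. (wx w (coevu_y D j) \<otimes> g) \<diamondop> (wx (coevu_r D j) x \<otimes> h))"
  unfolding wx_mul_def by (rule lmul_on_tens[OF takeuchi_wx])

lemma endo_mult_closed: "\<lbrakk>f \<in> carrier EndP; g \<in> carrier EndP\<rbrakk> \<Longrightarrow> f \<otimes>\<^bsub>EndP\<^esub> g \<in> carrier EndP"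
  and endo_add_closed: "\<lbrakk>f \<in> carrier EndP; g \<in> carrier EndP\<rbrakk> \<Longrightarrow> f \<oplus>\<^bsub>EndP\<^esub> g \<in> carrier EndP"
  using ring.ring_simprules(1,5)[OF ring_EndP] by blast+

lemma sum_in_P: "(\<And>i. i < n \<Longrightarrow> f i \<in> carrier P) \<Longrightarrow> (\<Oplus>\<^bsub>P\<^esub>i\<in>{..<n::nat}. f i) \<in> carrier P"
  by (rule P.finsum_closed) simp

lemma P_sum_cong: "\<lbrakk>\<And>i. i < n \<Longrightarrow> f i = g i; \<And>i. i < n \<Longrightarrow> g i \<in> carrier P\<rbrakk> \<Longrightarrow>
    (\<Oplus>\<^bsub>P\<^esub>i\<in>{..<n::nat}. f i) = (\<Oplus>\<^bsub>P\<^esub>i\<in>{..<n}. g i)"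
  by (rule P.finsum_cong') auto

lemmas P_sum_swap = P.finsum_swap[OF finite_lessThan finite_lessThan]

lemmas cl = el_closed bar_closed xw_closed wx_closed coev_closed coevu_closed ev_closed evu_closed
  X.lact_closed X.ract_closed Om.lact_closed Om.ract_closed
lemmas endo_cl = el_mul_endo bar_mul_endo xw_mul_endo wx_mul_endo endo_mult_closed endo_add_closed
lemma el_mul_hom: "el_mul \<in> ring_hom A EndP"
  by (rule ring_hom_memI; (rule endo_P_eqI)?)
    (simp_all add: endo_cl endo_ring_simps(2-4) el_mul_tens ring_hom_mult[OF el] ring_hom_add[OF el] el_one
      ring.ring_simprules(6)[OF ring_EndP] B.m_assoc el_closed B.l_distr P.tens_add_left[simplified])

lemma bar_mul_hom: "bar_mul \<in> ring_hom A (opp EndP)"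
  by (rule ring_hom_memI; (unfold mult_opp add_opp one_opp carrier_opp)?; (rule endo_P_eqI)?)
    (simp_all add: endo_cl endo_ring_simps(2-4) bar_mul_tens ring_hom_mult[OF bar, simplified]
      ring_hom_add[OF bar, simplified] bar_one
      ring.ring_simprules(6)[OF ring_EndP] B.m_assoc bar_closed B.l_distr P.tens_add_right[simplified])

lemma el_bar_mul: "\<lbrakk>a \<in> carrier A; b \<in> carrier A\<rbrakk> \<Longrightarrow> el_mul a \<otimes>\<^bsub>EndP\<^esub> bar_mul b = bar_mul b \<otimes>\<^bsub>EndP\<^esub> el_mul a"
  by (rule endo_P_eqI) (simp_all add: endo_cl endo_ring_simps(2) el_mul_tens bar_mul_tens cl)

lemma el_scalar_mul: "k \<in> carrier K \<Longrightarrow> el_mul (scalar A k) = bar_mul (scalar A k)"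
  by (rule endo_P_eqI)
    (simp_all add: endo_cl Om.scalar_closed el_mul_tens bar_mul_tens el_scalar tn_balanced bar_closed)

lemma xw_mul_additive_left: "w \<in> carrier Om \<Longrightarrow> additive_map X EndP (\<lambda>x. xw_mul x w)"
proof (rule additive_mapI)
  fix x x' assume w: "w \<in> carrier Om" and x: "x \<in> carrier X" "x' \<in> carrier X"
  have "xw_mul (x \<oplus>\<^bsub>X\<^esub> x') w (g \<diamondop> h) = xw_mul x w (g \<diamondop> h) \<oplus>\<^bsub>P\<^esub> xw_mul x' w (g \<diamondop> h)"
    if "g \<in> carrier B" "h \<in> carrier B" for g h
  proof -
    have "xw_mul (x \<oplus>\<^bsub>X\<^esub> x') w (g \<diamondop> h) = (\<Oplus>\<^bsub>P\<^esub>i\<in>{..<coev_len D}.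
        (xw x (coev_w D i) \<otimes> g) \<diamondop> (xw (coev_x D i) w \<otimes> h) \<oplus>\<^bsub>P\<^esub>
        (xw x' (coev_w D i) \<otimes> g) \<diamondop> (xw (coev_x D i) w \<otimes> h))"
      by (rule trans[OF xw_mul_tens P_sum_cong])
        (use w x that in \<open>simp_all add: cl additive_map_add[OF xw_left] B.l_distr P.tens_add_left[simplified]\<close>)
    also have "\<dots> = xw_mul x w (g \<diamondop> h) \<oplus>\<^bsub>P\<^esub> xw_mul x' w (g \<diamondop> h)"
      using w x that by (simp add: xw_mul_tens) (rule P.finsum_addf; auto simp: cl)
    finally show ?thesis .
  qed
  then show "xw_mul (x \<oplus>\<^bsub>X\<^esub> x') w = xw_mul x w \<oplus>\<^bsub>EndP\<^esub> xw_mul x' w"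
    using w x by (intro endo_P_eqI) (simp_all add: endo_cl endo_ring_simps(3))
qed (simp add: endo_cl)

lemma xw_mul_additive_right: "x \<in> carrier X \<Longrightarrow> additive_map Om EndP (\<lambda>w. xw_mul x w)"
proof (rule additive_mapI)
  fix w w' assume x: "x \<in> carrier X" and w: "w \<in> carrier Om" "w' \<in> carrier Om"
  have "xw_mul x (w \<oplus>\<^bsub>Om\<^esub> w') (g \<diamondop> h) = xw_mul x w (g \<diamondop> h) \<oplus>\<^bsub>P\<^esub> xw_mul x w' (g \<diamondop> h)"
    if "g \<in> carrier B" "h \<in> carrier B" for g h
  proof -
    have "xw_mul x (w \<oplus>\<^bsub>Om\<^esub> w') (g \<diamondop> h) = (\<Oplus>\<^bsub>P\<^esub>i\<in>{..<coev_len D}.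
        (xw x (coev_w D i) \<otimes> g) \<diamondop> (xw (coev_x D i) w \<otimes> h) \<oplus>\<^bsub>P\<^esub>
        (xw x (coev_w D i) \<otimes> g) \<diamondop> (xw (coev_x D i) w' \<otimes> h))"
      by (rule trans[OF xw_mul_tens P_sum_cong])
        (use w x that in \<open>simp_all add: cl additive_map_add[OF xw_right] B.l_distr P.tens_add_right[simplified]\<close>)
    also have "\<dots> = xw_mul x w (g \<diamondop> h) \<oplus>\<^bsub>P\<^esub> xw_mul x w' (g \<diamondop> h)"
      using w x that by (simp add: xw_mul_tens) (rule P.finsum_addf; auto simp: cl)
    finally show ?thesis .
  qed
  then show "xw_mul x (w \<oplus>\<^bsub>Om\<^esub> w') = xw_mul x w \<oplus>\<^bsub>EndP\<^esub> xw_mul x w'"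
    using w x by (intro endo_P_eqI) (simp_all add: endo_cl endo_ring_simps(3))
qed (simp add: endo_cl)

text \<open>The vector \<open>x\<close> occurs only in the first tensor factor and \<open>w\<close>
  only in the second, exactly where \<open>el_mul\<close> and \<open>bar_mul\<close> act, so the
  dual bases stay untouched.\<close>

lemma xw_mul_actions:
  assumes a: "a \<in> carrier A" and x: "x \<in> carrier X" and w: "w \<in> carrier Om"
  shows "el_mul a \<otimes>\<^bsub>EndP\<^esub> xw_mul x w = xw_mul (a \<triangleright>\<^bsub>X\<^esub> x) w"
    and "xw_mul x w \<otimes>\<^bsub>EndP\<^esub> el_mul a = xw_mul (x \<triangleleft>\<^bsub>X\<^esub> a) w"
    and "bar_mul a \<otimes>\<^bsub>EndP\<^esub> xw_mul x w = xw_mul x (w \<triangleleft>\<^bsub>Om\<^esub> a)"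
    and "xw_mul x w \<otimes>\<^bsub>EndP\<^esub> bar_mul a = xw_mul x (a \<triangleright>\<^bsub>Om\<^esub> w)"
proof -
  let ?n = "coev_len D"
  have el_sum: "el_mul a (\<Oplus>\<^bsub>P\<^esub>i\<in>{..<?n}. f i \<diamondop> g i) = (\<Oplus>\<^bsub>P\<^esub>i\<in>{..<?n}. (el a \<otimes> f i) \<diamondop> g i)"
    and bar_sum: "bar_mul a (\<Oplus>\<^bsub>P\<^esub>i\<in>{..<?n}. f i \<diamondop> g i) = (\<Oplus>\<^bsub>P\<^esub>i\<in>{..<?n}. f i \<diamondop> (bar a \<otimes> g i))"
    if "\<And>i. i < ?n \<Longrightarrow> f i \<in> carrier B" "\<And>i. i < ?n \<Longrightarrow> g i \<in> carrier B" for f g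
  proof -
    show "el_mul a (\<Oplus>\<^bsub>P\<^esub>i\<in>{..<?n}. f i \<diamondop> g i) = (\<Oplus>\<^bsub>P\<^esub>i\<in>{..<?n}. (el a \<otimes> f i) \<diamondop> g i)"
      unfolding el_mul_def
      by (rule trans[OF lmul_on_sum[OF takeuchi_el[OF a]] P_sum_cong])
        (use that a in \<open>simp_all add: sum_lessThan_1 cl del: One_nat_def\<close>)
    show "bar_mul a (\<Oplus>\<^bsub>P\<^esub>i\<in>{..<?n}. f i \<diamondop> g i) = (\<Oplus>\<^bsub>P\<^esub>i\<in>{..<?n}. f i \<diamondop> (bar a \<otimes> g i))"
      unfolding bar_mul_def
      by (rule trans[OF lmul_on_sum[OF takeuchi_bar[OF a]] P_sum_cong])
        (use that a in \<open>simp_all add: sum_lessThan_1 cl del: One_nat_def\<close>)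
  qed
  note [simp] = endo_cl a x w cl
  show "el_mul a \<otimes>\<^bsub>EndP\<^esub> xw_mul x w = xw_mul (a \<triangleright>\<^bsub>X\<^esub> x) w"
    by (rule endo_P_eqI) (auto simp: endo_ring_simps(2) xw_mul_tens el_sum el_xw[symmetric] B.m_assoc intro!: P_sum_cong)
  show "xw_mul x w \<otimes>\<^bsub>EndP\<^esub> el_mul a = xw_mul (x \<triangleleft>\<^bsub>X\<^esub> a) w"
    by (rule endo_P_eqI) (auto simp: endo_ring_simps(2) xw_mul_tens el_mul_tens xw_el[symmetric] B.m_assoc intro!: P_sum_cong)
  show "bar_mul a \<otimes>\<^bsub>EndP\<^esub> xw_mul x w = xw_mul x (w \<triangleleft>\<^bsub>Om\<^esub> a)"
    by (rule endo_P_eqI) (auto simp: endo_ring_simps(2) xw_mul_tens bar_sum bar_xw[symmetric] B.m_assoc intro!: P_sum_cong)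
  show "xw_mul x w \<otimes>\<^bsub>EndP\<^esub> bar_mul a = xw_mul x (a \<triangleright>\<^bsub>Om\<^esub> w)"
    by (rule endo_P_eqI) (auto simp: endo_ring_simps(2) xw_mul_tens bar_mul_tens xw_bar[symmetric] B.m_assoc intro!: P_sum_cong)
qed

text \<open>The evaluation crosses the tensor sign, acts on the basis vector
  \<open>coevu_r D j\<close> from the left, and the expansion of \<open>w\<close> in the dual bases
  collapses the sum.\<close>

lemma wx_sum_left:
  assumes "w \<in> carrier Om" "x \<in> carrier X" "g \<in> carrier B" "h \<in> carrier B"
  shows "(\<Oplus>\<^bsub>P\<^esub>j\<in>{..<coevu_len D}. (bar (evu D w (coevu_y D j)) \<otimes> g) \<diamondop> (wx (coevu_r D j) x \<otimes> h))
    = g \<diamondop> (wx w x \<otimes> h)"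
proof -
  have "(\<Oplus>\<^bsub>P\<^esub>j\<in>{..<coevu_len D}. (bar (evu D w (coevu_y D j)) \<otimes> g) \<diamondop> (wx (coevu_r D j) x \<otimes> h))
      = (\<Oplus>\<^bsub>P\<^esub>j\<in>{..<coevu_len D}. g \<diamondop> (wx (evu D w (coevu_y D j) \<triangleright>\<^bsub>Om\<^esub> coevu_r D j) x \<otimes> h))"
    by (rule P_sum_cong) (use assms in \<open>simp_all add: cl tn_balanced el_wx[symmetric] B.m_assoc\<close>)
  also have "\<dots> = g \<diamondop> ((\<Oplus>j\<in>{..<coevu_len D}. wx (evu D w (coevu_y D j) \<triangleright>\<^bsub>Om\<^esub> coevu_r D j) x) \<otimes> h)"
    by (rule tn_sum_right[symmetric]) (use assms in \<open>simp_all add: cl\<close>)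
  also have "(\<Oplus>j\<in>{..<coevu_len D}. wx (evu D w (coevu_y D j) \<triangleright>\<^bsub>Om\<^esub> coevu_r D j) x)
      = wx (\<Oplus>\<^bsub>Om\<^esub>j\<in>{..<coevu_len D}. evu D w (coevu_y D j) \<triangleright>\<^bsub>Om\<^esub> coevu_r D j) x"
    by (rule additive_map_finsum[OF Om.M.abelian_group_axioms B.is_abelian_group wx_left, symmetric])
      (use assms in \<open>auto simp: cl\<close>)
  also have "\<dots> = wx w x" by (simp add: Om_eq_coevu assms)
  finally show ?thesis .
qed

text \<open>Here the evaluation crosses in the other direction and acts on
  \<open>coevu_y D j\<close> from the right, which leaves the expansion of \<open>x\<close>.\<close>

lemma wx_sum_right:
  assumes "w \<in> carrier Om" "x \<in> carrier X" "g \<in> carrier B" "h \<in> carrier B"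
  shows "(\<Oplus>\<^bsub>P\<^esub>j\<in>{..<coevu_len D}. (wx w (coevu_y D j) \<otimes> g) \<diamondop> (el (evu D (coevu_r D j) x) \<otimes> h))
    = (wx w x \<otimes> g) \<diamondop> h"
proof -
  have "(\<Oplus>\<^bsub>P\<^esub>j\<in>{..<coevu_len D}. (wx w (coevu_y D j) \<otimes> g) \<diamondop> (el (evu D (coevu_r D j) x) \<otimes> h))
      = (\<Oplus>\<^bsub>P\<^esub>j\<in>{..<coevu_len D}. (wx w (coevu_y D j \<triangleleft>\<^bsub>X\<^esub> evu D (coevu_r D j) x) \<otimes> g) \<diamondop> h)"
    by (rule P_sum_cong) (use assms in \<open>simp_all add: cl tn_balanced[symmetric] bar_wx[symmetric] B.m_assoc\<close>)
  also have "\<dots> = ((\<Oplus>j\<in>{..<coevu_len D}. wx w (coevu_y D j \<triangleleft>\<^bsub>X\<^esub> evu D (coevu_r D j) x)) \<otimes> g) \<diamondop> h"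
    by (rule tn_sum_left[symmetric]) (use assms in \<open>simp_all add: cl\<close>)
  also have "(\<Oplus>j\<in>{..<coevu_len D}. wx w (coevu_y D j \<triangleleft>\<^bsub>X\<^esub> evu D (coevu_r D j) x))
      = wx w (\<Oplus>\<^bsub>X\<^esub>j\<in>{..<coevu_len D}. coevu_y D j \<triangleleft>\<^bsub>X\<^esub> evu D (coevu_r D j) x)"
    by (rule additive_map_finsum[OF X.M.abelian_group_axioms B.is_abelian_group wx_right, symmetric])
      (use assms in \<open>auto simp: cl\<close>)
  also have "\<dots> = wx w x" by (simp add: X_eq_coevu assms)
  finally show ?thesis .
qed

text \<open>After interchanging sums, the relation \<open>wx_xw_coev\<close> contracts the sum over
  i in the first factor, and \<open>wx_sum_left\<close> removes the dual bases that came from the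
  coproduct of the operator. Used for the relations of the operators and, with \<open>h\<close>
  equal to one, for the first antipode identity.\<close>

lemma wx_mul_xw_tens:
  assumes w: "w \<in> carrier Om" and x: "x \<in> carrier X" and g: "g \<in> carrier B" and h: "h \<in> carrier B"
  shows "(\<Oplus>\<^bsub>P\<^esub>i\<in>{..<coev_len D}. wx_mul (coev_w D i) x ((xw (coev_x D i) w \<otimes> g) \<diamondop> h)) = g \<diamondop> (wx w x \<otimes> h)"
proof -
  have "(\<Oplus>\<^bsub>P\<^esub>i\<in>{..<coev_len D}. wx_mul (coev_w D i) x ((xw (coev_x D i) w \<otimes> g) \<diamondop> h))
      = (\<Oplus>\<^bsub>P\<^esub>i\<in>{..<coev_len D}. \<Oplus>\<^bsub>P\<^esub>j\<in>{..<coevu_len D}.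
          (wx (coev_w D i) (coevu_y D j) \<otimes> xw (coev_x D i) w \<otimes> g) \<diamondop> (wx (coevu_r D j) x \<otimes> h))"
    by (rule P_sum_cong, rule trans[OF wx_mul_tens P_sum_cong])
      (use assms in \<open>simp_all add: cl B.m_assoc sum_in_P\<close>)
  also have "\<dots> = (\<Oplus>\<^bsub>P\<^esub>j\<in>{..<coevu_len D}. \<Oplus>\<^bsub>P\<^esub>i\<in>{..<coev_len D}.
          (wx (coev_w D i) (coevu_y D j) \<otimes> xw (coev_x D i) w \<otimes> g) \<diamondop> (wx (coevu_r D j) x \<otimes> h))"
    by (rule P_sum_swap) (use assms in \<open>simp add: cl\<close>)
  also have "\<dots> = (\<Oplus>\<^bsub>P\<^esub>j\<in>{..<coevu_len D}. (bar (evu D w (coevu_y D j)) \<otimes> g) \<diamondop> (wx (coevu_r D j) x \<otimes> h))"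
    by (rule P_sum_cong) (use assms in \<open>simp_all add: cl tn_sum_left[symmetric] wx_xw_coev\<close>)
  also have "\<dots> = g \<diamondop> (wx w x \<otimes> h)" by (rule wx_sum_left) fact+
  finally show ?thesis .
qed

text \<open>The same contraction in the second factor, through \<open>wx_xw_coev'\<close> and
  \<open>wx_sum_right\<close>. With \<open>h\<close> equal to one it gives the second antipode
  identity.\<close>

lemma wx_mul_xw_tens':
  assumes w: "w \<in> carrier Om" and x: "x \<in> carrier X" and g: "g \<in> carrier B" and h: "h \<in> carrier B"
  shows "(\<Oplus>\<^bsub>P\<^esub>i\<in>{..<coev_len D}. wx_mul w (coev_x D i) (h \<diamondop> (xw x (coev_w D i) \<otimes> g))) = (wx w x \<otimes> h) \<diamondop> g"
proof -
  have "(\<Oplus>\<^bsub>P\<^esub>i\<in>{..<coev_len D}. wx_mul w (coev_x D i) (h \<diamondop> (xw x (coev_w D i) \<otimes> g)))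
      = (\<Oplus>\<^bsub>P\<^esub>i\<in>{..<coev_len D}. \<Oplus>\<^bsub>P\<^esub>j\<in>{..<coevu_len D}.
          (wx w (coevu_y D j) \<otimes> h) \<diamondop> (wx (coevu_r D j) (coev_x D i) \<otimes> xw x (coev_w D i) \<otimes> g))"
    by (rule P_sum_cong, rule trans[OF wx_mul_tens P_sum_cong])
      (use assms in \<open>simp_all add: cl B.m_assoc sum_in_P\<close>)
  also have "\<dots> = (\<Oplus>\<^bsub>P\<^esub>j\<in>{..<coevu_len D}. \<Oplus>\<^bsub>P\<^esub>i\<in>{..<coev_len D}.
          (wx w (coevu_y D j) \<otimes> h) \<diamondop> (wx (coevu_r D j) (coev_x D i) \<otimes> xw x (coev_w D i) \<otimes> g))"
    by (rule P_sum_swap) (use assms in \<open>simp add: cl\<close>)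
  also have "\<dots> = (\<Oplus>\<^bsub>P\<^esub>j\<in>{..<coevu_len D}. (wx w (coevu_y D j) \<otimes> h) \<diamondop> (el (evu D (coevu_r D j) x) \<otimes> g))"
    by (rule P_sum_cong) (use assms in \<open>simp_all add: cl tn_sum_right[symmetric] wx_xw_coev'\<close>)
  also have "\<dots> = (wx w x \<otimes> h) \<diamondop> g" by (rule wx_sum_right) fact+
  finally show ?thesis .
qed

lemma xw_mul_wx_tens:
  assumes "w \<in> carrier Om" "x \<in> carrier X" "g \<in> carrier B" "h \<in> carrier B"
  shows "(\<Oplus>\<^bsub>P\<^esub>j\<in>{..<coevu_len D}. xw_mul (coevu_y D j) w ((wx (coevu_r D j) x \<otimes> g) \<diamondop> h)) = g \<diamondop> (xw x w \<otimes> h)"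
  using H_relations.wx_mul_xw_tens[OF H_relations_swap assms(2,1,3,4)] by (simp add: xw_mul_swap)

lemma xw_mul_wx_tens':
  assumes "w \<in> carrier Om" "x \<in> carrier X" "g \<in> carrier B" "h \<in> carrier B"
  shows "(\<Oplus>\<^bsub>P\<^esub>j\<in>{..<coevu_len D}. xw_mul x (coevu_r D j) (h \<diamondop> (wx w (coevu_y D j) \<otimes> g))) = (xw x w \<otimes> h) \<diamondop> g"
  using H_relations.wx_mul_xw_tens'[OF H_relations_swap assms(2,1,3,4)] by (simp add: xw_mul_swap)

lemma EndP_sum: "\<lbrakk>\<And>i. i < n \<Longrightarrow> f i \<in> carrier EndP; p \<in> carrier P\<rbrakk> \<Longrightarrow>
    (\<Oplus>\<^bsub>EndP\<^esub>i\<in>{..<n::nat}. f i) p = (\<Oplus>\<^bsub>P\<^esub>i\<in>{..<n}. f i p)"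
  by (rule P.endo_finsum) auto

lemma EndP_sum_closed: "(\<And>i. i < n \<Longrightarrow> f i \<in> carrier EndP) \<Longrightarrow> (\<Oplus>\<^bsub>EndP\<^esub>i\<in>{..<n::nat}. f i) \<in> carrier EndP"
  by (rule abelian_monoid.finsum_closed) (use ring_EndP in \<open>auto simp: ring_def abelian_group_def\<close>)

text \<open>\<open>xw_mul\<close> introduces a second index k. For fixed k the sum over i is the
  contraction \<open>wx_mul_xw_tens\<close>; what remains, summed over k, is the relation
  \<open>wx_xw_coev\<close> in the second tensor factor.\<close>

lemma wx_xw_mul_coev:
  assumes x: "x \<in> carrier X" and w: "w \<in> carrier Om"
  shows "(\<Oplus>\<^bsub>EndP\<^esub>i\<in>{..<coev_len D}. wx_mul (coev_w D i) x \<otimes>\<^bsub>EndP\<^esub> xw_mul (coev_x D i) w) = bar_mul (evu D w x)"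
proof (rule endo_P_eqI)
  fix g h assume gh: "g \<in> carrier B" "h \<in> carrier B"
  note [simp] = cl x w gh endo_cl
  let ?n = "coev_len D" and ?m = "coevu_len D"
  have wx_add: "wx_mul (coev_w D i) x (\<Oplus>\<^bsub>P\<^esub>k\<in>{..<?n}. f k) = (\<Oplus>\<^bsub>P\<^esub>k\<in>{..<?n}. wx_mul (coev_w D i) x (f k))"
    if "i < ?n" "\<And>k. k < ?n \<Longrightarrow> f k \<in> carrier P" for i f
    by (rule additive_map_finsum[OF P.abelian_group_axioms P.abelian_group_axioms endo_additive]) (use that in auto)
  have wxP: "wx_mul (coev_w D i) x p \<in> carrier P" if "i < ?n" "p \<in> carrier P" for i p
    using endo_closed[OF wx_mul_endo[OF x coev_closed(1)[OF that(1)]] that(2)] .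
  have "(\<Oplus>\<^bsub>EndP\<^esub>i\<in>{..<?n}. wx_mul (coev_w D i) x \<otimes>\<^bsub>EndP\<^esub> xw_mul (coev_x D i) w) (g \<diamondop> h)
      = (\<Oplus>\<^bsub>P\<^esub>i\<in>{..<?n}. (wx_mul (coev_w D i) x \<otimes>\<^bsub>EndP\<^esub> xw_mul (coev_x D i) w) (g \<diamondop> h))"
    by (rule EndP_sum) simp_all
  also have "\<dots> = (\<Oplus>\<^bsub>P\<^esub>i\<in>{..<?n}. \<Oplus>\<^bsub>P\<^esub>k\<in>{..<?n}.
      wx_mul (coev_w D i) x ((xw (coev_x D i) (coev_w D k) \<otimes> g) \<diamondop> (xw (coev_x D k) w \<otimes> h)))"
    by (intro P_sum_cong sum_in_P) (simp_all add: endo_ring_simps(2) xw_mul_tens wx_add wxP)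
  also have "\<dots> = (\<Oplus>\<^bsub>P\<^esub>k\<in>{..<?n}. \<Oplus>\<^bsub>P\<^esub>i\<in>{..<?n}.
      wx_mul (coev_w D i) x ((xw (coev_x D i) (coev_w D k) \<otimes> g) \<diamondop> (xw (coev_x D k) w \<otimes> h)))"
    by (rule P_sum_swap) (simp add: wxP)
  also have "\<dots> = (\<Oplus>\<^bsub>P\<^esub>k\<in>{..<?n}. g \<diamondop> ((wx (coev_w D k) x \<otimes> xw (coev_x D k) w) \<otimes> h))"
    by (rule P_sum_cong) (simp_all add: wx_mul_xw_tens B.m_assoc)
  also have "\<dots> = g \<diamondop> (bar (evu D w x) \<otimes> h)"
    by (simp add: tn_sum_right[symmetric] wx_xw_coev)
  finally show "(\<Oplus>\<^bsub>EndP\<^esub>i\<in>{..<?n}. wx_mul (coev_w D i) x \<otimes>\<^bsub>EndP\<^esub> xw_mul (coev_x D i) w) (g \<diamondop> h)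
      = bar_mul (evu D w x) (g \<diamondop> h)" by (simp add: bar_mul_tens)
qed (auto intro!: EndP_sum_closed simp: endo_cl cl x w)

text \<open>Here the sum over i contracts in the second factor, and the sum over k is
  \<open>wx_xw_coev'\<close> in the first.\<close>

lemma wx_xw_mul_coev':
  assumes x: "x \<in> carrier X" and w: "w \<in> carrier Om"
  shows "(\<Oplus>\<^bsub>EndP\<^esub>i\<in>{..<coev_len D}. wx_mul w (coev_x D i) \<otimes>\<^bsub>EndP\<^esub> xw_mul x (coev_w D i)) = el_mul (evu D w x)"
proof (rule endo_P_eqI)
  fix g h assume gh: "g \<in> carrier B" "h \<in> carrier B"
  note [simp] = cl x w gh endo_cl
  let ?n = "coev_len D" and ?m = "coevu_len D"
  have wx_add: "wx_mul w (coev_x D i) (\<Oplus>\<^bsub>P\<^esub>k\<in>{..<?n}. f k) = (\<Oplus>\<^bsub>P\<^esub>k\<in>{..<?n}. wx_mul w (coev_x D i) (f k))"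
    if "i < ?n" "\<And>k. k < ?n \<Longrightarrow> f k \<in> carrier P" for i f
    by (rule additive_map_finsum[OF P.abelian_group_axioms P.abelian_group_axioms endo_additive]) (use that in auto)
  have wxP: "wx_mul w (coev_x D i) p \<in> carrier P" if "i < ?n" "p \<in> carrier P" for i p
    using endo_closed[OF wx_mul_endo[OF coev_closed(2)[OF that(1)] w] that(2)] .
  have "(\<Oplus>\<^bsub>EndP\<^esub>i\<in>{..<?n}. wx_mul w (coev_x D i) \<otimes>\<^bsub>EndP\<^esub> xw_mul x (coev_w D i)) (g \<diamondop> h)
      = (\<Oplus>\<^bsub>P\<^esub>i\<in>{..<?n}. (wx_mul w (coev_x D i) \<otimes>\<^bsub>EndP\<^esub> xw_mul x (coev_w D i)) (g \<diamondop> h))"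
    by (rule EndP_sum) simp_all
  also have "\<dots> = (\<Oplus>\<^bsub>P\<^esub>i\<in>{..<?n}. \<Oplus>\<^bsub>P\<^esub>k\<in>{..<?n}.
      wx_mul w (coev_x D i) ((xw x (coev_w D k) \<otimes> g) \<diamondop> (xw (coev_x D k) (coev_w D i) \<otimes> h)))"
    by (intro P_sum_cong sum_in_P) (simp_all add: endo_ring_simps(2) xw_mul_tens wx_add wxP)
  also have "\<dots> = (\<Oplus>\<^bsub>P\<^esub>k\<in>{..<?n}. \<Oplus>\<^bsub>P\<^esub>i\<in>{..<?n}.
      wx_mul w (coev_x D i) ((xw x (coev_w D k) \<otimes> g) \<diamondop> (xw (coev_x D k) (coev_w D i) \<otimes> h)))"
    by (rule P_sum_swap) (simp add: wxP)
  also have "\<dots> = (\<Oplus>\<^bsub>P\<^esub>k\<in>{..<?n}. ((wx w (coev_x D k) \<otimes> xw x (coev_w D k)) \<otimes> g) \<diamondop> h)"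
    by (rule P_sum_cong) (simp_all add: wx_mul_xw_tens' B.m_assoc)
  also have "\<dots> = (el (evu D w x) \<otimes> g) \<diamondop> h"
    by (simp add: tn_sum_left[symmetric] wx_xw_coev')
  finally show "(\<Oplus>\<^bsub>EndP\<^esub>i\<in>{..<?n}. wx_mul w (coev_x D i) \<otimes>\<^bsub>EndP\<^esub> xw_mul x (coev_w D i)) (g \<diamondop> h)
      = el_mul (evu D w x) (g \<diamondop> h)" by (simp add: el_mul_tens)
qed (auto intro!: EndP_sum_closed simp: endo_cl cl x w)

lemma H_relations_EndP: "H_relations K A Om X D EndP el_mul bar_mul xw_mul wx_mul"
proof -
  note sw = H_relations_swap
  note swap = H_relations.xw_mul_additive_left[OF sw] H_relations.xw_mul_additive_right[OF sw]
    H_relations.xw_mul_actions[OF sw] H_relations.wx_xw_mul_coev[OF sw] H_relations.wx_xw_mul_coev'[OF sw]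
  \<comment> \<open>Stated for the exchanged data, these are the missing laws of
    \<open>wx_mul\<close> and the two contractions over \<open>coevu_len D\<close>; folding rewrites
    them for \<open>D\<close>.\<close>
  note swap' = swap[folded wx_mul_swap xw_mul_swap, unfolded swap_dual_simps]
  show ?thesis
    by (intro H_relations.intro H_relations_axioms.intro dual_bimodules_axioms ring_EndP)
      (fact el_mul_hom bar_mul_hom | erule (1) el_bar_mul | erule el_scalar_mul
        | (rule xw_mul_additive_left xw_mul_additive_right xw_mul_actions wx_xw_mul_coev wx_xw_mul_coev' swap';
           assumption))+
qed

end

section \<open>Right multiplication and representatives of tensors\<close>

context H_relations
begin

text \<open>Unlike left multiplication, right multiplication respects the relations of the tensor square
  without any condition.\<close>

definition rmul :: "'b \<Rightarrow> 'b \<Rightarrow> ('b \<times> 'b \<Rightarrow>\<^sub>0 int) set \<Rightarrow> ('b \<times> 'b \<Rightarrow>\<^sub>0 int) set" where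
  "rmul g h = (SOME \<phi>. additive_map P P \<phi> \<and>
     (\<forall>x\<in>carrier B. \<forall>y\<in>carrier B. \<phi> (x \<diamondop> y) = (x \<otimes> g) \<diamondop> (y \<otimes> h)))"

lemma
  assumes g: "g \<in> carrier B" and h: "h \<in> carrier B"
  shows rmul_additive: "additive_map P P (rmul g h)"
    and rmul_tens: "\<And>x y. \<lbrakk>x \<in> carrier B; y \<in> carrier B\<rbrakk> \<Longrightarrow> rmul g h (x \<diamondop> y) = (x \<otimes> g) \<diamondop> (y \<otimes> h)"
proof -
  have l: "additive_map B P (\<lambda>x. (x \<otimes> g) \<diamondop> (y \<otimes> h))" if "y \<in> carrier B" for y
    by (rule additive_map_comp[OF B.additive_map_mult_right[OF g] tn_left]) (simp add: that h)
  have r: "additive_map B P (\<lambda>y. (x \<otimes> g) \<diamondop> (y \<otimes> h))" if "x \<in> carrier B" for x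
    by (rule additive_map_comp[OF B.additive_map_mult_right[OF h] tn_right]) (simp add: that g)
  have b: "((bar s \<otimes> x) \<otimes> g) \<diamondop> (y \<otimes> h) = (x \<otimes> g) \<diamondop> ((el s \<otimes> y) \<otimes> h)"
    if "x \<in> carrier B" "s \<in> carrier A" "y \<in> carrier B" for x s y
    using that g h by (simp add: B.m_assoc cl tn_balanced)
  obtain \<phi> where "additive_map P P \<phi>"
    "\<And>x y. \<lbrakk>x \<in> carrier B; y \<in> carrier B\<rbrakk> \<Longrightarrow> \<phi> (x \<diamondop> y) = (x \<otimes> g) \<diamondop> (y \<otimes> h)"
    using P_lift[OF P.abelian_group_axioms l r b] by blast
  then have ex: "\<exists>\<phi>. additive_map P P \<phi> \<and>
      (\<forall>x\<in>carrier B. \<forall>y\<in>carrier B. \<phi> (x \<diamondop> y) = (x \<otimes> g) \<diamondop> (y \<otimes> h))"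
    by blast
  from someI_ex[OF ex] show "additive_map P P (rmul g h)"
    "\<And>x y. \<lbrakk>x \<in> carrier B; y \<in> carrier B\<rbrakk> \<Longrightarrow> rmul g h (x \<diamondop> y) = (x \<otimes> g) \<diamondop> (y \<otimes> h)"
    unfolding rmul_def by blast+
qed

lemma rmul_closed: "\<lbrakk>g \<in> carrier B; h \<in> carrier B; p \<in> carrier P\<rbrakk> \<Longrightarrow> rmul g h p \<in> carrier P"
  using additive_map_closed[OF rmul_additive] .

lemma rmul_rmul:
  assumes "g \<in> carrier B" "h \<in> carrier B" "g' \<in> carrier B" "h' \<in> carrier B" "p \<in> carrier P"
  shows "rmul g h (rmul g' h' p) = rmul (g' \<otimes> g) (h' \<otimes> h) p"
  by (rule P_eqI[where p = p, OF additive_map_comp[OF rmul_additive rmul_additive] rmul_additive])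
    (use assms in \<open>simp_all add: rmul_tens B.m_assoc\<close>)

lemma rmul_additive_snd:
  assumes g: "g \<in> carrier B" and p: "p \<in> carrier P"
  shows "additive_map B P (\<lambda>h. rmul g h p)"
proof (rule additive_mapI)
  fix h h' assume h: "h \<in> carrier B" "h' \<in> carrier B"
  show "rmul g (h \<oplus> h') p = rmul g h p \<oplus>\<^bsub>P\<^esub> rmul g h' p"
    by (rule P_eqI[where p = p, OF rmul_additive P.additive_map_add_fun[OF rmul_additive rmul_additive]])
      (use g h p in \<open>simp_all add: rmul_tens B.r_distr P.tens_add_right[simplified]\<close>)
qed (use g p in \<open>simp add: rmul_closed\<close>)

lemma rmul_additive_fst:
  assumes h: "h \<in> carrier B" and p: "p \<in> carrier P"
  shows "additive_map B P (\<lambda>g. rmul g h p)"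
proof (rule additive_mapI)
  fix g g' assume g: "g \<in> carrier B" "g' \<in> carrier B"
  show "rmul (g \<oplus> g') h p = rmul g h p \<oplus>\<^bsub>P\<^esub> rmul g' h p"
    by (rule P_eqI[where p = p, OF rmul_additive P.additive_map_add_fun[OF rmul_additive rmul_additive]])
      (use g h p in \<open>simp_all add: rmul_tens B.r_distr P.tens_add_left[simplified]\<close>)
qed (use h p in \<open>simp add: rmul_closed\<close>)

text \<open>Associativity in \<open>B\<close>, read on elementary tensors; this is the generator
  case of \<open>lam_rmul\<close>.\<close>

lemma lmul_on_rmul:
  assumes t: "takeuchi n u v" and g: "g \<in> carrier B" and h: "h \<in> carrier B" and p: "p \<in> carrier P"
  shows "lmul_on n u v (rmul g h p) = rmul g h (lmul_on n u v p)"
proof (rule P_eqI[where p = p])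
  note L = endo_additive[OF lmul_on_endo[OF t]] and R = rmul_additive[OF g h] and c = takeuchi_closed[OF t]
  show "additive_map P P (\<lambda>p. lmul_on n u v (rmul g h p))" "additive_map P P (\<lambda>p. rmul g h (lmul_on n u v p))"
    by (rule additive_map_comp[OF R L], rule additive_map_comp[OF L R])
  fix x y assume xy: "x \<in> carrier B" "y \<in> carrier B"
  have "rmul g h (lmul_on n u v (x \<diamondop> y)) = (\<Oplus>\<^bsub>P\<^esub>i\<in>{..<n}. rmul g h ((u i \<otimes> x) \<diamondop> (v i \<otimes> y)))"
    unfolding lmul_on_tens[OF t xy]
    by (rule additive_map_finsum[OF P.abelian_group_axioms P.abelian_group_axioms R]) (use xy c in auto)
  also have "\<dots> = lmul_on n u v (rmul g h (x \<diamondop> y))"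
    using xy g h c by (simp add: rmul_tens lmul_on_tens[OF t]) (rule P_sum_cong; simp add: rmul_tens B.m_assoc)
  finally show "lmul_on n u v (rmul g h (x \<diamondop> y)) = rmul g h (lmul_on n u v (x \<diamondop> y))" by simp
qed (rule p)

text \<open>The coproduct and antipode conditions are written with nested formal sums over arbitrary
  representatives. Such a sum is evaluated by any additive \<open>\<phi>\<close> that gives the
  correct values on elementary tensors, and so depends only on the class of
  \<open>f\<close>.\<close>

lemma tens_cls_frag_extend:
  assumes f: "Poly_Mapping.keys f \<subseteq> carrier B \<times> carrier B" and \<phi>: "additive_map P P \<phi>"
    and keys: "\<And>x y. \<lbrakk>x \<in> carrier B; y \<in> carrier B\<rbrakk> \<Longrightarrow> Poly_Mapping.keys (F (x, y)) \<subseteq> carrier B \<times> carrier B"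
    and F: "\<And>x y. \<lbrakk>x \<in> carrier B; y \<in> carrier B\<rbrakk> \<Longrightarrow> tens_cls A M M (F (x, y)) = \<phi> (x \<diamondop> y)"
  shows "tens_cls A M M (frag_extend F f) = \<phi> (tens_cls A M M f)"
proof -
  have *: "Poly_Mapping.keys (frag_extend F g) \<subseteq> carrier B \<times> carrier B"
    if "Poly_Mapping.keys g \<subseteq> carrier B \<times> carrier B" for g
  proof (rule order_trans[OF keys_frag_extend], rule UN_least)
    fix s assume "s \<in> Poly_Mapping.keys g"
    with that obtain x y where "s = (x, y)" "x \<in> carrier B" "y \<in> carrier B" by (cases s) auto
    then show "Poly_Mapping.keys (F s) \<subseteq> carrier B \<times> carrier B" using keys by simp
  qed
  note z = additive_map_zero[OF P.abelian_group_axioms P.abelian_group_axioms \<phi>]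
    and m = additive_map_minus[OF P.abelian_group_axioms P.abelian_group_axioms \<phi>]
  show ?thesis
  proof (rule free_Abelian_group_induct[OF f, of "\<lambda>f. tens_cls A M M (frag_extend F f) = \<phi> (tens_cls A M M f)"])
    show "tens_cls A M M (frag_extend F 0) = \<phi> (tens_cls A M M 0)"
      using z by (simp add: P.zero_tensor)
    show "tens_cls A M M (frag_extend F (x - y)) = \<phi> (tens_cls A M M (x - y))"
      if "Poly_Mapping.keys x \<subseteq> carrier B \<times> carrier B" "Poly_Mapping.keys y \<subseteq> carrier B \<times> carrier B"
        "tens_cls A M M (frag_extend F x) = \<phi> (tens_cls A M M x)"
        "tens_cls A M M (frag_extend F y) = \<phi> (tens_cls A M M y)" for x y
      using that P.tens_cls_closed[simplified] *
      by (simp add: frag_extend_diff P.tens_cls_minus[symmetric] m)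
    show "tens_cls A M M (frag_extend F (frag_of s)) = \<phi> (tens_cls A M M (frag_of s))"
      if "s \<in> carrier B \<times> carrier B" for s
      using that F by auto
  qed
qed

lemma tens_cls_rmul:
  assumes "Poly_Mapping.keys f \<subseteq> carrier B \<times> carrier B" "g \<in> carrier B" "h \<in> carrier B"
  shows "tens_cls A M M (frag_extend (\<lambda>(c, d). frag_of (c \<otimes> g, d \<otimes> h)) f) = rmul g h (tens_cls A M M f)"
  by (rule tens_cls_frag_extend[OF assms(1) rmul_additive[OF assms(2,3)]])
    (use assms in \<open>simp_all add: rmul_tens\<close>)

lemma P_representative:
  assumes "p \<in> carrier P" "f \<in> p"
  shows "Poly_Mapping.keys f \<subseteq> carrier B \<times> carrier B" "tens_cls A M M f = p"
proof -
  obtain g where g: "Poly_Mapping.keys g \<subseteq> carrier B \<times> carrier B" "p = tens_cls A M M g"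
    using P.carrier_tensor_E[OF assms(1)] by auto
  show "Poly_Mapping.keys f \<subseteq> carrier B \<times> carrier B"
    using P.tens_cls_mem_keys[of f g] assms(2) g by simp
  show "tens_cls A M M f = p"
    using P.tens_cls_eq_of_mem[of f g] assms(2) g by simp
qed

lemma P_nonempty: "p \<in> carrier P \<Longrightarrow> \<exists>f. f \<in> p"
  using P.carrier_tensor_E[of p] P.tens_cls_self by metis

end

section \<open>The coproduct and the antipode\<close>

context dual_bimodules
begin

interpretation HH: H_relations K A Om X D H hel hbar hxw hwx
  by (rule H_relations_H)

notation HH.tn (infixl \<open>\<diamondop>\<close> 68)

text \<open>Left multiplication by the coproduct, obtained from initiality of \<open>H\<close>. The coproduct itself is
  its value at \<open>1 \<diamondop> 1\<close>, so no product on the tensor square has to be constructed.\<close>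

definition lam where
  "lam = (SOME \<Phi>. \<Phi> \<in> ring_hom H HH.EndP \<and>
     (\<forall>a\<in>carrier A. \<Phi> (hel a) = HH.el_mul a \<and> \<Phi> (hbar a) = HH.bar_mul a) \<and>
     (\<forall>x\<in>carrier X. \<forall>w\<in>carrier Om. \<Phi> (hxw x w) = HH.xw_mul x w \<and> \<Phi> (hwx w x) = HH.wx_mul w x))"

lemma lam_hom: "lam \<in> ring_hom H HH.EndP"
  and lam_gens: "a \<in> carrier A \<Longrightarrow> lam (hel a) = HH.el_mul a" "a \<in> carrier A \<Longrightarrow> lam (hbar a) = HH.bar_mul a"
    "\<lbrakk>x \<in> carrier X; w \<in> carrier Om\<rbrakk> \<Longrightarrow> lam (hxw x w) = HH.xw_mul x w"
    "\<lbrakk>x \<in> carrier X; w \<in> carrier Om\<rbrakk> \<Longrightarrow> lam (hwx w x) = HH.wx_mul w x"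
proof -
  obtain \<Phi> where "\<Phi> \<in> ring_hom H HH.EndP"
    "\<And>a. a \<in> carrier A \<Longrightarrow> \<Phi> (hel a) = HH.el_mul a" "\<And>a. a \<in> carrier A \<Longrightarrow> \<Phi> (hbar a) = HH.bar_mul a"
    "\<And>x w. \<lbrakk>x \<in> carrier X; w \<in> carrier Om\<rbrakk> \<Longrightarrow> \<Phi> (hxw x w) = HH.xw_mul x w"
    "\<And>x w. \<lbrakk>x \<in> carrier X; w \<in> carrier Om\<rbrakk> \<Longrightarrow> \<Phi> (hwx w x) = HH.wx_mul w x"
    by (rule H_relations.H_lift[OF HH.H_relations_EndP]) (rule_tac that)
  then have "\<exists>\<Phi>. \<Phi> \<in> ring_hom H HH.EndP \<and>
     (\<forall>a\<in>carrier A. \<Phi> (hel a) = HH.el_mul a \<and> \<Phi> (hbar a) = HH.bar_mul a) \<and>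
     (\<forall>x\<in>carrier X. \<forall>w\<in>carrier Om. \<Phi> (hxw x w) = HH.xw_mul x w \<and> \<Phi> (hwx w x) = HH.wx_mul w x)"
    by blast
  from someI_ex[OF this] show "lam \<in> ring_hom H HH.EndP"
    "a \<in> carrier A \<Longrightarrow> lam (hel a) = HH.el_mul a" "a \<in> carrier A \<Longrightarrow> lam (hbar a) = HH.bar_mul a"
    "\<lbrakk>x \<in> carrier X; w \<in> carrier Om\<rbrakk> \<Longrightarrow> lam (hxw x w) = HH.xw_mul x w"
    "\<lbrakk>x \<in> carrier X; w \<in> carrier Om\<rbrakk> \<Longrightarrow> lam (hwx w x) = HH.wx_mul w x"
    unfolding lam_def by blast+
qed

lemma lam_additive: "b \<in> carrier H \<Longrightarrow> additive_map HH.P HH.P (lam b)"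
  using HH.endo_additive[OF ring_hom_closed[OF lam_hom]] .

lemma lam_closed: "\<lbrakk>b \<in> carrier H; p \<in> carrier HH.P\<rbrakk> \<Longrightarrow> lam b p \<in> carrier HH.P"
  using additive_map_closed[OF lam_additive] .

lemma lam_mult: "\<lbrakk>b \<in> carrier H; c \<in> carrier H; p \<in> carrier HH.P\<rbrakk> \<Longrightarrow> lam (b \<otimes>\<^bsub>H\<^esub> c) p = lam b (lam c p)"
  by (simp add: ring_hom_mult[OF lam_hom] endo_ring_simps(2))

lemma lam_one: "p \<in> carrier HH.P \<Longrightarrow> lam \<one>\<^bsub>H\<^esub> p = p"
  by (simp add: ring_hom_one[OF lam_hom] endo_ring_simps(4))

lemma lam_additive_left: "p \<in> carrier HH.P \<Longrightarrow> additive_map H HH.P (\<lambda>b. lam b p)"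
  by (rule additive_mapI) (simp_all add: lam_closed ring_hom_add[OF lam_hom] endo_ring_simps(3))

lemmas lam_minus_left = additive_map_minus[OF H.is_abelian_group HH.P.abelian_group_axioms lam_additive_left]
lemmas lam_sum = additive_map_finsum[OF HH.P.abelian_group_axioms HH.P.abelian_group_axioms lam_additive]
lemmas rmul_minus = additive_map_minus[OF HH.P.abelian_group_axioms HH.P.abelian_group_axioms HH.rmul_additive]
lemmas mul_defs = HH.el_mul_def HH.bar_mul_def HH.xw_mul_def HH.wx_mul_def
lemmas takeuchi_gens = HH.takeuchi_el HH.takeuchi_bar HH.takeuchi_xw HH.takeuchi_wx

lemma lam_rmul:
  assumes "b \<in> carrier H" and gh: "g \<in> carrier H" "h \<in> carrier H" and p: "p \<in> carrier HH.P"
  shows "lam b (HH.rmul g h p) = HH.rmul g h (lam b p)"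
  using assms(1) p
\<comment> \<open>For a product, the hypothesis on the left factor \<open>b\<close> is used at
  \<open>lam c p\<close>.\<close>
proof (induction arbitrary: p rule: H_induct)
  case (minus b c)
  then show ?case using gh by (simp add: lam_minus_left HH.rmul_closed rmul_minus lam_closed)
next
  case (mult b c)
  then show ?case using gh by (simp add: lam_mult HH.rmul_closed lam_closed)
qed (use gh in \<open>simp_all only: lam_gens mul_defs HH.lmul_on_rmul[OF takeuchi_gens(1)]
      HH.lmul_on_rmul[OF takeuchi_gens(2)] HH.lmul_on_rmul[OF takeuchi_gens(3)] HH.lmul_on_rmul[OF takeuchi_gens(4)]\<close>)

text \<open>Restricted because \<open>is_H_coproduct\<close> fixes a function through an extensional
  function space, and \<open>THE\<close> needs a unique one.\<close>

definition cop where "cop = (\<lambda>b\<in>carrier H. lam b (\<one>\<^bsub>H\<^esub> \<diamondop> \<one>\<^bsub>H\<^esub>))"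

lemma cop_closed: "b \<in> carrier H \<Longrightarrow> cop b \<in> carrier HH.P"
  by (simp add: cop_def lam_closed)

text \<open>In Sweedler notation the value is b_1 g \<diamondop> b_2 h, which justifies reading
  \<open>lam b\<close> as left multiplication by the coproduct.\<close>

lemma lam_tens: "\<lbrakk>b \<in> carrier H; g \<in> carrier H; h \<in> carrier H\<rbrakk> \<Longrightarrow> lam b (g \<diamondop> h) = HH.rmul g h (cop b)"
  by (simp add: cop_def lam_rmul[symmetric] HH.rmul_tens)

lemma is_H_coproduct_cop: "is_H_coproduct K A Om X D cop"
  unfolding is_H_coproduct_def Let_def H_bimod_def
proof (intro conjI ballI)
  show "cop \<in> carrier H \<rightarrow>\<^sub>E carrier HH.P"
    using cop_closed by (auto simp: cop_def)
  show "cop (m \<oplus>\<^bsub>H\<^esub> n) = cop m \<oplus>\<^bsub>HH.P\<^esub> cop n" if "m \<in> carrier H" "n \<in> carrier H" for m n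
    using that by (simp add: cop_def additive_map_add[OF lam_additive_left])
  show "cop (hel a \<otimes>\<^bsub>H\<^esub> hbar b) = hel a \<diamondop> hbar b" if "a \<in> carrier A" "b \<in> carrier A" for a b
    using that by (simp add: cop_def lam_mult lam_gens HH.bar_mul_tens HH.el_mul_tens HH.cl)
  show "cop (hxw x w) = (\<Oplus>\<^bsub>HH.P\<^esub>i\<in>{..<coev_len D}. hxw x (coev_w D i) \<diamondop> hxw (coev_x D i) w)"
    if "x \<in> carrier X" "w \<in> carrier Om" for x w
    using that by (simp add: cop_def lam_gens HH.xw_mul_tens HH.cl) (rule HH.P_sum_cong; simp add: HH.cl)
  show "cop (hwx w x) = (\<Oplus>\<^bsub>HH.P\<^esub>j\<in>{..<coevu_len D}. hwx w (coevu_y D j) \<diamondop> hwx (coevu_r D j) x)"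
    if "w \<in> carrier Om" "x \<in> carrier X" for x w
    using that by (simp add: cop_def lam_gens HH.wx_mul_tens HH.cl) (rule HH.P_sum_cong; simp add: HH.cl)
next
  fix m n f g assume m: "m \<in> carrier H" and n: "n \<in> carrier H" and f: "f \<in> cop m" and g: "g \<in> cop n"
  note f' = HH.P_representative[OF cop_closed[OF m] f] and g' = HH.P_representative[OF cop_closed[OF n] g]
  let ?h = "\<lambda>(m1, m2) (n1, n2). (m1 \<otimes>\<^bsub>H\<^esub> n1, m2 \<otimes>\<^bsub>H\<^esub> n2)"
  let ?F = "\<lambda>(x, y). frag_extend (\<lambda>(c, d). frag_of (c \<otimes>\<^bsub>H\<^esub> x, d \<otimes>\<^bsub>H\<^esub> y)) f"
  \<comment> \<open>Reading the double sum with \<open>g\<close> outermost, the inner sum at (x, y)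
    is \<open>f\<close> multiplied by (x, y) on the right, hence a representative of
    \<open>lam m (x \<diamondop> y)\<close>.\<close>
  have eq: "frag_bilin ?h f g = frag_extend ?F g"
    using g'(1)
  proof (induction g rule: frag_induction)
    case (one s)
    then show ?case by (cases s) (simp add: frag_bilin_def case_prod_unfold)
  qed (simp_all add: frag_bilin_simps frag_extend_diff)
  have "tens_cls A HH.M HH.M (frag_extend ?F g) = lam m (tens_cls A HH.M HH.M g)"
  proof (rule HH.tens_cls_frag_extend[OF g'(1) lam_additive[OF m]])
    fix x y assume xy: "x \<in> carrier H" "y \<in> carrier H"
    show "Poly_Mapping.keys (?F (x, y)) \<subseteq> carrier H \<times> carrier H"
      unfolding case_prod_conv
      by (rule order_trans[OF keys_frag_extend]) (use f'(1) xy in \<open>auto simp: case_prod_unfold\<close>)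
    show "tens_cls A HH.M HH.M (?F (x, y)) = lam m (x \<diamondop> y)"
      using xy f' by (simp add: HH.tens_cls_rmul lam_tens m)
  qed
  \<comment> \<open>Multiplicativity of \<open>lam\<close>, evaluated at the unit tensor.\<close>
  moreover have "cop (m \<otimes>\<^bsub>H\<^esub> n) = lam m (cop n)"
    using m n by (simp add: cop_def lam_mult)
  ultimately show "cop (m \<otimes>\<^bsub>H\<^esub> n) = tens_cls A HH.M HH.M (frag_bilin ?h f g)"
    by (simp only: eq g'(2))
qed

lemma is_H_coproductD:
  assumes "is_H_coproduct K A Om X D \<Delta>"
  shows "\<Delta> \<in> carrier H \<rightarrow>\<^sub>E carrier HH.P"
    and "additive_map H HH.P \<Delta>"
    and "\<lbrakk>a \<in> carrier A; b \<in> carrier A\<rbrakk> \<Longrightarrow> \<Delta> (hel a \<otimes>\<^bsub>H\<^esub> hbar b) = hel a \<diamondop> hbar b"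
    and "\<lbrakk>x \<in> carrier X; w \<in> carrier Om\<rbrakk> \<Longrightarrow>
      \<Delta> (hxw x w) = (\<Oplus>\<^bsub>HH.P\<^esub>i\<in>{..<coev_len D}. hxw x (coev_w D i) \<diamondop> hxw (coev_x D i) w)"
    and "\<lbrakk>x \<in> carrier X; w \<in> carrier Om\<rbrakk> \<Longrightarrow>
      \<Delta> (hwx w x) = (\<Oplus>\<^bsub>HH.P\<^esub>j\<in>{..<coevu_len D}. hwx w (coevu_y D j) \<diamondop> hwx (coevu_r D j) x)"
    and "\<lbrakk>m \<in> carrier H; n \<in> carrier H; f \<in> \<Delta> m; g \<in> \<Delta> n\<rbrakk> \<Longrightarrow> \<Delta> (m \<otimes>\<^bsub>H\<^esub> n) = tens_cls A HH.M HH.M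
      (frag_bilin (\<lambda>(m1, m2) (n1, n2). (m1 \<otimes>\<^bsub>H\<^esub> n1, m2 \<otimes>\<^bsub>H\<^esub> n2)) f g)"
proof -
  note d = assms[unfolded is_H_coproduct_def Let_def H_bimod_def]
  note d1 = d[THEN conjunct1] and d' = d[THEN conjunct2]
  note d2 = d'[THEN conjunct1] and d'' = d'[THEN conjunct2]
  note d3 = d''[THEN conjunct1] and d''' = d''[THEN conjunct2]
  note d4 = d'''[THEN conjunct1] and d5 = d'''[THEN conjunct2, THEN conjunct1]
    and d6 = d'''[THEN conjunct2, THEN conjunct2]
  show "\<Delta> \<in> carrier H \<rightarrow>\<^sub>E carrier HH.P" by (rule d1)
  show "additive_map H HH.P \<Delta>"
    by (rule additive_mapI, rule PiE_mem[OF d1], assumption, rule d2[rule_format])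
  show "\<lbrakk>a \<in> carrier A; b \<in> carrier A\<rbrakk> \<Longrightarrow> \<Delta> (hel a \<otimes>\<^bsub>H\<^esub> hbar b) = hel a \<diamondop> hbar b"
    by (rule d3[rule_format])
  show "\<lbrakk>x \<in> carrier X; w \<in> carrier Om\<rbrakk> \<Longrightarrow>
      \<Delta> (hxw x w) = (\<Oplus>\<^bsub>HH.P\<^esub>i\<in>{..<coev_len D}. hxw x (coev_w D i) \<diamondop> hxw (coev_x D i) w)"
    by (rule d4[rule_format])
  show "\<lbrakk>x \<in> carrier X; w \<in> carrier Om\<rbrakk> \<Longrightarrow>
      \<Delta> (hwx w x) = (\<Oplus>\<^bsub>HH.P\<^esub>j\<in>{..<coevu_len D}. hwx w (coevu_y D j) \<diamondop> hwx (coevu_r D j) x)"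
    by (rule d5[rule_format])
  show "\<lbrakk>m \<in> carrier H; n \<in> carrier H; f \<in> \<Delta> m; g \<in> \<Delta> n\<rbrakk> \<Longrightarrow> \<Delta> (m \<otimes>\<^bsub>H\<^esub> n) = tens_cls A HH.M HH.M
      (frag_bilin (\<lambda>(m1, m2) (n1, n2). (m1 \<otimes>\<^bsub>H\<^esub> n1, m2 \<otimes>\<^bsub>H\<^esub> n2)) f g)"
    by (rule d6[rule_format])
qed

lemma H_coproduct_eq: "H_coproduct K A Om X D = cop"
  unfolding H_coproduct_def
proof (rule the_equality, rule is_H_coproduct_cop)
  fix \<Delta> assume d: "is_H_coproduct K A Om X D \<Delta>"
  note dd = is_H_coproductD[OF d] and dc = is_H_coproductD[OF is_H_coproduct_cop]
  have "\<Delta> b = cop b" if "b \<in> carrier H" for b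
    using that
  proof (induction rule: H_induct)
    case (el a)
    \<comment> \<open>The coproduct is prescribed on products of \<open>hel a\<close> and
      \<open>hbar b\<close>, so the other factor is taken to be the unit.\<close>
    then show ?case using dd(3)[of a "\<one>\<^bsub>A\<^esub>"] dc(3)[of a "\<one>\<^bsub>A\<^esub>"] by (simp add: HH.bar_one hel_closed)
  next
    case (bar a)
    then show ?case using dd(3)[of "\<one>\<^bsub>A\<^esub>" a] dc(3)[of "\<one>\<^bsub>A\<^esub>" a] by (simp add: HH.el_one hbar_closed)
  next
    case (minus g h)
    then show ?case
      by (simp add: additive_map_minus[OF H.is_abelian_group HH.P.abelian_group_axioms dd(2)]
          additive_map_minus[OF H.is_abelian_group HH.P.abelian_group_axioms dc(2)])
  next
    case (mult m n)
    \<comment> \<open>Multiplicativity is stated for representatives. Since classes are nonempty, a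
      pair exists, and by the induction hypotheses it represents the values of both
      coproducts.\<close>
    obtain f g where fg: "f \<in> cop m" "g \<in> cop n"
      using HH.P_nonempty cop_closed mult(1,2) by meson
    then show ?case using dd(6)[OF mult(1,2), of f g] dc(6)[OF mult(1,2) fg] mult by simp
  qed (simp_all add: dd dc)
  then show "\<Delta> = cop"
    by (intro PiE_ext[OF dd(1) dc(1)]) simp
qed

section \<open>The antipode and its two identities\<close>

lemma antipode_exists:
  obtains S where "S \<in> ring_hom H (opp H)"
    "\<And>a. a \<in> carrier A \<Longrightarrow> S (hel a) = hbar a" "\<And>a. a \<in> carrier A \<Longrightarrow> S (hbar a) = hel a"
    "\<And>x w. \<lbrakk>x \<in> carrier X; w \<in> carrier Om\<rbrakk> \<Longrightarrow> S (hxw x w) = hwx w x"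
    "\<And>x w. \<lbrakk>x \<in> carrier X; w \<in> carrier Om\<rbrakk> \<Longrightarrow> S (hwx w x) = hxw x w"
  by (rule H_relations.H_lift[OF HH.H_relations_opp]) (rule_tac that)

text \<open>For linearity of the antipode over the field: reversing a product leaves the scalar on
  the right, from where it must return to the left.\<close>

lemma scalar_central_H: "\<lbrakk>k \<in> carrier K; b \<in> carrier H\<rbrakk> \<Longrightarrow> hel (scalar A k) \<otimes>\<^bsub>H\<^esub> b = b \<otimes>\<^bsub>H\<^esub> hel (scalar A k)"
proof -
  assume k: "k \<in> carrier K" and b: "b \<in> carrier H"
  let ?s = "hel (scalar A k)"
  note sc = Om.scalar_closed[OF k] and scl = hel_closed[OF Om.scalar_closed[OF k]]
  show "?s \<otimes>\<^bsub>H\<^esub> b = b \<otimes>\<^bsub>H\<^esub> ?s"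
    using b
  proof (induction rule: H_induct)
    case (el a)
    then show ?case using sc k by (simp add: ring_hom_mult[OF HH.el, symmetric] Om.scalar_commute)
  next
    case (bar a)
    then show ?case using sc by (simp add: HH.el_bar)
  next
    case (xw x w)
    then show ?case using sc k by (simp add: HH.el_xw HH.xw_el X.scalar_central)
  next
    case (wx x w)
    then show ?case using sc k by (simp add: HH.el_wx HH.wx_el Om.scalar_central)
  next
    case (minus g h)
    then show ?case using scl by (simp add: H.minus_eq H.r_distr H.l_distr H.r_minus H.l_minus)
  next
    case (mult g h)
    then show ?case using scl by (metis H.m_assoc)
  qed
qed

context
  fixes S
  assumes S_hom: "S \<in> ring_hom H (opp H)"
    and S_gens: "\<And>a. a \<in> carrier A \<Longrightarrow> S (hel a) = hbar a" "\<And>a. a \<in> carrier A \<Longrightarrow> S (hbar a) = hel a"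
      "\<And>x w. \<lbrakk>x \<in> carrier X; w \<in> carrier Om\<rbrakk> \<Longrightarrow> S (hxw x w) = hwx w x"
      "\<And>x w. \<lbrakk>x \<in> carrier X; w \<in> carrier Om\<rbrakk> \<Longrightarrow> S (hwx w x) = hxw x w"
begin

lemma S_closed: "b \<in> carrier H \<Longrightarrow> S b \<in> carrier H"
  using ring_hom_closed[OF S_hom] by simp

lemma S_mult: "\<lbrakk>b \<in> carrier H; c \<in> carrier H\<rbrakk> \<Longrightarrow> S (b \<otimes>\<^bsub>H\<^esub> c) = S c \<otimes>\<^bsub>H\<^esub> S b"
  using ring_hom_mult[OF S_hom] by simp

lemma S_one: "S \<one>\<^bsub>H\<^esub> = \<one>\<^bsub>H\<^esub>"
  using ring_hom_one[OF S_hom] by simp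

lemma S_additive: "additive_map H H S"
  using additive_map_ring_hom[OF S_hom] by (simp add: additive_map_opp)

lemmas S_minus = additive_map_minus[OF H.is_abelian_group H.is_abelian_group S_additive]

text \<open>\<open>S\<close> applied twice preserves products and differences and fixes every
  generator.\<close>

lemma S_involutive: "b \<in> carrier H \<Longrightarrow> S (S b) = b"
  by (induction rule: H_induct) (simp_all add: S_gens S_minus S_mult S_closed)

lemma S_unique:
  assumes "S' \<in> ring_hom H (opp H)" "H_antipode_gens K A Om X D S'" "b \<in> carrier H"
  shows "S' b = S b"
proof -
  have add: "additive_map H H S'"
    using additive_map_ring_hom[OF assms(1)] by (simp add: additive_map_opp)
  show ?thesis
    using assms(3)
  proof (induction rule: H_induct)
    case (minus g h)
    then show ?case
      by (simp add: S_minus additive_map_minus[OF H.is_abelian_group H.is_abelian_group add])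
  next
    case (mult g h)
    then show ?case using ring_hom_mult[OF assms(1)] by (simp add: S_mult)
  qed (use assms(2) in \<open>simp_all add: H_antipode_gens_def S_gens\<close>)
qed

lemma lam_lmul_sum:
  assumes "b \<in> carrier H" "\<And>i. i < n \<Longrightarrow> f i \<in> carrier HH.P"
  shows "lam b (\<Oplus>\<^bsub>HH.P\<^esub>i\<in>{..<n::nat}. f i) = (\<Oplus>\<^bsub>HH.P\<^esub>i\<in>{..<n}. lam b (f i))"
  by (rule lam_sum[OF assms(1)]) (use assms(2) in auto)

text \<open>In the notation of the paper, \<open>\<Psi>(g \<diamondop> h) = S(g)\<^sub>1 h \<diamondop> S(g)\<^sub>2\<close>.\<close>

lemma BS_left:
  obtains \<Psi> where "additive_map HH.P HH.P \<Psi>"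
    "\<And>g h. \<lbrakk>g \<in> carrier H; h \<in> carrier H\<rbrakk> \<Longrightarrow> \<Psi> (g \<diamondop> h) = lam (S g) (h \<diamondop> \<one>\<^bsub>H\<^esub>)"
    "\<And>b. b \<in> carrier H \<Longrightarrow> \<Psi> (cop b) = \<one>\<^bsub>H\<^esub> \<diamondop> S b"
proof -
  have l: "additive_map H HH.P (\<lambda>g. lam (S g) (h \<diamondop> \<one>\<^bsub>H\<^esub>))" if "h \<in> carrier H" for h
    by (rule additive_map_comp[OF S_additive lam_additive_left]) (simp add: that)
  have r: "additive_map H HH.P (\<lambda>h. lam (S g) (h \<diamondop> \<one>\<^bsub>H\<^esub>))" if "g \<in> carrier H" for g
    by (rule additive_map_comp[OF HH.tn_left lam_additive]) (simp_all add: that S_closed)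
  \<comment> \<open>\<open>S\<close> turns \<open>hbar s\<close> on the left into
    \<open>hel s\<close> on the right, whose operator multiplies the first tensor factor, that is
    \<open>h\<close>.\<close>
  have b: "lam (S (hbar s \<otimes>\<^bsub>H\<^esub> g)) (h \<diamondop> \<one>\<^bsub>H\<^esub>) = lam (S g) ((hel s \<otimes>\<^bsub>H\<^esub> h) \<diamondop> \<one>\<^bsub>H\<^esub>)"
    if "g \<in> carrier H" "s \<in> carrier A" "h \<in> carrier H" for g s h
    using that by (simp add: S_mult S_gens S_closed HH.cl lam_mult lam_gens HH.el_mul_tens)
  obtain \<Psi> where \<Psi>: "additive_map HH.P HH.P \<Psi>"
    "\<And>g h. \<lbrakk>g \<in> carrier H; h \<in> carrier H\<rbrakk> \<Longrightarrow> \<Psi> (g \<diamondop> h) = lam (S g) (h \<diamondop> \<one>\<^bsub>H\<^esub>)"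
    using HH.P_lift[OF HH.P.abelian_group_axioms l r b] by blast
  \<comment> \<open>Since \<open>S\<close> reverses products, \<open>lam (S g)\<close> can be pulled
    out of the sum. A generator is thereby reduced to the case where \<open>g\<close> is one, the
    assumption \<open>sum\<close>.\<close>
  have gen: "\<Psi> (lam b p) = HH.rmul \<one>\<^bsub>H\<^esub> (S b) (\<Psi> p)"
    if b: "b \<in> carrier H" and lamb: "lam b = HH.lmul_on n u v" and t: "HH.takeuchi n u v"
      and sum: "\<And>h. h \<in> carrier H \<Longrightarrow> (\<Oplus>\<^bsub>HH.P\<^esub>i\<in>{..<n}. lam (S (u i)) ((v i \<otimes>\<^bsub>H\<^esub> h) \<diamondop> \<one>\<^bsub>H\<^esub>)) = h \<diamondop> S b"
      and p: "p \<in> carrier HH.P" for b n u v p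
  proof (rule HH.P_eqI[where p = p])
    note uv = HH.takeuchi_closed[OF t]
    show "additive_map HH.P HH.P (\<lambda>p. \<Psi> (lam b p))"
      by (rule additive_map_comp[OF lam_additive[OF b] \<Psi>(1)])
    show "additive_map HH.P HH.P (\<lambda>p. HH.rmul \<one>\<^bsub>H\<^esub> (S b) (\<Psi> p))"
      by (rule additive_map_comp[OF \<Psi>(1) HH.rmul_additive]) (simp_all add: b S_closed)
    fix g h assume gh: "g \<in> carrier H" "h \<in> carrier H"
    have "\<Psi> (lam b (g \<diamondop> h)) = (\<Oplus>\<^bsub>HH.P\<^esub>i\<in>{..<n}. \<Psi> ((u i \<otimes>\<^bsub>H\<^esub> g) \<diamondop> (v i \<otimes>\<^bsub>H\<^esub> h)))"
      unfolding lamb HH.lmul_on_tens[OF t gh]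
      by (rule additive_map_finsum[OF HH.P.abelian_group_axioms HH.P.abelian_group_axioms \<Psi>(1)]) (use gh uv in auto)
    also have "\<dots> = (\<Oplus>\<^bsub>HH.P\<^esub>i\<in>{..<n}. lam (S g) (lam (S (u i)) ((v i \<otimes>\<^bsub>H\<^esub> h) \<diamondop> \<one>\<^bsub>H\<^esub>)))"
      by (rule HH.P_sum_cong) (use gh uv in \<open>simp_all add: \<Psi>(2) S_mult S_closed lam_mult lam_closed\<close>)
    also have "\<dots> = lam (S g) (h \<diamondop> S b)"
      using gh uv by (simp add: lam_lmul_sum[symmetric] S_closed lam_closed sum)
    also have "\<dots> = HH.rmul \<one>\<^bsub>H\<^esub> (S b) (\<Psi> (g \<diamondop> h))"
      using gh b by (simp add: \<Psi>(2) lam_rmul[symmetric] S_closed HH.rmul_tens)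
    finally show "\<Psi> (lam b (g \<diamondop> h)) = HH.rmul \<one>\<^bsub>H\<^esub> (S b) (\<Psi> (g \<diamondop> h))" .
  qed (rule p)
  note \<Psi>_closed = additive_map_closed[OF \<Psi>(1)]
    and \<Psi>_minus = additive_map_minus[OF HH.P.abelian_group_axioms HH.P.abelian_group_axioms \<Psi>(1)]
  \<comment> \<open>All \<open>p\<close> are needed at once: for a product, the hypothesis on the
    left factor \<open>g\<close> is applied at \<open>lam h p\<close>.\<close>
  have claim: "\<Psi> (lam b p) = HH.rmul \<one>\<^bsub>H\<^esub> (S b) (\<Psi> p)" if "b \<in> carrier H" "p \<in> carrier HH.P" for b p
    using that
  proof (induction arbitrary: p rule: H_induct)
    case (el a)
    show ?case
      by (rule gen[OF _ lam_gens(1)[unfolded HH.el_mul_def] HH.takeuchi_el])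
        (use el in \<open>simp_all add: HH.cl S_gens lam_gens HH.bar_mul_tens HH.sum_lessThan_1 del: One_nat_def\<close>)
  next
    case (bar a)
    \<comment> \<open>Balancing moves \<open>hbar a\<close> across the tensor sign, where it becomes
      \<open>hel a\<close>, the value of \<open>S\<close> on \<open>hbar a\<close>.\<close>
    show ?case
      by (rule gen[OF _ lam_gens(2)[unfolded HH.bar_mul_def] HH.takeuchi_bar])
        (use bar in \<open>simp_all add: HH.cl S_gens S_one lam_one HH.sum_lessThan_1 HH.tn_balanced[of _ a "\<one>\<^bsub>H\<^esub>", simplified]
          del: One_nat_def\<close>)
  next
    case (xw x w)
    have "(\<Oplus>\<^bsub>HH.P\<^esub>i\<in>{..<coev_len D}. lam (S (hxw x (coev_w D i))) ((hxw (coev_x D i) w \<otimes>\<^bsub>H\<^esub> h) \<diamondop> \<one>\<^bsub>H\<^esub>)) = h \<diamondop> hwx w x"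
      if "h \<in> carrier H" for h
    proof -
      have "(\<Oplus>\<^bsub>HH.P\<^esub>i\<in>{..<coev_len D}. lam (S (hxw x (coev_w D i))) ((hxw (coev_x D i) w \<otimes>\<^bsub>H\<^esub> h) \<diamondop> \<one>\<^bsub>H\<^esub>))
          = (\<Oplus>\<^bsub>HH.P\<^esub>i\<in>{..<coev_len D}. HH.wx_mul (coev_w D i) x ((hxw (coev_x D i) w \<otimes>\<^bsub>H\<^esub> h) \<diamondop> \<one>\<^bsub>H\<^esub>))"
        by (rule HH.P_sum_cong)
          (use xw that in \<open>simp_all add: HH.cl S_gens lam_gens endo_closed[OF HH.wx_mul_endo]\<close>)
      then show ?thesis using HH.wx_mul_xw_tens[OF xw(2,1) that, of "\<one>\<^bsub>H\<^esub>"] xw by (simp add: HH.cl)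
    qed
    then show ?case
      by (intro gen[OF _ lam_gens(3)[unfolded HH.xw_mul_def] HH.takeuchi_xw])
        (use xw in \<open>simp_all add: HH.cl S_gens\<close>)
  next
    case (wx x w)
    have "(\<Oplus>\<^bsub>HH.P\<^esub>j\<in>{..<coevu_len D}. lam (S (hwx w (coevu_y D j))) ((hwx (coevu_r D j) x \<otimes>\<^bsub>H\<^esub> h) \<diamondop> \<one>\<^bsub>H\<^esub>)) = h \<diamondop> hxw x w"
      if "h \<in> carrier H" for h
    proof -
      have "(\<Oplus>\<^bsub>HH.P\<^esub>j\<in>{..<coevu_len D}. lam (S (hwx w (coevu_y D j))) ((hwx (coevu_r D j) x \<otimes>\<^bsub>H\<^esub> h) \<diamondop> \<one>\<^bsub>H\<^esub>))
          = (\<Oplus>\<^bsub>HH.P\<^esub>j\<in>{..<coevu_len D}. HH.xw_mul (coevu_y D j) w ((hwx (coevu_r D j) x \<otimes>\<^bsub>H\<^esub> h) \<diamondop> \<one>\<^bsub>H\<^esub>))"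
        by (rule HH.P_sum_cong)
          (use wx that in \<open>simp_all add: HH.cl S_gens lam_gens endo_closed[OF HH.xw_mul_endo]\<close>)
      then show ?thesis using HH.xw_mul_wx_tens[OF wx(2,1) that, of "\<one>\<^bsub>H\<^esub>"] wx by (simp add: HH.cl)
    qed
    then show ?case
      by (intro gen[OF _ lam_gens(4)[unfolded HH.wx_mul_def] HH.takeuchi_wx])
        (use wx in \<open>simp_all add: HH.cl S_gens\<close>)
  next
    case (minus g h)
    then show ?case
      using additive_map_minus[OF H.is_abelian_group HH.P.abelian_group_axioms HH.rmul_additive_snd[OF H.one_closed \<Psi>_closed]]
      by (simp add: lam_minus_left \<Psi>_minus lam_closed S_minus S_closed)
  next
    case (mult g h)
    then show ?case by (simp add: lam_mult lam_closed HH.rmul_rmul S_closed S_mult \<Psi>_closed)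
  qed
  have "\<Psi> (cop b) = \<one>\<^bsub>H\<^esub> \<diamondop> S b" if "b \<in> carrier H" for b
    using that claim[OF that, of "\<one>\<^bsub>H\<^esub> \<diamondop> \<one>\<^bsub>H\<^esub>"] by (simp add: cop_def \<Psi>(2) S_one lam_one HH.rmul_tens S_closed)
  with that \<Psi> show ?thesis by blast
qed

text \<open>Here \<open>\<Psi>(g \<diamondop> h) = S(h)\<^sub>1 \<diamondop> S(h)\<^sub>2 g\<close>; recall that \<open>S\<close> is its own inverse.\<close>

lemma BS_right:
  obtains \<Psi> where "additive_map HH.P HH.P \<Psi>"
    "\<And>g h. \<lbrakk>g \<in> carrier H; h \<in> carrier H\<rbrakk> \<Longrightarrow> \<Psi> (g \<diamondop> h) = lam (S h) (\<one>\<^bsub>H\<^esub> \<diamondop> g)"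
    "\<And>b. b \<in> carrier H \<Longrightarrow> \<Psi> (cop b) = S b \<diamondop> \<one>\<^bsub>H\<^esub>"
proof -
  have l: "additive_map H HH.P (\<lambda>g. lam (S h) (\<one>\<^bsub>H\<^esub> \<diamondop> g))" if "h \<in> carrier H" for h
    by (rule additive_map_comp[OF HH.tn_right lam_additive]) (simp_all add: that S_closed)
  have r: "additive_map H HH.P (\<lambda>h. lam (S h) (\<one>\<^bsub>H\<^esub> \<diamondop> g))" if "g \<in> carrier H" for g
    by (rule additive_map_comp[OF S_additive lam_additive_left]) (simp add: that)
  \<comment> \<open>\<open>S\<close> sends \<open>hel s\<close> on the left to \<open>hbar s\<close>
    on the right, whose operator acts on the second tensor factor, where \<open>g\<close> now
    stands.\<close>
  have b: "lam (S h) (\<one>\<^bsub>H\<^esub> \<diamondop> (hbar s \<otimes>\<^bsub>H\<^esub> g)) = lam (S (hel s \<otimes>\<^bsub>H\<^esub> h)) (\<one>\<^bsub>H\<^esub> \<diamondop> g)"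
    if "g \<in> carrier H" "s \<in> carrier A" "h \<in> carrier H" for g s h
    using that by (simp add: S_mult S_gens S_closed HH.cl lam_mult lam_gens HH.bar_mul_tens)
  obtain \<Psi> where \<Psi>: "additive_map HH.P HH.P \<Psi>"
    "\<And>g h. \<lbrakk>g \<in> carrier H; h \<in> carrier H\<rbrakk> \<Longrightarrow> \<Psi> (g \<diamondop> h) = lam (S h) (\<one>\<^bsub>H\<^esub> \<diamondop> g)"
    using HH.P_lift[OF HH.P.abelian_group_axioms l r b] by blast
  \<comment> \<open>The roles of the two legs are exchanged: \<open>S\<close> meets the
    \<open>v i\<close>, the \<open>u i\<close> multiply \<open>g\<close>, and
    \<open>lam (S h)\<close> is what leaves the sum.\<close>
  have gen: "\<Psi> (lam b p) = HH.rmul (S b) \<one>\<^bsub>H\<^esub> (\<Psi> p)"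
    if b: "b \<in> carrier H" and lamb: "lam b = HH.lmul_on n u v" and t: "HH.takeuchi n u v"
      and sum: "\<And>g. g \<in> carrier H \<Longrightarrow> (\<Oplus>\<^bsub>HH.P\<^esub>i\<in>{..<n}. lam (S (v i)) (\<one>\<^bsub>H\<^esub> \<diamondop> (u i \<otimes>\<^bsub>H\<^esub> g))) = S b \<diamondop> g"
      and p: "p \<in> carrier HH.P" for b n u v p
  proof (rule HH.P_eqI[where p = p])
    note uv = HH.takeuchi_closed[OF t]
    show "additive_map HH.P HH.P (\<lambda>p. \<Psi> (lam b p))"
      by (rule additive_map_comp[OF lam_additive[OF b] \<Psi>(1)])
    show "additive_map HH.P HH.P (\<lambda>p. HH.rmul (S b) \<one>\<^bsub>H\<^esub> (\<Psi> p))"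
      by (rule additive_map_comp[OF \<Psi>(1) HH.rmul_additive]) (simp_all add: b S_closed)
    fix g h assume gh: "g \<in> carrier H" "h \<in> carrier H"
    have "\<Psi> (lam b (g \<diamondop> h)) = (\<Oplus>\<^bsub>HH.P\<^esub>i\<in>{..<n}. \<Psi> ((u i \<otimes>\<^bsub>H\<^esub> g) \<diamondop> (v i \<otimes>\<^bsub>H\<^esub> h)))"
      unfolding lamb HH.lmul_on_tens[OF t gh]
      by (rule additive_map_finsum[OF HH.P.abelian_group_axioms HH.P.abelian_group_axioms \<Psi>(1)]) (use gh uv in auto)
    also have "\<dots> = (\<Oplus>\<^bsub>HH.P\<^esub>i\<in>{..<n}. lam (S h) (lam (S (v i)) (\<one>\<^bsub>H\<^esub> \<diamondop> (u i \<otimes>\<^bsub>H\<^esub> g))))"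
      by (rule HH.P_sum_cong) (use gh uv in \<open>simp_all add: \<Psi>(2) S_mult S_closed lam_mult lam_closed\<close>)
    also have "\<dots> = lam (S h) (S b \<diamondop> g)"
      using gh uv by (simp add: lam_lmul_sum[symmetric] S_closed lam_closed sum)
    also have "\<dots> = HH.rmul (S b) \<one>\<^bsub>H\<^esub> (\<Psi> (g \<diamondop> h))"
      using gh b by (simp add: \<Psi>(2) lam_rmul[symmetric] S_closed HH.rmul_tens)
    finally show "\<Psi> (lam b (g \<diamondop> h)) = HH.rmul (S b) \<one>\<^bsub>H\<^esub> (\<Psi> (g \<diamondop> h))" .
  qed (rule p)
  note \<Psi>_closed = additive_map_closed[OF \<Psi>(1)]
    and \<Psi>_minus = additive_map_minus[OF HH.P.abelian_group_axioms HH.P.abelian_group_axioms \<Psi>(1)]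
  have claim: "\<Psi> (lam b p) = HH.rmul (S b) \<one>\<^bsub>H\<^esub> (\<Psi> p)" if "b \<in> carrier H" "p \<in> carrier HH.P" for b p
    using that
  proof (induction arbitrary: p rule: H_induct)
    case (el a)
    \<comment> \<open>Here the generator that balancing moves is \<open>hel a\<close>; it arrives in
      the first factor as \<open>hbar a\<close>.\<close>
    show ?case
      by (rule gen[OF _ lam_gens(1)[unfolded HH.el_mul_def] HH.takeuchi_el])
        (use el in \<open>simp_all add: HH.cl S_gens S_one lam_one HH.sum_lessThan_1 HH.tn_balanced[of "\<one>\<^bsub>H\<^esub>" a, simplified, symmetric]
          del: One_nat_def\<close>)
  next
    case (bar a)
    show ?case
      by (rule gen[OF _ lam_gens(2)[unfolded HH.bar_mul_def] HH.takeuchi_bar])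
        (use bar in \<open>simp_all add: HH.cl S_gens lam_gens HH.el_mul_tens HH.sum_lessThan_1 del: One_nat_def\<close>)
  next
    case (xw x w)
    have "(\<Oplus>\<^bsub>HH.P\<^esub>i\<in>{..<coev_len D}. lam (S (hxw (coev_x D i) w)) (\<one>\<^bsub>H\<^esub> \<diamondop> (hxw x (coev_w D i) \<otimes>\<^bsub>H\<^esub> g))) = hwx w x \<diamondop> g"
      if "g \<in> carrier H" for g
    proof -
      have "(\<Oplus>\<^bsub>HH.P\<^esub>i\<in>{..<coev_len D}. lam (S (hxw (coev_x D i) w)) (\<one>\<^bsub>H\<^esub> \<diamondop> (hxw x (coev_w D i) \<otimes>\<^bsub>H\<^esub> g)))
          = (\<Oplus>\<^bsub>HH.P\<^esub>i\<in>{..<coev_len D}. HH.wx_mul w (coev_x D i) (\<one>\<^bsub>H\<^esub> \<diamondop> (hxw x (coev_w D i) \<otimes>\<^bsub>H\<^esub> g)))"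
        by (rule HH.P_sum_cong)
          (use xw that in \<open>simp_all add: HH.cl S_gens lam_gens endo_closed[OF HH.wx_mul_endo]\<close>)
      then show ?thesis using HH.wx_mul_xw_tens'[OF xw(2,1) that, of "\<one>\<^bsub>H\<^esub>"] xw by (simp add: HH.cl)
    qed
    then show ?case
      by (intro gen[OF _ lam_gens(3)[unfolded HH.xw_mul_def] HH.takeuchi_xw])
        (use xw in \<open>simp_all add: HH.cl S_gens\<close>)
  next
    case (wx x w)
    have "(\<Oplus>\<^bsub>HH.P\<^esub>j\<in>{..<coevu_len D}. lam (S (hwx (coevu_r D j) x)) (\<one>\<^bsub>H\<^esub> \<diamondop> (hwx w (coevu_y D j) \<otimes>\<^bsub>H\<^esub> g))) = hxw x w \<diamondop> g"
      if "g \<in> carrier H" for g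
    proof -
      have "(\<Oplus>\<^bsub>HH.P\<^esub>j\<in>{..<coevu_len D}. lam (S (hwx (coevu_r D j) x)) (\<one>\<^bsub>H\<^esub> \<diamondop> (hwx w (coevu_y D j) \<otimes>\<^bsub>H\<^esub> g)))
          = (\<Oplus>\<^bsub>HH.P\<^esub>j\<in>{..<coevu_len D}. HH.xw_mul x (coevu_r D j) (\<one>\<^bsub>H\<^esub> \<diamondop> (hwx w (coevu_y D j) \<otimes>\<^bsub>H\<^esub> g)))"
        by (rule HH.P_sum_cong)
          (use wx that in \<open>simp_all add: HH.cl S_gens lam_gens endo_closed[OF HH.xw_mul_endo]\<close>)
      then show ?thesis using HH.xw_mul_wx_tens'[OF wx(2,1) that, of "\<one>\<^bsub>H\<^esub>"] wx by (simp add: HH.cl)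
    qed
    then show ?case
      by (intro gen[OF _ lam_gens(4)[unfolded HH.wx_mul_def] HH.takeuchi_wx])
        (use wx in \<open>simp_all add: HH.cl S_gens\<close>)
  next
    case (minus g h)
    then show ?case
      using additive_map_minus[OF H.is_abelian_group HH.P.abelian_group_axioms HH.rmul_additive_fst[OF H.one_closed \<Psi>_closed]]
      by (simp add: lam_minus_left \<Psi>_minus lam_closed S_minus S_closed)
  next
    case (mult g h)
    then show ?case by (simp add: lam_mult lam_closed HH.rmul_rmul S_closed S_mult \<Psi>_closed)
  qed
  have "\<Psi> (cop b) = S b \<diamondop> \<one>\<^bsub>H\<^esub>" if "b \<in> carrier H" for b
    using that claim[OF that, of "\<one>\<^bsub>H\<^esub> \<diamondop> \<one>\<^bsub>H\<^esub>"] by (simp add: cop_def \<Psi>(2) S_one lam_one HH.rmul_tens S_closed)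
  with that \<Psi> show ?thesis by blast
qed

lemma inv_into_S: "b \<in> carrier H \<Longrightarrow> inv_into (carrier H) S b = S b"
  by (rule inv_into_f_eq[OF inj_on_inverseI[of _ S S]]) (simp_all add: S_closed S_involutive)

lemma BS_antipode_S: "BS_antipode A H hel hbar cop S"
  unfolding BS_antipode_def Let_def
proof (intro conjI allI impI ballI)
  show "S (hbar a) = hel a" if "a \<in> carrier A" for a using that by (rule S_gens)
  fix \<sigma> b f assume \<sigma>: "\<forall>b\<in>carrier H. \<sigma> b \<in> cop b" and b: "b \<in> carrier H" and f: "f \<in> cop b"
  note f' = HH.P_representative[OF cop_closed[OF b] f]
  have \<sigma>': "Poly_Mapping.keys (\<sigma> c) \<subseteq> carrier H \<times> carrier H" "tens_cls A HH.M HH.M (\<sigma> c) = cop c"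
    if "c \<in> carrier H" for c
    using HH.P_representative[OF cop_closed[OF that]] \<sigma> that by blast+
  \<comment> \<open>The antipode conditions multiply only one leg. Inserting a unit in the other
    makes the inner sums instances of \<open>tens_cls_rmul\<close>.\<close>
  have part: "frag_extend (\<lambda>(c, d). frag_of (c \<otimes>\<^bsub>H\<^esub> g, d)) (\<sigma> k)
      = frag_extend (\<lambda>(c, d). frag_of (c \<otimes>\<^bsub>H\<^esub> g, d \<otimes>\<^bsub>H\<^esub> \<one>\<^bsub>H\<^esub>)) (\<sigma> k)"
    "frag_extend (\<lambda>(c, d). frag_of (c, d \<otimes>\<^bsub>H\<^esub> g)) (\<sigma> k)
      = frag_extend (\<lambda>(c, d). frag_of (c \<otimes>\<^bsub>H\<^esub> \<one>\<^bsub>H\<^esub>, d \<otimes>\<^bsub>H\<^esub> g)) (\<sigma> k)"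
    if "k \<in> carrier H" for g k
    using \<sigma>'(1)[OF that] by (auto intro!: frag_extend_eq)
  have keys: "Poly_Mapping.keys (frag_extend (\<lambda>(c, d). frag_of (c \<otimes>\<^bsub>H\<^esub> g, d \<otimes>\<^bsub>H\<^esub> h)) (\<sigma> k)) \<subseteq> carrier H \<times> carrier H"
    if "k \<in> carrier H" "g \<in> carrier H" "h \<in> carrier H" for g h k
    by (rule order_trans[OF keys_frag_extend]) (use \<sigma>'(1)[OF that(1)] that in \<open>auto simp: case_prod_unfold\<close>)
  obtain \<Psi> where \<Psi>: "additive_map HH.P HH.P \<Psi>"
    "\<And>g h. \<lbrakk>g \<in> carrier H; h \<in> carrier H\<rbrakk> \<Longrightarrow> \<Psi> (g \<diamondop> h) = lam (S g) (h \<diamondop> \<one>\<^bsub>H\<^esub>)"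
    "\<And>b. b \<in> carrier H \<Longrightarrow> \<Psi> (cop b) = \<one>\<^bsub>H\<^esub> \<diamondop> S b"
    by (rule BS_left) (rule_tac that)
  have "tens_cls A HH.M HH.M (frag_extend (\<lambda>(b1, b2). frag_extend (\<lambda>(c1, c2). frag_of (c1 \<otimes>\<^bsub>H\<^esub> b2, c2)) (\<sigma> (S b1))) f)
      = \<Psi> (tens_cls A HH.M HH.M f)"
    by (rule HH.tens_cls_frag_extend[OF f'(1) \<Psi>(1)])
      (simp_all add: part keys S_closed HH.tens_cls_rmul \<sigma>' \<Psi>(2) lam_tens)
  then show "tens_cls A HH.M HH.M (frag_extend (\<lambda>(b1, b2). frag_extend (\<lambda>(c1, c2). frag_of (c1 \<otimes>\<^bsub>H\<^esub> b2, c2)) (\<sigma> (S b1))) f)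
      = \<one>\<^bsub>H\<^esub> \<diamondop> S b"
    by (simp add: f'(2) \<Psi>(3) b)
  obtain \<Psi>' where \<Psi>': "additive_map HH.P HH.P \<Psi>'"
    "\<And>g h. \<lbrakk>g \<in> carrier H; h \<in> carrier H\<rbrakk> \<Longrightarrow> \<Psi>' (g \<diamondop> h) = lam (S h) (\<one>\<^bsub>H\<^esub> \<diamondop> g)"
    "\<And>b. b \<in> carrier H \<Longrightarrow> \<Psi>' (cop b) = S b \<diamondop> \<one>\<^bsub>H\<^esub>"
    by (rule BS_right) (rule_tac that)
  have "tens_cls A HH.M HH.M (frag_extend (\<lambda>(b1, b2). frag_extend (\<lambda>(c1, c2). frag_of (c1, c2 \<otimes>\<^bsub>H\<^esub> b1))
        (\<sigma> (inv_into (carrier H) S b2))) f) = \<Psi>' (tens_cls A HH.M HH.M f)"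
    by (rule HH.tens_cls_frag_extend[OF f'(1) \<Psi>'(1)])
      (simp_all add: part keys inv_into_S S_closed HH.tens_cls_rmul \<sigma>' \<Psi>'(2) lam_tens)
  then show "tens_cls A HH.M HH.M (frag_extend (\<lambda>(b1, b2). frag_extend (\<lambda>(c1, c2). frag_of (c1, c2 \<otimes>\<^bsub>H\<^esub> b1))
        (\<sigma> (inv_into (carrier H) S b2))) f) = inv_into (carrier H) S b \<diamondop> \<one>\<^bsub>H\<^esub>"
    by (simp add: f'(2) \<Psi>'(3) b inv_into_S)
qed

lemma S_iso: "S \<in> ring_iso H (opp H)"
proof -
  have "bij_betw S (carrier H) (carrier H)"
    by (rule bij_betwI[where g = S]) (auto simp: S_closed S_involutive)
  then show ?thesis using S_hom by (simp add: ring_iso_def)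
qed

lemma S_antihom: "alg_antihom K A H hel S"
proof -
  have "S (hel (scalar A k) \<otimes>\<^bsub>H\<^esub> b) = hel (scalar A k) \<otimes>\<^bsub>H\<^esub> S b" if "k \<in> carrier K" "b \<in> carrier H" for k b
    using that
    by (simp add: S_mult hel_closed Om.scalar_closed S_gens HH.el_scalar[symmetric] scalar_central_H S_closed)
  then show ?thesis using S_hom by (simp add: alg_antihom_def)
qed

lemma S_antipode_gens: "H_antipode_gens K A Om X D S"
  by (simp add: H_antipode_gens_def S_gens)

end

end

theorem theorem4p11:
  fixes K :: "('k, 'kk) ring_scheme" and A :: "('k, 'a, 'aa) module_scheme"
    and Om :: "('a, 'w, 'ww) bimod_scheme" and X :: "('a, 'x, 'xx) bimod_scheme"
    and D :: "('a, 'w, 'x) dual_data"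
  assumes "unital_algebra K A"
    and "algebra_bimodule K A Om" and "algebra_bimodule K A X"
    and "pivotal A Om" and "pivotal_dual A Om X D"
  shows "let H = H_alg K A Om X D; el = H_el K A Om X D; bar = H_bar K A Om X D;
             extends = (\<lambda>S. alg_antihom K A H el S \<and> H_antipode_gens K A Om X D S)
         in \<exists>S. extends S \<and>
              (\<forall>S'. extends S' \<longrightarrow> (\<forall>b\<in>carrier H. S' b = S b)) \<and>
              S \<in> ring_iso H (opp H) \<and>
              (\<forall>b\<in>carrier H. inv_into (carrier H) S b = S b) \<and>
              BS_antipode A H el bar (H_coproduct K A Om X D) S"
proof -
  interpret dual_bimodules K A Om X D
    by (rule dual_bimodules.intro[OF assms(2,3)]) (rule dual_bimodules_axioms.intro[OF assms(5)])
  obtain S where S: "S \<in> ring_hom H (opp H)"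
    "\<And>a. a \<in> carrier A \<Longrightarrow> S (hel a) = hbar a" "\<And>a. a \<in> carrier A \<Longrightarrow> S (hbar a) = hel a"
    "\<And>x w. \<lbrakk>x \<in> carrier X; w \<in> carrier Om\<rbrakk> \<Longrightarrow> S (hxw x w) = hwx w x"
    "\<And>x w. \<lbrakk>x \<in> carrier X; w \<in> carrier Om\<rbrakk> \<Longrightarrow> S (hwx w x) = hxw x w"
    by (rule antipode_exists) (rule_tac that)
  show ?thesis
    unfolding Let_def H_coproduct_eq
    using S_antihom[OF S] S_antipode_gens[OF S] S_iso[OF S] BS_antipode_S[OF S]
      inv_into_S[OF S] S_unique[OF S] unfolding alg_antihom_def by blast
qed

end
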